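(* Let $\mathcal A$ be an indexing collection of finite dimension $p=\dim\mathcal A$ on $\mathcal T$, with compatible metric $d_{\mathcal A}$ and reference measure $m$, let $X$ be an $L^2$ set-indexed Lévy process with cancelled drift, $f:\mathcal T\to\mathbb R$ a locally $X$-integrable function and $Y=\{Y_A:A\in\mathcal A\}$, $Y_A=\int_A f\,dX$, all as in the context. Let $A=A(t)\in\mathcal A$. Suppose that $\sigma^2=0$ and that $f$ is bounded in the neighborhood of $A$ (i.e. $\sup_{s\in B_{\mathcal T}(t,\rho_0)}|f(s)|<\infty$ for some $\rho_0>0$). Then, with probability one, $$\sup_{(\alpha,q,q')\in\underline R'_f(A)}\min\left\{\frac q\beta,\ \frac{q'}\beta+\alpha\right\}\ \le\ \alpha_{Y,d_{\mathcal T}}(A)\ \le\ \inf_{(\alpha,q)\in\overline R'_f(A)}\left\{\frac q\beta+\alpha\right\},$$ with the conventions $\inf\varnothing=1/0=+\infty$.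
   Context: Indexing collection. $\mathcal T$ is a non-empty set. $\mathcal A\subseteq\mathcal P(\mathcal T)$ is an indexing collection on $\mathcal T$ if: (1) $\varnothing\in\mathcal A$, and $\mathcal A$ and $\mathcal A\setminus\{\varnothing\}$ are closed under countable intersections; (2) there is an increasing sequence of finite subcollections $\mathcal A_n\subseteq\mathcal A$ ($n\in\mathbb N$), each closed under intersections, such that with $g_n(A)=\bigcap\{A'\in\mathcal A_n\cup\{\mathcal T\}:A\subseteq A'\}$ one has $A=\bigcap_n g_n(A)$ for all $A\in\mathcal A$; (3) (SHAPE) if $A,A_1,\dots,A_n\in\mathcal A$ and $A\subseteq\bigcup_{i\le n}A_i$ then $A\subseteq A_j$ for some $j$; (4) (TIP) the map $t\mapsto A(t)=\bigcap_nA_n(t)$, with $A_n(t)=\bigcap\{A\in\mathcal A_n\cup\{\mathcal T\}:t\in A\}$, is a bijection from $\mathcal T$ onto $\mathcal A\setminus\{\varnothing\}$. The sequence $(\mathcal A_n)$ is fixed, and $\varnothing$ and $\varnothing'=\bigcap_{A\in\mathcal A,A\ne\varnothing}A$ are assumed to belong to every $\mathcal A_n$. $\mathcal B=\sigma(\mathcal A)$. Classes. For a class $\mathcal D$ of sets, $\mathcal D(u)$ is the class of finite unions of its elements. $\mathcal C=\{A\setminus U:A\in\mathcal A,U\in\mathcal A(u)\}$; $\mathcal C_k=\{A_0\setminus\bigcup_{i=1}^{k+1}A_i:A_0,\dots,A_{k+1}\in\mathcal A\}$. $\mathcal C^\ell(\mathcal A_n)$ is the collection of sets $A\setminus\bigcup_{A'\in\mathcal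 A_n,A'\subsetneq A}A'$, $A\in\mathcal A_n$; $\mathcal C^\ell=\bigcup_n\mathcal C^\ell(\mathcal A_n)$. For $h:\mathcal A\to\mathbb R$ with $h(\varnothing)=0$, $\Delta h:\mathcal C(u)\to\mathbb R$ is its unique additive extension (additive on disjoint unions). Finite dimension. There is $p\in\mathbb N^*$ such that every $(\mathcal A_n,\subseteq)$ admits an order embedding into $\mathbb N^p$ with the componentwise order, and $\mathcal C^\ell\subseteq\mathcal C_{p-1}$; the least such $p$ is $\dim\mathcal A$. Compatible metric. A pseudo-metric $d_{\mathcal A}$ on $\mathcal A$ ("metric" for short), transported to $\mathcal T$ by $d_{\mathcal T}(s,t)=d_{\mathcal A}(A(s),A(t))$, is (set-indexed) compatible if: (i) $d_{\mathcal A}(A\cap A'',A'\cap A'')\le d_{\mathcal A}(A,A')$; (ii) $d_{\mathcal A}(A_n,\bigcap_kA_k)\to0$ for every non-increasing sequence $(A_n)$ in $\mathcal A$; (iii) $\max_{C\in\mathcal C^\ell(\mathcal A_n)}\mathrm{diam}(C)\to0$ as $n\to\infty$, where $\mathrm{diam}(C)=\sup_{s,s'\in C}d_{\mathcal T}(s,s')$; (iv) for $A\subseteq A'$ in $\mathcal A$ there is $A''\in\mathcal A$ with $A\subseteq A''\subseteq A'$ and $d_{\mathcal A}(A,A'')=d_{\mathcal A}(A'',A')=d_{\mathcal A}(A,A')/2$. Open balls for $d_{\mathcal A},d_{\mathcal T}$ are denoted $B_{\mathcal A},B_{\mathcal T}$. A compatible metric $d_{\mathcal A}$ is fixed. $m$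 is a measure on $(\mathcal T,\mathcal B)$, finite on $\mathcal A$, such that $d_m(A,A')=m(A\triangle A')$ is also compatible. Metric on $\mathcal C$. Every $C\in\mathcal C$ has an extremal representation $C=A_0\setminus\bigcup_{i=1}^nA_i$ with $A_i\subseteq A_0$ for all $i$ and $A_i\subseteq A_j\Rightarrow i=j$ for $i,j\ge1$, unique up to relabelling $A_1,\dots,A_n$. $d_{\mathcal C}(C,C')$ is the Hausdorff distance, for $d_{\mathcal A}$, between the finite sets $\{A_0,\dots,A_n\}$ and $\{A'_0,\dots,A'_{n'}\}$ of the extremal representations of $C$ and $C'$; $B_{\mathcal C}$ denotes its open balls. The processes. $(\Omega,\mathcal F,\mathbf P)$ is a complete probability space. $\sigma\ge0$, $\nu$ is a Borel measure on $\mathbb R$ with $\nu(\{0\})=0$ and $\int x^2\,\nu(dx)<\infty$. $B=\{B_A\}$ is a centered Gaussian process with $\mathbf E[B_{A_1}B_{A_2}]=m(A_1\cap A_2)$, and $\widetilde\Pi$ is an independent Poisson random set on $\mathcal T\times\mathbb R$ with intensity $m\otimes\nu$. For measurable $g:\mathcal T\to\mathbb R$ and $\varepsilon>0$, $$\int_Ag\,d\widetilde N^\varepsilon=\sum_{(t,J)\in\widetilde\Pi,\ t\in A,\ |J|\ge\varepsilon}g(t)J,\qquad \int_Ag\,dN^\varepsilon=\int_Ag\,d\widetilde N^\varepsilon-\int_Ag\,dm\int_{\varepsilon\le|x|\le1}x\,\nu(dx),$$ and $\int_Ag\,dN$ (resp. $\int_Ag\,d\widetilde N$ when $\int_{|x|\le1}|x|\nu(dx)<\infty$)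 is the limit as $\varepsilon\to0^+$, which holds almost surely uniformly over $\{A'\in\mathcal A:A'\subseteq A\}$ for each $A\in\mathcal A$. $\int_Ag\,dB$ is the Wiener integral. Drifts are cancelled: $X_A=\sigma B_A+\int_A1\,dN$ and $Y_A=\sigma\int_Af\,dB+\int_Af\,dN$ if $\int_{|x|\le1}|x|\nu(dx)=\infty$; the same with $\widetilde N$ in place of $N$ if $\int_{|x|\le1}|x|\nu(dx)<\infty$. Thus $X$ has Lévy–Khintchine triplet $(b,\sigma^2,\nu)$ (truncation $\mathbf 1_{|x|\le1}$) with $b=0$, resp. $b=\int_{|x|\le1}x\,\nu(dx)$. $f$ is locally $X$-integrable: it is $\mathcal B$-measurable and for every $A\in\mathcal A$, $g=f\mathbf 1_A$ satisfies $(b+\int_{|x|>1}x\,\nu(dx))^2\|g\|_{L^1(m)}^2+(\sigma^2+\int x^2\nu(dx))\|g\|_{L^2(m)}^2<\infty$ (with $0\times\infty=0$). $d_{\mathcal T}$-localized exponent (convention $\sup\varnothing=0$), with $p=\dim\mathcal A$: $$\alpha_{h,d_{\mathcal T}}(A)=\sup\Big\{\alpha\ge0:\limsup_{\rho\to0^+}\ \sup_{C\in\mathcal C_{p-1}\cap B_{\mathcal C}(A,\rho),\ \mathrm{diam}(C)<\rho}\frac{|\Delta h(C)|}{\rho^\alpha}<\infty\Big\}.$$ Blumenthal–Getoor exponent: $\beta=\inf\{\delta>0:\int_{|x|\le1}|x|^\delta\nu(dx)<\infty\}$. For $A=A(t)$, $\alpha\ge0$, $\rho>0$: $L'_{f,\alpha}(A)=\{s\in\mathcal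 T:|f(s)|>d_{\mathcal T}(s,t)^\alpha\}$, $L'_{f,\alpha}(A,\rho)=B_{\mathcal T}(t,\rho)\cap L'_{f,\alpha}(A)$, $L'^{\complement}_{f,\alpha}(A,\rho)=B_{\mathcal T}(t,\rho)\setminus L'_{f,\alpha}(A)$, $$\overline R'_f(A)=\Big\{(\alpha,q)\in\mathbb R_+^2:\liminf_{\rho\to0^+}\frac{m(L'_{f,\alpha}(A,\rho))}{\rho^q}>0\Big\},$$ $$\underline R'_f(A)=\Big\{(\alpha,q,q')\in\mathbb R_+^3:\limsup_{\rho\to0^+}\Big[\frac{m(L'_{f,\alpha}(A,\rho))}{\rho^q}+\frac{m(L'^{\complement}_{f,\alpha}(A,\rho))}{\rho^{q'}}\Big]<\infty\Big\}.$$
   Formalization: When β = 0, the quotient 0/0, which the convention 1/0 = +∞ does not settle, is read as 0 in the lower bound and as +∞ in the upper bound; no single value makes both inequalities true. *)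

theory Defs
  imports "HOL-Probability.Probability"
begin

section \<open>Indexing collections\<close>

definition hull_approx :: "'a set \<Rightarrow> (nat \<Rightarrow> 'a set set) \<Rightarrow> nat \<Rightarrow> 'a set \<Rightarrow> 'a set" where
  "hull_approx \<T> An n A = \<Inter>{A' \<in> An n \<union> {\<T>}. A \<subseteq> A'}"

definition point_approx :: "'a set \<Rightarrow> (nat \<Rightarrow> 'a set set) \<Rightarrow> nat \<Rightarrow> 'a \<Rightarrow> 'a set" where
  "point_approx \<T> An n t = \<Inter>{A \<in> An n \<union> {\<T>}. t \<in> A}"

definition point_set :: "'a set \<Rightarrow> (nat \<Rightarrow> 'a set set) \<Rightarrow> 'a \<Rightarrow> 'a set" where
  "point_set \<T> An t = (\<Inter>n. point_approx \<T> An n t)"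

definition indexing_collection ::
  "'a set \<Rightarrow> 'a set set \<Rightarrow> (nat \<Rightarrow> 'a set set) \<Rightarrow> bool" where
  "indexing_collection \<T> \<A> An \<longleftrightarrow>
     \<T> \<noteq> {} \<and> \<A> \<subseteq> Pow \<T> \<and> {} \<in> \<A> \<and>
     (\<forall>S. S \<noteq> {} \<and> countable S \<and> S \<subseteq> \<A> \<longrightarrow> \<Inter>S \<in> \<A>) \<and>
     (\<forall>S. S \<noteq> {} \<and> countable S \<and> S \<subseteq> \<A> - {{}} \<longrightarrow> \<Inter>S \<in> \<A> - {{}}) \<and>
     incseq An \<and>
     (\<forall>n. finite (An n) \<and> An n \<subseteq> \<A> \<and> {} \<in> An n \<and> \<Inter>(\<A> - {{}}) \<in> An n \<and>
          (\<forall>A\<in>An n. \<forall>A'\<in>An n. A \<inter> A' \<in> An n)) \<and>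
     (\<forall>A\<in>\<A>. A = (\<Inter>n. hull_approx \<T> An n A)) \<and>
     \<comment> \<open>SHAPE\<close>
     (\<forall>A\<in>\<A>. \<forall>F. finite F \<and> F \<noteq> {} \<and> F \<subseteq> \<A> \<and> A \<subseteq> \<Union>F \<longrightarrow> (\<exists>A'\<in>F. A \<subseteq> A')) \<and>
     \<comment> \<open>TIP\<close>
     bij_betw (point_set \<T> An) \<T> (\<A> - {{}})"

definition finite_unions :: "'a set set \<Rightarrow> 'a set set" where
  "finite_unions D = {\<Union>F | F. finite F \<and> F \<subseteq> D}"

definition class_C :: "'a set set \<Rightarrow> 'a set set" where
  "class_C \<A> = {A - U | A U. A \<in> \<A> \<and> U \<in> finite_unions \<A>}"

definition class_Ck :: "'a set set \<Rightarrow> nat \<Rightarrow> 'a set set" where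
  "class_Ck \<A> k = {A 0 - (\<Union>i\<in>{1..k + 1}. A i) | A. \<forall>i\<le>k + 1. A i \<in> \<A>}"

definition left_nbhds :: "'a set set \<Rightarrow> 'a set set" where
  "left_nbhds D = {A - \<Union>{A' \<in> D. A' \<subset> A} | A. A \<in> D}"

definition additive_extension ::
  "'a set set \<Rightarrow> ('a set \<Rightarrow> real) \<Rightarrow> ('a set \<Rightarrow> real) \<Rightarrow> bool" where
  "additive_extension \<A> h g \<longleftrightarrow>
     g \<in> extensional (finite_unions (class_C \<A>)) \<and>
     (\<forall>A\<in>\<A>. g A = h A) \<and>
     (\<forall>U\<in>finite_unions (class_C \<A>). \<forall>V\<in>finite_unions (class_C \<A>).
        U \<inter> V = {} \<longrightarrow> g (U \<union> V) = g U + g V)"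

definition Delta :: "'a set set \<Rightarrow> ('a set \<Rightarrow> real) \<Rightarrow> 'a set \<Rightarrow> real" where
  "Delta \<A> h = (THE g. additive_extension \<A> h g)"

subsection \<open>Dimension\<close>

definition order_embeds_nat :: "nat \<Rightarrow> 'a set set \<Rightarrow> bool" where
  "order_embeds_nat p D \<longleftrightarrow>
     (\<exists>\<phi> :: 'a set \<Rightarrow> nat \<Rightarrow> nat. \<forall>A\<in>D. \<forall>A'\<in>D. A \<subseteq> A' \<longleftrightarrow> (\<forall>i<p. \<phi> A i \<le> \<phi> A' i))"

definition admissible_dim :: "'a set set \<Rightarrow> (nat \<Rightarrow> 'a set set) \<Rightarrow> nat \<Rightarrow> bool" where
  "admissible_dim \<A> An p \<longleftrightarrow>
     p \<ge> 1 \<and> (\<forall>n. order_embeds_nat p (An n)) \<and> (\<Union>n. left_nbhds (An n)) \<subseteq> class_Ck \<A> (p - 1)"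

definition finite_dim :: "'a set set \<Rightarrow> (nat \<Rightarrow> 'a set set) \<Rightarrow> bool" where
  "finite_dim \<A> An \<longleftrightarrow> (\<exists>p. admissible_dim \<A> An p)"

definition ic_dim :: "'a set set \<Rightarrow> (nat \<Rightarrow> 'a set set) \<Rightarrow> nat" where
  "ic_dim \<A> An = (LEAST p. admissible_dim \<A> An p)"

section \<open>Metrics\<close>

definition pseudo_metric_on :: "'b set \<Rightarrow> ('b \<Rightarrow> 'b \<Rightarrow> real) \<Rightarrow> bool" where
  "pseudo_metric_on S d \<longleftrightarrow>
     (\<forall>x\<in>S. \<forall>y\<in>S. 0 \<le> d x y \<and> d x y = d y x) \<and> (\<forall>x\<in>S. d x x = 0) \<and>
     (\<forall>x\<in>S. \<forall>y\<in>S. \<forall>z\<in>S. d x z \<le> d x y + d y z)"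

definition point_dist ::
  "'a set \<Rightarrow> (nat \<Rightarrow> 'a set set) \<Rightarrow> ('a set \<Rightarrow> 'a set \<Rightarrow> real) \<Rightarrow> 'a \<Rightarrow> 'a \<Rightarrow> real" where
  "point_dist \<T> An d s t = d (point_set \<T> An s) (point_set \<T> An t)"

definition point_ball ::
  "'a set \<Rightarrow> (nat \<Rightarrow> 'a set set) \<Rightarrow> ('a set \<Rightarrow> 'a set \<Rightarrow> real) \<Rightarrow> 'a \<Rightarrow> real \<Rightarrow> 'a set" where
  "point_ball \<T> An d t \<rho> = {s \<in> \<T>. point_dist \<T> An d t s < \<rho>}"

text \<open>The value may be infinite, and it is 0 for the empty set.\<close>

definition point_diam ::
  "'a set \<Rightarrow> (nat \<Rightarrow> 'a set set) \<Rightarrow> ('a set \<Rightarrow> 'a set \<Rightarrow> real) \<Rightarrow> 'a set \<Rightarrow> ennreal" where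
  "point_diam \<T> An d C = (SUP s\<in>C. SUP s'\<in>C. ennreal (point_dist \<T> An d s s'))"

definition compatible_metric ::
  "'a set \<Rightarrow> 'a set set \<Rightarrow> (nat \<Rightarrow> 'a set set) \<Rightarrow> ('a set \<Rightarrow> 'a set \<Rightarrow> real) \<Rightarrow> bool" where
  "compatible_metric \<T> \<A> An d \<longleftrightarrow>
     pseudo_metric_on \<A> d \<and>
     (\<forall>A\<in>\<A>. \<forall>A'\<in>\<A>. \<forall>A''\<in>\<A>. d (A \<inter> A'') (A' \<inter> A'') \<le> d A A') \<and>
     (\<forall>S. range S \<subseteq> \<A> \<and> decseq S \<longrightarrow> (\<lambda>n. d (S n) (\<Inter>k. S k)) \<longlonglongrightarrow> 0) \<and>
     (\<lambda>n. SUP C\<in>left_nbhds (An n). point_diam \<T> An d C) \<longlonglongrightarrow> 0 \<and>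
     (\<forall>A\<in>\<A>. \<forall>A'\<in>\<A>. A \<subseteq> A' \<longrightarrow>
        (\<exists>A''\<in>\<A>. A \<subseteq> A'' \<and> A'' \<subseteq> A' \<and> d A A'' = d A A' / 2 \<and> d A'' A' = d A A' / 2))"

definition measure_dist :: "'a measure \<Rightarrow> 'a set \<Rightarrow> 'a set \<Rightarrow> real" where
  "measure_dist m A A' = measure m ((A - A') \<union> (A' - A))"

text \<open>
  Requiring \<open>{} \<notin> F\<close> excludes \<open>A - {}\<close> as a second extremal representation of \<open>A \<in> \<A>\<close>, so that
  \<open>A\<close> is represented by \<open>{A}\<close> alone. The empty set also equals \<open>A - A\<close> for every \<open>A\<close>; we fix its
  representation to be \<open>{{}}\<close>.
\<close>

definition extremal_rep :: "'a set set \<Rightarrow> 'a set \<Rightarrow> 'a set \<Rightarrow> 'a set set \<Rightarrow> bool" where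
  "extremal_rep \<A> C A0 F \<longleftrightarrow>
     A0 \<in> \<A> \<and> finite F \<and> F \<subseteq> \<A> \<and> {} \<notin> F \<and> C = A0 - \<Union>F \<and>
     (\<forall>A\<in>F. A \<subseteq> A0) \<and> (\<forall>A\<in>F. \<forall>A'\<in>F. A \<subseteq> A' \<longrightarrow> A = A')"

definition extremal_sets :: "'a set set \<Rightarrow> 'a set \<Rightarrow> 'a set set" where
  "extremal_sets \<A> C =
     (if C = {} then {{}} else (THE E. \<exists>A0 F. extremal_rep \<A> C A0 F \<and> E = insert A0 F))"

definition hausdorff_dist :: "('b \<Rightarrow> 'b \<Rightarrow> real) \<Rightarrow> 'b set \<Rightarrow> 'b set \<Rightarrow> real" where
  "hausdorff_dist d E F =
     max (MAX x\<in>E. MIN y\<in>F. d x y) (MAX y\<in>F. MIN x\<in>E. d x y)"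

definition class_C_dist ::
  "'a set set \<Rightarrow> ('a set \<Rightarrow> 'a set \<Rightarrow> real) \<Rightarrow> 'a set \<Rightarrow> 'a set \<Rightarrow> real" where
  "class_C_dist \<A> d C C' = hausdorff_dist d (extremal_sets \<A> C) (extremal_sets \<A> C')"

definition class_C_ball ::
  "'a set set \<Rightarrow> ('a set \<Rightarrow> 'a set \<Rightarrow> real) \<Rightarrow> 'a set \<Rightarrow> real \<Rightarrow> 'a set set" where
  "class_C_ball \<A> d C \<rho> = {C' \<in> class_C \<A>. class_C_dist \<A> d C C' < \<rho>}"

section \<open>Gaussian process, Wiener integral, Poisson random set\<close>

definition gaussian_rv :: "'w measure \<Rightarrow> ('w \<Rightarrow> real) \<Rightarrow> bool" where
  "gaussian_rv P Z \<longleftrightarrow>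
     Z \<in> borel_measurable P \<and>
     ((\<exists>a. AE \<omega> in P. Z \<omega> = a) \<or>
      (\<exists>\<mu> s. s > 0 \<and> distributed P lborel Z (\<lambda>x. ennreal (normal_density \<mu> s x))))"

definition set_indexed_BM ::
  "'w measure \<Rightarrow> 'a set set \<Rightarrow> 'a measure \<Rightarrow> ('a set \<Rightarrow> 'w \<Rightarrow> real) \<Rightarrow> bool" where
  "set_indexed_BM P \<A> m B \<longleftrightarrow>
     (\<forall>F c. finite F \<and> F \<subseteq> \<A> \<longrightarrow> gaussian_rv P (\<lambda>\<omega>. \<Sum>A\<in>F. c A * B A \<omega>)) \<and>
     (\<forall>A\<in>\<A>. (\<integral>\<omega>. B A \<omega> \<partial>P) = 0) \<and>
     (\<forall>A\<in>\<A>. \<forall>A'\<in>\<A>. (\<integral>\<omega>. B A \<omega> * B A' \<omega> \<partial>P) = measure m (A \<inter> A'))"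

text \<open>
  \<open>L\<^sup>2\<close>-limit of the integrals of linear combinations of indicators of sets in \<open>\<A>\<close>. It is
  determined up to a null set when \<open>g \<in> L\<^sup>2(m)\<close> and is unspecified otherwise.
\<close>

definition wiener_integral ::
  "'w measure \<Rightarrow> 'a set set \<Rightarrow> 'a measure \<Rightarrow> ('a set \<Rightarrow> 'w \<Rightarrow> real) \<Rightarrow> ('a \<Rightarrow> real) \<Rightarrow> 'w \<Rightarrow> real" where
  "wiener_integral P \<A> m B g = (SOME I. I \<in> borel_measurable P \<and>
     (\<exists>F c. (\<forall>k::nat. finite (F k) \<and> F k \<subseteq> \<A>) \<and>
        (\<lambda>k. \<integral>\<^sup>+ s. ennreal ((g s - (\<Sum>A\<in>F k. c k A * indicator A s))\<^sup>2) \<partial>m) \<longlonglongrightarrow> 0 \<and>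
        (\<lambda>k. \<integral>\<^sup>+ \<omega>. ennreal ((I \<omega> - (\<Sum>A\<in>F k. c k A * B A \<omega>))\<^sup>2) \<partial>P) \<longlonglongrightarrow> 0))"

definition num_points :: "('w \<Rightarrow> 'b set) \<Rightarrow> 'b set \<Rightarrow> 'w \<Rightarrow> ennreal" where
  "num_points \<Xi> D \<omega> = emeasure (count_space UNIV) (\<Xi> \<omega> \<inter> D)"

definition poisson_random_set :: "'w measure \<Rightarrow> 'b measure \<Rightarrow> ('w \<Rightarrow> 'b set) \<Rightarrow> bool" where
  "poisson_random_set P Q \<Xi> \<longleftrightarrow>
     (\<forall>\<omega>\<in>space P. countable (\<Xi> \<omega>) \<and> \<Xi> \<omega> \<subseteq> space Q) \<and>
     (\<forall>D\<in>sets Q. num_points \<Xi> D \<in> borel_measurable P) \<and>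
     (\<forall>D\<in>sets Q. emeasure Q D < \<top> \<longrightarrow>
        (\<forall>k. measure P {\<omega> \<in> space P. num_points \<Xi> D \<omega> = of_nat k} =
             exp (- measure Q D) * measure Q D ^ k / fact k)) \<and>
     (\<forall>D\<in>sets Q. emeasure Q D = \<top> \<longrightarrow> (AE \<omega> in P. num_points \<Xi> D \<omega> = \<top>)) \<and>
     (\<forall>(n::nat) D. (\<forall>i<n. D i \<in> sets Q) \<and> disjoint_family_on D {..<n} \<longrightarrow>
        prob_space.indep_vars P (\<lambda>_. borel) (\<lambda>i. num_points \<Xi> (D i)) {..<n})"

definition indep_BM_Poisson ::
  "'w measure \<Rightarrow> 'a set set \<Rightarrow> ('a set \<Rightarrow> 'w \<Rightarrow> real) \<Rightarrow> 'b measure \<Rightarrow> ('w \<Rightarrow> 'b set) \<Rightarrow> bool" where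
  "indep_BM_Poisson P \<A> B Q \<Xi> \<longleftrightarrow>
     prob_space.indep_set P
       (sigma_sets (space P) {B A -` S \<inter> space P | A S. A \<in> \<A> \<and> S \<in> sets borel})
       (sigma_sets (space P) {num_points \<Xi> D -` S \<inter> space P | D S. D \<in> sets Q \<and> S \<in> sets borel})"

section \<open>The set-indexed Levy process and its integrals\<close>

definition L2_levy_measure :: "real measure \<Rightarrow> bool" where
  "L2_levy_measure \<nu> \<longleftrightarrow>
     sets \<nu> = sets borel \<and> emeasure \<nu> {0} = 0 \<and> (\<integral>\<^sup>+ x. ennreal (x\<^sup>2) \<partial>\<nu>) < \<top>"

definition summable_small_jumps :: "real measure \<Rightarrow> bool" where
  "summable_small_jumps \<nu> \<longleftrightarrow> (\<integral>\<^sup>+ x\<in>{x. \<bar>x\<bar> \<le> 1}. ennreal \<bar>x\<bar> \<partial>\<nu>) < \<top>"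

definition triplet_drift :: "real measure \<Rightarrow> real" where
  "triplet_drift \<nu> =
     (if summable_small_jumps \<nu> then (LINT x:{x. \<bar>x\<bar> \<le> 1}|\<nu>. x) else 0)"

definition jump_integral_eps ::
  "'a measure \<Rightarrow> real measure \<Rightarrow> ('w \<Rightarrow> ('a \<times> real) set) \<Rightarrow> ('a \<Rightarrow> real) \<Rightarrow>
   real \<Rightarrow> 'a set \<Rightarrow> 'w \<Rightarrow> real" where
  "jump_integral_eps m \<nu> \<Xi> g \<epsilon> A \<omega> =
     (\<Sum>\<^sub>\<infinity>(s, x) \<in> {(s, x) \<in> \<Xi> \<omega>. s \<in> A \<and> \<epsilon> \<le> \<bar>x\<bar>}. g s * x) -
     (if summable_small_jumps \<nu> then 0
      else (LINT s:A|m. g s) * (LINT x:{x. \<epsilon> \<le> \<bar>x\<bar> \<and> \<bar>x\<bar> \<le> 1}|\<nu>. x))"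

text \<open>
  The integral against \<open>N\<close> (or its uncompensated version when the small jumps are summable) is the
  almost sure limit of the truncated integrals, uniformly over the sets of \<open>\<A>\<close> below any given one.
\<close>

definition jump_integral ::
  "'w measure \<Rightarrow> 'a set set \<Rightarrow> 'a measure \<Rightarrow> real measure \<Rightarrow> ('w \<Rightarrow> ('a \<times> real) set) \<Rightarrow>
   ('a \<Rightarrow> real) \<Rightarrow> ('a set \<Rightarrow> 'w \<Rightarrow> real) \<Rightarrow> bool" where
  "jump_integral P \<A> m \<nu> \<Xi> g L \<longleftrightarrow>
     (\<forall>A\<in>\<A>. AE \<omega> in P.
        uniform_limit {A' \<in> \<A>. A' \<subseteq> A}
          (\<lambda>\<epsilon> A'. jump_integral_eps m \<nu> \<Xi> g \<epsilon> A' \<omega>) (\<lambda>A'. L A' \<omega>) (at_right 0))"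

definition levy_process ::
  "'w measure \<Rightarrow> 'a set set \<Rightarrow> 'a measure \<Rightarrow> real \<Rightarrow> real measure \<Rightarrow> ('a set \<Rightarrow> 'w \<Rightarrow> real) \<Rightarrow>
   ('w \<Rightarrow> ('a \<times> real) set) \<Rightarrow> ('a set \<Rightarrow> 'w \<Rightarrow> real) \<Rightarrow> bool" where
  "levy_process P \<A> m \<sigma> \<nu> B \<Xi> X \<longleftrightarrow>
     (\<exists>L. jump_integral P \<A> m \<nu> \<Xi> (\<lambda>_. 1) L \<and>
          (\<forall>A\<in>\<A>. \<forall>\<omega>\<in>space P. X A \<omega> = \<sigma> * B A \<omega> + L A \<omega>))"

definition levy_integral ::
  "'w measure \<Rightarrow> 'a set set \<Rightarrow> 'a measure \<Rightarrow> real \<Rightarrow> real measure \<Rightarrow> ('a set \<Rightarrow> 'w \<Rightarrow> real) \<Rightarrow>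
   ('w \<Rightarrow> ('a \<times> real) set) \<Rightarrow> ('a \<Rightarrow> real) \<Rightarrow> ('a set \<Rightarrow> 'w \<Rightarrow> real) \<Rightarrow> bool" where
  "levy_integral P \<A> m \<sigma> \<nu> B \<Xi> f Y \<longleftrightarrow>
     (\<exists>L. jump_integral P \<A> m \<nu> \<Xi> f L \<and>
          (\<forall>A\<in>\<A>. \<forall>\<omega>\<in>space P.
             Y A \<omega> = \<sigma> * wiener_integral P \<A> m B (\<lambda>s. f s * indicator A s) \<omega> + L A \<omega>))"

text \<open>Multiplication in \<^typ>\<open>ennreal\<close> satisfies \<open>0 * \<infinity> = 0\<close>, as the definition requires.\<close>

definition locally_integrable ::
  "'a set set \<Rightarrow> 'a measure \<Rightarrow> real \<Rightarrow> real measure \<Rightarrow> ('a \<Rightarrow> real) \<Rightarrow> bool" where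
  "locally_integrable \<A> m \<sigma> \<nu> f \<longleftrightarrow>
     f \<in> borel_measurable m \<and>
     (\<forall>A\<in>\<A>.
        ennreal ((triplet_drift \<nu> + (LINT x:{x. \<bar>x\<bar> > 1}|\<nu>. x))\<^sup>2) *
          (\<integral>\<^sup>+ s. ennreal \<bar>f s * indicator A s\<bar> \<partial>m)\<^sup>2 +
        (ennreal (\<sigma>\<^sup>2) + (\<integral>\<^sup>+ x. ennreal (x\<^sup>2) \<partial>\<nu>)) *
          (\<integral>\<^sup>+ s. ennreal ((f s * indicator A s)\<^sup>2) \<partial>m) < \<top>)"

section \<open>Exponents\<close>

text \<open>\<^typ>\<open>ennreal\<close> provides \<open>Sup {} = 0\<close> and \<open>Inf {} = \<infinity>\<close>.\<close>

definition localized_exponent ::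
  "'a set \<Rightarrow> 'a set set \<Rightarrow> (nat \<Rightarrow> 'a set set) \<Rightarrow> ('a set \<Rightarrow> 'a set \<Rightarrow> real) \<Rightarrow>
   ('a set \<Rightarrow> real) \<Rightarrow> 'a set \<Rightarrow> ennreal" where
  "localized_exponent \<T> \<A> An d h A =
     Sup {ennreal \<alpha> | \<alpha>. \<alpha> \<ge> 0 \<and>
       Limsup (at_right 0) (\<lambda>\<rho>.
         SUP C\<in>{C \<in> class_Ck \<A> (ic_dim \<A> An - 1) \<inter> class_C_ball \<A> d A \<rho>.
                 point_diam \<T> An d C < ennreal \<rho>}.
           ennreal (\<bar>Delta \<A> h C\<bar> / \<rho> powr \<alpha>)) < \<top>}"

definition blumenthal_getoor :: "real measure \<Rightarrow> ennreal" where
  "blumenthal_getoor \<nu> =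
     Inf {ennreal \<delta> | \<delta>. \<delta> > 0 \<and> (\<integral>\<^sup>+ x\<in>{x. \<bar>x\<bar> \<le> 1}. ennreal (\<bar>x\<bar> powr \<delta>) \<partial>\<nu>) < \<top>}"

text \<open>\<^const>\<open>powr\<close> has \<open>0 powr 0 = 0\<close>; here \<open>0\<close> to the power \<open>0\<close> is \<open>1\<close>.\<close>

definition rpow :: "real \<Rightarrow> real \<Rightarrow> real" where
  "rpow x \<alpha> = (if \<alpha> = 0 then 1 else x powr \<alpha>)"

definition large_set ::
  "'a set \<Rightarrow> (nat \<Rightarrow> 'a set set) \<Rightarrow> ('a set \<Rightarrow> 'a set \<Rightarrow> real) \<Rightarrow> ('a \<Rightarrow> real) \<Rightarrow> 'a \<Rightarrow> real \<Rightarrow> 'a set" where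
  "large_set \<T> An d f t \<alpha> = {s \<in> \<T>. \<bar>f s\<bar> > rpow (point_dist \<T> An d s t) \<alpha>}"

definition upper_region ::
  "'a set \<Rightarrow> (nat \<Rightarrow> 'a set set) \<Rightarrow> ('a set \<Rightarrow> 'a set \<Rightarrow> real) \<Rightarrow> 'a measure \<Rightarrow> ('a \<Rightarrow> real) \<Rightarrow> 'a \<Rightarrow>
   (real \<times> real) set" where
  "upper_region \<T> An d m f t = {(\<alpha>, q). \<alpha> \<ge> 0 \<and> q \<ge> 0 \<and>
     Liminf (at_right 0) (\<lambda>\<rho>.
       emeasure m (point_ball \<T> An d t \<rho> \<inter> large_set \<T> An d f t \<alpha>) / ennreal (\<rho> powr q)) > 0}"

definition lower_region ::
  "'a set \<Rightarrow> (nat \<Rightarrow> 'a set set) \<Rightarrow> ('a set \<Rightarrow> 'a set \<Rightarrow> real) \<Rightarrow> 'a measure \<Rightarrow> ('a \<Rightarrow> real) \<Rightarrow> 'a \<Rightarrow>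
   (real \<times> real \<times> real) set" where
  "lower_region \<T> An d m f t = {(\<alpha>, q, q'). \<alpha> \<ge> 0 \<and> q \<ge> 0 \<and> q' \<ge> 0 \<and>
     Limsup (at_right 0) (\<lambda>\<rho>.
       emeasure m (point_ball \<T> An d t \<rho> \<inter> large_set \<T> An d f t \<alpha>) / ennreal (\<rho> powr q) +
       emeasure m (point_ball \<T> An d t \<rho> - large_set \<T> An d f t \<alpha>) / ennreal (\<rho> powr q')) < \<top>}"

text \<open>
  Quotients by the Blumenthal-Getoor exponent, with \<open>q / 0 = \<infinity>\<close> for \<open>q > 0\<close>. The quotient
  \<open>0 / 0\<close>, which the convention \<open>1 / 0 = \<infinity>\<close> does not settle, is \<open>0\<close> in the lower bound (this is the
  division of \<^typ>\<open>ennreal\<close>) and \<open>\<infinity>\<close> in the upper bound. No single value serves both: \<open>\<infinity>\<close> makes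
  the lower bound false when \<open>\<nu>\<close> is infinite with exponent \<open>0\<close> and the \<open>m\<close>-measure of small balls
  decays logarithmically, and \<open>0\<close> makes the upper bound false when \<open>\<nu> = 0\<close> and the pseudo-metric
  is identically 0.
\<close>

definition quot_lower :: "real \<Rightarrow> ennreal \<Rightarrow> ennreal" where
  "quot_lower q b = ennreal q / b"

definition quot_upper :: "real \<Rightarrow> ennreal \<Rightarrow> ennreal" where
  "quot_upper q b = (if b = 0 then \<top> else ennreal q / b)"

end

theory Submission
  imports Defs
begin

text \<open>
  The oscillation of \<open>Y\<close> near \<open>A(t)\<close> is governed by the jumps \<open>f(s) x\<close> of the Poisson set with
  location \<open>s\<close> in a small ball around \<open>t\<close>, since the sets \<open>C\<close> of the exponent at scale \<open>\<rho>\<close> lie in the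
  ball of radius \<open>2 \<rho>\<close>.

  Upper bound: the increments over the left neighbourhoods of a point \<open>s\<close> converge to the jump at
  \<open>s\<close>. If \<open>(\<alpha>, q)\<close> is in the upper region and \<open>q / \<kappa> < \<beta>\<close>, the set of pairs \<open>(s, x)\<close> with
  \<open>\<bar>f s\<bar> > r\<^sup>\<alpha>\<close> and \<open>\<bar>x\<bar> > r\<^sup>\<kappa>\<close>, where \<open>r\<close> is the distance from \<open>s\<close> to \<open>t\<close>, has infinite intensity,
  so that there are arbitrarily close jumps larger than \<open>r\<close> to the power \<open>\<alpha> + \<kappa>\<close>.

  Lower bound: for \<open>\<delta>\<close> slightly above \<open>\<beta>\<close> the \<open>\<delta>\<close>-th moment of the jumps located in the ball of
  radius \<open>\<rho>\<close> is of order \<open>\<rho>\<close> to the power \<open>min q (q' + \<alpha> \<delta>)\<close>, hence smaller than \<open>\<rho>\<^sup>\<gamma>\<^sup>\<delta>\<close>. With high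
  probability there is no jump above \<open>\<rho>\<^sup>\<gamma>\<close>, and the smaller jumps sum up to \<open>O(\<rho>\<^sup>\<gamma>)\<close>, by Markov's
  inequality if \<open>\<delta> \<le> 1\<close> and by a maximal inequality for the compensated sums otherwise. The embedding
  of \<open>An n\<close> in \<open>\<nat>\<^sup>p\<close> turns this into a \<open>p\<close>-parameter maximal inequality for independent variables,
  which follows from \<open>p\<close> applications of Etemadi's argument. Borel-Cantelli along dyadic radii concludes.
\<close>

section \<open>A maximal inequality\<close>

text \<open>The lower bound must control uncountably many sets with tools that see finitely many
  independent variables. Two discretizations bridge the gap: sets of \<open>\<A>\<close> are
  replaced by sets of \<open>An n\<close>, on which the order embedding acts, and truncated jumps
  are rounded to a finite grid, so that a compensated sum becomes a linear combination of Poisson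
  counts over disjoint cells. The bad events of the approximations need not be monotone; as they
  have a uniform probability bound, it is enough to discard their lim inf, outside of which
  infinitely many approximations are good. Passing from \<open>\<A>\<close> to the differences in
  \<open>class_Ck\<close> costs only a power of 2.

  The compensator is present exactly when the small jumps are not summable, and this fixes the side
  of 1 on which \<delta> has to lie. For one \<delta>, the probability of a jump above
  \<open>r\<close>, the Markov bound and the variance bound are all of order
  \<open>V / r powr \<delta>\<close>, with \<open>V\<close> the \<delta>-th moment, so that one
  power of the radius has to be summed.

  Two degeneracies recur: \<open>\<T>\<close> may lie in \<open>\<A>\<close> but in no
  \<open>An n\<close>, and \<open>d\<close> is only a pseudo-metric.\<close>

lemma (in prob_space) indep_vars_prob_inter:
  fixes X :: "'i \<Rightarrow> 'a \<Rightarrow> real"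
  assumes X: "indep_vars (\<lambda>_. borel) X J" and IK: "I \<inter> K = {}" "I \<subseteq> J" "K \<subseteq> J"
    and S: "S \<in> sets (PiM I (\<lambda>_. borel))" and S': "S' \<in> sets (PiM K (\<lambda>_. borel))"
  shows "prob {\<omega>\<in>space M. restrict (\<lambda>i. X i \<omega>) I \<in> S \<and> restrict (\<lambda>i. X i \<omega>) K \<in> S'} =
         prob {\<omega>\<in>space M. restrict (\<lambda>i. X i \<omega>) I \<in> S} *
         prob {\<omega>\<in>space M. restrict (\<lambda>i. X i \<omega>) K \<in> S'}"
  using indep_varD[OF indep_var_restrict[OF X IK] S S']
  by (simp add: vimage_def Collect_conj_eq[symmetric] conj_commute Int_def cong: conj_cong)

text \<open>Stop at the first level \<open>k\<close> at which a partial sum reaches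
  \<open>2 * r\<close>. The variables above that level are independent of this event. Either their
  sum stays below \<open>r\<close>, and then the full sum reaches \<open>r\<close>, or it does not,
  which multiplies the probability of the stopping event by at most \<eta>. The family
  \<open>QQ\<close> makes the step iterable: it stands for the restrictions imposed by the
  coordinates already treated.\<close>

lemma (in prob_space) etemadi_step:
  fixes X :: "'i \<Rightarrow> 'a \<Rightarrow> real" and l :: "'i \<Rightarrow> nat"
  assumes J: "finite J" and X: "indep_vars (\<lambda>_. borel) X J" and r: "r > 0"
    and QQ: "finite QQ"
    and bnd: "\<And>I. I \<subseteq> J \<Longrightarrow> prob {\<omega>\<in>space M. \<exists>q\<in>QQ. r \<le> \<bar>\<Sum>j\<in>I \<inter> q. X j \<omega>\<bar>} \<le> \<eta>"
  shows "prob {\<omega>\<in>space M. \<exists>k. \<exists>q\<in>QQ. 2 * r \<le> \<bar>\<Sum>j\<in>{j\<in>J. l j \<le> k} \<inter> q. X j \<omega>\<bar>} \<le> 2 * \<eta>"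
proof -
  define big where "big I c \<omega> \<longleftrightarrow> (\<exists>q\<in>QQ. c \<le> \<bar>\<Sum>j\<in>I \<inter> q. X j \<omega>\<bar>)" for I c \<omega>
  define Jk where "Jk k = {j\<in>J. l j \<le> k}" for k
  have Jk: "Jk k \<subseteq> J" "finite (Jk k)" for k using J by (auto simp: Jk_def)
  have X_meas: "X j \<in> borel_measurable M" if "j \<in> J" for j
    using X that by (auto simp: indep_vars_def)
  have meas: "{\<omega>\<in>space M. big I c \<omega>} \<in> events" if "I \<subseteq> J" for I c
  proof -
    have [measurable]: "(\<lambda>\<omega>. \<Sum>j\<in>I \<inter> q. X j \<omega>) \<in> borel_measurable M" for q
      using that by (intro borel_measurable_sum X_meas) auto
    have "{\<omega>\<in>space M. c \<le> \<bar>\<Sum>j\<in>I \<inter> q. X j \<omega>\<bar>} \<in> events" for q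
      by measurable
    then show ?thesis unfolding big_def by (intro sets.sets_Collect_finite_Ex QQ)
  qed
  \<comment> \<open>From level \<open>K\<close> on nothing is added to \<open>Jk\<close>, so that
    the first passage occurs at one of finitely many levels; the inserted 0 covers an empty
    \<open>J\<close>.\<close>
  define K where "K = Max (insert 0 (l ` J))"
  have JK: "Jk k = J" if "K \<le> k" for k
    using J that unfolding Jk_def K_def by (auto dest: order_trans[rotated])
  \<comment> \<open>First passage at level \<open>k\<close>. These events are disjoint, so their
    probabilities sum to at most 1 at the end.\<close>
  define E where "E k = {\<omega>\<in>space M. big (Jk k) (2 * r) \<omega> \<and> (\<forall>i<k. \<not> big (Jk i) (2 * r) \<omega>)}" for k
  define F where "F k = {\<omega>\<in>space M. big (J - Jk k) r \<omega>}" for k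
  have E_sets: "E k \<in> events" for k
  proof -
    have "E k = {\<omega>\<in>space M. big (Jk k) (2 * r) \<omega>} \<inter> (space M - (\<Union>i<k. {\<omega>\<in>space M. big (Jk i) (2 * r) \<omega>}))"
      by (auto simp: E_def)
    then show ?thesis using meas[OF Jk(1)] by auto
  qed
  have F_sets: "F k \<in> events" for k unfolding F_def by (rule meas) auto
  have EF: "prob (E k \<inter> F k) = prob (E k) * prob (F k)" for k
  proof -
    \<comment> \<open>\<open>bg\<close> is \<open>big\<close> read on the coordinate space. It
      exhibits \<open>E k\<close> and \<open>F k\<close> as events of the two disjoint blocks
      \<open>Jk k\<close> and \<open>J - Jk k\<close>.\<close>
    define bg where "bg I c x \<longleftrightarrow> (\<exists>q\<in>QQ. c \<le> \<bar>\<Sum>j\<in>I \<inter> q. x j\<bar>)" for I c and x :: "'i \<Rightarrow> real"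
    have bg_meas: "{x \<in> space (PiM I' (\<lambda>_. borel)). bg I c x} \<in> sets (PiM I' (\<lambda>_. borel))" if "I \<subseteq> I'" for I I' c
    proof -
      have [measurable]: "(\<lambda>x. \<Sum>j\<in>I \<inter> q. x j :: real) \<in> borel_measurable (PiM I' (\<lambda>_. borel))" for q
        using that by (intro borel_measurable_sum measurable_component_singleton) auto
      have "{x \<in> space (PiM I' (\<lambda>_. borel)). c \<le> \<bar>\<Sum>j\<in>I \<inter> q. x j :: real\<bar>} \<in> sets (PiM I' (\<lambda>_. borel))" for q
        by measurable
      then show ?thesis unfolding bg_def by (intro sets.sets_Collect_finite_Ex QQ)
    qed
    have bg_restrict: "bg I c (restrict (\<lambda>i. X i \<omega>) I') = big I c \<omega>" if "I \<subseteq> I'" for I I' c \<omega>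
    proof -
      have "(\<Sum>j\<in>I \<inter> q. restrict (\<lambda>i. X i \<omega>) I' j) = (\<Sum>j\<in>I \<inter> q. X j \<omega>)" for q
        using that by (intro sum.cong) auto
      then show ?thesis by (simp add: bg_def big_def)
    qed
    define S where "S = {x \<in> space (PiM (Jk k) (\<lambda>_. borel)). bg (Jk k) (2 * r) x} \<inter>
       (space (PiM (Jk k) (\<lambda>_. borel)) - (\<Union>i<k. {x \<in> space (PiM (Jk k) (\<lambda>_. borel)). bg (Jk i) (2 * r) x}))"
    define S' where "S' = {x \<in> space (PiM (J - Jk k) (\<lambda>_. borel)). bg (J - Jk k) r x}"
    have mono: "Jk i \<subseteq> Jk k" if "i < k" for i using that by (auto simp: Jk_def)
    have "S \<in> sets (PiM (Jk k) (\<lambda>_. borel))" unfolding S_def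
      using bg_meas[OF mono] bg_meas[OF order_refl, of "Jk k"] by auto
    moreover have "S' \<in> sets (PiM (J - Jk k) (\<lambda>_. borel))" unfolding S'_def by (rule bg_meas) auto
    moreover have sp: "restrict (\<lambda>i. X i \<omega>) I \<in> space (PiM I (\<lambda>_. borel))" for I \<omega>
      by (simp add: space_PiM)
    moreover have Ek: "E k = {\<omega>\<in>space M. restrict (\<lambda>i. X i \<omega>) (Jk k) \<in> S}"
      using sp bg_restrict[OF mono] bg_restrict[OF order_refl] by (auto simp: E_def S_def)
    moreover have Fk: "F k = {\<omega>\<in>space M. restrict (\<lambda>i. X i \<omega>) (J - Jk k) \<in> S'}"
      using sp bg_restrict[OF order_refl] by (auto simp: F_def S'_def)
    moreover have "E k \<inter> F k = {\<omega>\<in>space M. restrict (\<lambda>i. X i \<omega>) (Jk k) \<in> S \<and> restrict (\<lambda>i. X i \<omega>) (J - Jk k) \<in> S'}"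
      unfolding Ek Fk by blast
    ultimately show ?thesis
      using indep_vars_prob_inter[OF X, of "Jk k" "J - Jk k" S S'] Jk by (simp only:) auto
  qed
  have F_le: "prob (F k) \<le> \<eta>" for k unfolding F_def big_def by (rule bnd) auto
  have "\<eta> \<ge> 0" using F_le[of 0] measure_nonneg order_trans by blast
  have disj: "disjoint_family_on E {..K}"
    unfolding disjoint_family_on_def E_def by (auto) (metis nat_neq_iff)
  have sub: "{\<omega>\<in>space M. \<exists>k. big (Jk k) (2 * r) \<omega>} \<subseteq> {\<omega>\<in>space M. big J r \<omega>} \<union> (\<Union>k\<in>{..K}. E k \<inter> F k)"
  proof safe
    fix \<omega> k assume \<omega>: "\<omega> \<in> space M" and k: "big (Jk k) (2 * r) \<omega>"
      and nin: "\<omega> \<notin> (\<Union>k\<in>{..K}. E k \<inter> F k)"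
    define k' where "k' = (LEAST k. big (Jk k) (2 * r) \<omega>)"
    have k': "big (Jk k') (2 * r) \<omega>" unfolding k'_def by (rule LeastI) (rule k)
    have least: "\<not> big (Jk i) (2 * r) \<omega>" if "i < k'" for i using not_less_Least[of i] that unfolding k'_def by blast
    have "k' \<le> K"
    proof (rule ccontr)
      assume "\<not> k' \<le> K"
      then have "Jk k' = Jk K" using JK by simp
      then show False using least[of K] k' \<open>\<not> k' \<le> K\<close> by simp
    qed
    have "\<omega> \<in> E k'" using k' least \<omega> by (auto simp: E_def)
    then have nF: "\<not> big (J - Jk k') r \<omega>" using nin \<open>k' \<le> K\<close> \<omega> by (auto simp: F_def)
    obtain q where q: "q \<in> QQ" "2 * r \<le> \<bar>\<Sum>j\<in>Jk k' \<inter> q. X j \<omega>\<bar>" using k' by (auto simp: big_def)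
    have "(\<Sum>j\<in>J \<inter> q. X j \<omega>) = (\<Sum>j\<in>Jk k' \<inter> q. X j \<omega>) + (\<Sum>j\<in>(J - Jk k') \<inter> q. X j \<omega>)"
      using J Jk by (subst sum.union_disjoint[symmetric]) (auto intro!: sum.cong)
    moreover have "\<bar>\<Sum>j\<in>(J - Jk k') \<inter> q. X j \<omega>\<bar> < r" using nF q by (auto simp: big_def not_le)
    ultimately have "r \<le> \<bar>\<Sum>j\<in>J \<inter> q. X j \<omega>\<bar>" using q by linarith
    then show "big J r \<omega>" using q by (auto simp: big_def)
  qed
  have "prob {\<omega>\<in>space M. \<exists>k. big (Jk k) (2 * r) \<omega>} \<le> prob ({\<omega>\<in>space M. big J r \<omega>} \<union> (\<Union>k\<in>{..K}. E k \<inter> F k))"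
    using sub E_sets F_sets meas by (intro finite_measure_mono) auto
  also have "\<dots> \<le> prob {\<omega>\<in>space M. big J r \<omega>} + prob (\<Union>k\<in>{..K}. E k \<inter> F k)"
    using E_sets F_sets meas by (intro measure_Un_le) auto
  also have "prob (\<Union>k\<in>{..K}. E k \<inter> F k) \<le> (\<Sum>k\<le>K. prob (E k \<inter> F k))"
    using E_sets F_sets by (intro finite_measure_subadditive_finite) auto
  also have "\<dots> \<le> (\<Sum>k\<le>K. prob (E k) * \<eta>)"
    unfolding EF using F_le by (intro sum_mono mult_left_mono) auto
  also have "\<dots> = prob (\<Union>k\<in>{..K}. E k) * \<eta>"
    using disj E_sets by (subst finite_measure_finite_Union) (auto simp: sum_distrib_right)
  also have "\<dots> \<le> 1 * \<eta>" using \<open>\<eta> \<ge> 0\<close> by (intro mult_right_mono) auto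
  also have "prob {\<omega>\<in>space M. big J r \<omega>} \<le> \<eta>" unfolding big_def by (rule bnd) simp
  finally show ?thesis by (simp add: big_def Jk_def)
qed

text \<open>One application of the previous step per coordinate; each doubles both the level and the
  probability. The claim is made for every subfamily \<open>I\<close> because the next application
  needs it for the variables left over after stopping.\<close>

lemma (in prob_space) etemadi_multiparameter:
  fixes X :: "'i \<Rightarrow> 'a \<Rightarrow> real" and \<phi> :: "'i \<Rightarrow> nat \<Rightarrow> nat"
  assumes J: "finite J" and X: "indep_vars (\<lambda>_. borel) X J" and r: "r > 0"
    and bnd: "\<And>I. I \<subseteq> J \<Longrightarrow> prob {\<omega>\<in>space M. r \<le> \<bar>\<Sum>j\<in>I. X j \<omega>\<bar>} \<le> \<eta>"
  shows "I \<subseteq> J \<Longrightarrow> prob {\<omega>\<in>space M. \<exists>z. 2 ^ p * r \<le> \<bar>\<Sum>j\<in>{j\<in>I. \<forall>i<p. \<phi> j i \<le> z i}. X j \<omega>\<bar>} \<le> 2 ^ p * \<eta>"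
proof (induction p arbitrary: I)
  case 0
  then show ?case using bnd by simp
next
  case (Suc p)
  \<comment> \<open>The parameter \<open>z\<close> ranges over an infinite set, but it cuts out only
    finitely many subsets of \<open>J\<close>.\<close>
  define QQ where "QQ = (\<lambda>z. {j\<in>J. \<forall>i<p. \<phi> j i \<le> z i}) ` (UNIV :: (nat \<Rightarrow> nat) set)"
  have fin: "finite QQ" unfolding QQ_def using J by (auto intro!: finite_subset[where B = "Pow J"])
  have I: "finite I" "indep_vars (\<lambda>_. borel) X I"
    using finite_subset[OF Suc.prems J] indep_vars_subset[OF X Suc.prems] .
  have eq: "{\<omega>\<in>space M. \<exists>q\<in>QQ. c \<le> \<bar>\<Sum>j\<in>I' \<inter> q. X j \<omega>\<bar>} =
      {\<omega>\<in>space M. \<exists>z. c \<le> \<bar>\<Sum>j\<in>{j\<in>I'. \<forall>i<p. \<phi> j i \<le> z i}. X j \<omega>\<bar>}" if "I' \<subseteq> J" for I' c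
  proof -
    have "I' \<inter> {j\<in>J. \<forall>i<p. \<phi> j i \<le> z i} = {j\<in>I'. \<forall>i<p. \<phi> j i \<le> z i}" for z
      using that by auto
    then show ?thesis by (simp add: QQ_def)
  qed
  have "prob {\<omega>\<in>space M. \<exists>k. \<exists>q\<in>QQ. 2 * (2 ^ p * r) \<le> \<bar>\<Sum>j\<in>{j\<in>I. \<phi> j p \<le> k} \<inter> q. X j \<omega>\<bar>} \<le> 2 * (2 ^ p * \<eta>)"
  proof (rule etemadi_step[OF I _ fin])
    fix I' assume "I' \<subseteq> I"
    with Suc.prems have "I' \<subseteq> J" by auto
    then show "prob {\<omega>\<in>space M. \<exists>q\<in>QQ. 2 ^ p * r \<le> \<bar>\<Sum>j\<in>I' \<inter> q. X j \<omega>\<bar>} \<le> 2 ^ p * \<eta>"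
      using Suc.IH eq by simp
  qed (use r in simp)
  moreover have "{\<omega>\<in>space M. \<exists>z. 2 ^ Suc p * r \<le> \<bar>\<Sum>j\<in>{j\<in>I. \<forall>i<Suc p. \<phi> j i \<le> z i}. X j \<omega>\<bar>} =
     {\<omega>\<in>space M. \<exists>k. \<exists>q\<in>QQ. 2 * (2 ^ p * r) \<le> \<bar>\<Sum>j\<in>{j\<in>I. \<phi> j p \<le> k} \<inter> q. X j \<omega>\<bar>}" (is "?L = ?R")
  proof -
    have set_eq: "{j\<in>I. \<phi> j p \<le> k} \<inter> {j\<in>J. \<forall>i<p. \<phi> j i \<le> z i} = {j\<in>I. \<forall>i<Suc p. \<phi> j i \<le> (z(p := k)) i}" for z k
    proof -
      have "(\<forall>i<Suc p. \<phi> j i \<le> (z(p := k)) i) \<longleftrightarrow> (\<forall>i<p. \<phi> j i \<le> z i) \<and> \<phi> j p \<le> k" for j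
        unfolding All_less_Suc by auto
      then show ?thesis using Suc.prems by blast
    qed
    have "(\<exists>z. c \<le> \<bar>\<Sum>j\<in>{j\<in>I. \<forall>i<Suc p. \<phi> j i \<le> z i}. X j \<omega>\<bar>) \<longleftrightarrow>
       (\<exists>k z. c \<le> \<bar>\<Sum>j\<in>{j\<in>I. \<forall>i<Suc p. \<phi> j i \<le> (z(p := k)) i}. X j \<omega>\<bar>)" for c \<omega>
    proof safe
      fix z assume "c \<le> \<bar>\<Sum>j\<in>{j\<in>I. \<forall>i<Suc p. \<phi> j i \<le> z i}. X j \<omega>\<bar>"
      then show "\<exists>k z. c \<le> \<bar>\<Sum>j\<in>{j\<in>I. \<forall>i<Suc p. \<phi> j i \<le> (z(p := k)) i}. X j \<omega>\<bar>"
        by (intro exI[of _ "z p"] exI[of _ z]) (simp only: fun_upd_triv)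
    qed blast
    then show ?thesis by (simp add: QQ_def set_eq mult.assoc del: fun_upd_apply)
  qed
  ultimately show ?case by (simp add: mult.assoc)
qed

section \<open>Poisson random sets\<close>

text \<open>The shift to \<open>Suc k\<close> cancels one factor of the factorial, which reduces the
  series of each moment to the preceding ones.\<close>

lemma poisson_sums:
  fixes q :: real
  shows "(\<lambda>k. exp (- q) * q ^ k / fact k) sums 1"
    and "(\<lambda>k. real k * (exp (- q) * q ^ k / fact k)) sums q"
    and "(\<lambda>k. (real k)\<^sup>2 * (exp (- q) * q ^ k / fact k)) sums (q\<^sup>2 + q)"
proof -
  have e: "(\<lambda>k. q ^ k / fact k) sums exp q"
    using exp_converges[of q] by (simp add: divide_inverse mult.commute)
  from sums_mult[OF this, of "exp (- q)"] show "(\<lambda>k. exp (- q) * q ^ k / fact k) sums 1"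
    by (simp add: exp_minus)
  have 1: "(\<lambda>k. real k * (q ^ k / fact k)) sums (q * exp q)"
  proof -
    have "(\<lambda>k. real (Suc k) * (q ^ Suc k / fact (Suc k))) = (\<lambda>k. q * (q ^ k / fact k))"
      by (rule ext) (simp add: field_simps del: of_nat_Suc)
    then have "(\<lambda>k. real (Suc k) * (q ^ Suc k / fact (Suc k))) sums (q * exp q)"
      using sums_mult[OF e, of q] by (simp only:)
    from this[THEN sums_Suc] show ?thesis by simp
  qed
  from sums_mult[OF this, of "exp (- q)"] show one: "(\<lambda>k. real k * (exp (- q) * q ^ k / fact k)) sums q"
    by (simp add: exp_minus field_simps)
  have "(\<lambda>k. (real k)\<^sup>2 * (q ^ k / fact k)) sums ((q\<^sup>2 + q) * exp q)"
  proof -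
    have "(\<lambda>k. (real (Suc k))\<^sup>2 * (q ^ Suc k / fact (Suc k))) = (\<lambda>k. q * (real k * (q ^ k / fact k)) + q * (q ^ k / fact k))"
    proof (rule ext)
      fix k
      have "(real (Suc k))\<^sup>2 * (q ^ Suc k / fact (Suc k)) = real (Suc k) * (q * (q ^ k / fact k))"
        by (simp add: field_simps power2_eq_square del: of_nat_Suc)
      also have "real (Suc k) * (q * x) = q * (real k * x) + q * x" for x
        by (simp add: algebra_simps)
      finally show "(real (Suc k))\<^sup>2 * (q ^ Suc k / fact (Suc k)) = q * (real k * (q ^ k / fact k)) + q * (q ^ k / fact k)" .
    qed
    moreover have "(\<lambda>k. q * (real k * (q ^ k / fact k)) + q * (q ^ k / fact k)) sums (q * (q * exp q) + q * exp q)"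
      by (intro sums_add sums_mult 1 e)
    ultimately have "(\<lambda>k. (real (Suc k))\<^sup>2 * (q ^ Suc k / fact (Suc k))) sums (q * (q * exp q) + q * exp q)"
      by (simp only:)
    from this[THEN sums_Suc] show ?thesis by (simp add: power2_eq_square algebra_simps)
  qed
  from sums_mult[OF this, of "exp (- q)"] show "(\<lambda>k. (real k)\<^sup>2 * (exp (- q) * q ^ k / fact k)) sums (q\<^sup>2 + q)"
    by (simp add: exp_minus field_simps) (simp add: add_divide_distrib)
qed

lemma (in prob_space) indep_vars_second_moment:
  fixes X :: "'i \<Rightarrow> 'a \<Rightarrow> real"
  assumes "finite J" "indep_vars (\<lambda>_. borel) X J"
    and "\<And>j. j \<in> J \<Longrightarrow> integrable M (X j)" "\<And>j. j \<in> J \<Longrightarrow> integrable M (\<lambda>\<omega>. (X j \<omega>)\<^sup>2)"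
    and "\<And>j. j \<in> J \<Longrightarrow> expectation (X j) = 0"
  shows "integrable M (\<lambda>\<omega>. (\<Sum>j\<in>J. X j \<omega>)\<^sup>2) \<and>
    expectation (\<lambda>\<omega>. (\<Sum>j\<in>J. X j \<omega>)\<^sup>2) = (\<Sum>j\<in>J. expectation (\<lambda>\<omega>. (X j \<omega>)\<^sup>2))"
  using assms
proof (induction J)
  case empty
  then show ?case by simp
next
  case (insert i I)
  let ?S = "\<lambda>\<omega>. \<Sum>j\<in>I. X j \<omega>"
  have ind: "indep_var borel (X i) borel ?S"
    using indep_vars_sum[OF insert.hyps insert.prems(1)] .
  have intS: "integrable M ?S" using insert.prems by auto
  have IH: "integrable M (\<lambda>\<omega>. (?S \<omega>)\<^sup>2)" "expectation (\<lambda>\<omega>. (?S \<omega>)\<^sup>2) = (\<Sum>j\<in>I. expectation (\<lambda>\<omega>. (X j \<omega>)\<^sup>2))"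
    using insert.IH insert.prems indep_vars_subset[OF insert.prems(1), of I] by auto
  have iX: "integrable M (X i)" "integrable M (\<lambda>\<omega>. (X i \<omega>)\<^sup>2)" "expectation (X i) = 0"
    using insert.prems by auto
  have prod: "integrable M (\<lambda>\<omega>. X i \<omega> * ?S \<omega>)" "expectation (\<lambda>\<omega>. X i \<omega> * ?S \<omega>) = 0"
    using indep_var_integrable[OF ind iX(1) intS] indep_var_lebesgue_integral[OF ind iX(1) intS] iX(3) by auto
  have eq: "(\<lambda>\<omega>. (\<Sum>j\<in>insert i I. X j \<omega>)\<^sup>2) = (\<lambda>\<omega>. (X i \<omega>)\<^sup>2 + (2 * (X i \<omega> * ?S \<omega>) + (?S \<omega>)\<^sup>2))"
    using insert.hyps by (auto simp: power2_eq_square algebra_simps)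
  show ?case unfolding eq using insert.hyps IH iX prod by simp
qed

locale poisson_set = prob_space P
  for P :: "'w measure" +
  fixes Q :: "'b measure" and \<Xi> :: "'w \<Rightarrow> 'b set"
  assumes prs: "poisson_random_set P Q \<Xi>"
begin

lemma points_space: "\<omega> \<in> space P \<Longrightarrow> \<Xi> \<omega> \<subseteq> space Q"
  using prs by (auto simp: poisson_random_set_def)

lemma num_points_measurable[measurable (raw)]: "D \<in> sets Q \<Longrightarrow> num_points \<Xi> D \<in> borel_measurable P"
  using prs by (auto simp: poisson_random_set_def)

lemma num_points_infinite: "D \<in> sets Q \<Longrightarrow> emeasure Q D = \<top> \<Longrightarrow> AE \<omega> in P. num_points \<Xi> D \<omega> = \<top>"
  using prs by (auto simp: poisson_random_set_def)

lemma num_points_distr: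
  "D \<in> sets Q \<Longrightarrow> emeasure Q D < \<top> \<Longrightarrow>
    prob {\<omega> \<in> space P. num_points \<Xi> D \<omega> = of_nat k} = exp (- measure Q D) * measure Q D ^ k / fact k"
  using prs by (auto simp: poisson_random_set_def)

lemma num_points_eq_card: "num_points \<Xi> D \<omega> = (if finite (\<Xi> \<omega> \<inter> D) then of_nat (card (\<Xi> \<omega> \<inter> D)) else \<top>)"
  by (simp add: num_points_def emeasure_count_space)

text \<open>The events of having exactly \<open>k\<close> points exhaust the space up to a null set
  because the Poisson weights sum to 1. This gives almost sure finiteness and the expectation of any
  nonnegative function of the count.\<close>

lemma nn_integral_card_points:
  fixes g :: "nat \<Rightarrow> real"
  assumes D: "D \<in> sets Q" "emeasure Q D < \<top>" and g: "\<And>k. 0 \<le> g k"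
    and s: "(\<lambda>k. g k * (exp (- measure Q D) * measure Q D ^ k / fact k)) sums s"
  shows "(\<integral>\<^sup>+\<omega>. ennreal (g (card (\<Xi> \<omega> \<inter> D))) \<partial>P) = ennreal s"
    and "AE \<omega> in P. finite (\<Xi> \<omega> \<inter> D)"
proof -
  define E where "E k = {\<omega> \<in> space P. num_points \<Xi> D \<omega> = of_nat k}" for k
  have [measurable]: "E k \<in> events" for k
    unfolding E_def using num_points_measurable[OF D(1)] by measurable
  have disj: "disjoint_family E" by (auto simp: disjoint_family_on_def E_def)
  have pE: "prob (E k) = exp (- measure Q D) * measure Q D ^ k / fact k" for k
    unfolding E_def by (rule num_points_distr[OF D])
  have "prob (\<Union>k. E k) = (\<Sum>k. prob (E k))"
    using disj by (intro finite_measure_UNION[THEN sums_unique]) auto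
  also have "\<dots> = 1" unfolding pE using poisson_sums(1)[of "measure Q D"] by (simp add: sums_iff)
  finally have AE: "AE \<omega> in P. \<omega> \<in> (\<Union>k. E k)"
    by (intro prob_eq_1[THEN iffD1]) auto
  then show "AE \<omega> in P. finite (\<Xi> \<omega> \<inter> D)"
    by eventually_elim (auto simp: E_def num_points_eq_card split: if_splits)
  have eq: "AE \<omega> in P. ennreal (g (card (\<Xi> \<omega> \<inter> D))) = (\<Sum>k. ennreal (g k) * indicator (E k) \<omega>)"
    using AE
  proof eventually_elim
    case (elim \<omega>)
    then obtain k where k: "\<omega> \<in> E k" by auto
    then have c: "card (\<Xi> \<omega> \<inter> D) = k" by (auto simp: E_def num_points_eq_card split: if_splits)
    have "(\<Sum>k. ennreal (g k) * indicator (E k) \<omega>) = (\<Sum>k'\<in>{k}. ennreal (g k') * indicator (E k') \<omega>)"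
      using k disj by (intro suminf_finite) (auto simp: E_def indicator_def)
    then show ?case using k c by simp
  qed
  have "(\<integral>\<^sup>+\<omega>. ennreal (g (card (\<Xi> \<omega> \<inter> D))) \<partial>P) = (\<integral>\<^sup>+\<omega>. (\<Sum>k. ennreal (g k) * indicator (E k) \<omega>) \<partial>P)"
    by (rule nn_integral_cong_AE[OF eq])
  also have "\<dots> = (\<Sum>k. ennreal (g k) * emeasure P (E k))"
    by (subst nn_integral_suminf) (auto simp: nn_integral_cmult_indicator)
  also have "\<dots> = (\<Sum>k. ennreal (g k * (exp (- measure Q D) * measure Q D ^ k / fact k)))"
    by (intro suminf_cong) (simp only: emeasure_eq_measure pE, subst ennreal_mult, auto simp: g)
  also have "\<dots> = ennreal s"
    using s g by (intro suminf_ennreal_eq) (auto simp: field_simps)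
  finally show "(\<integral>\<^sup>+\<omega>. ennreal (g (card (\<Xi> \<omega> \<inter> D))) \<partial>P) = ennreal s" .
qed

lemma finite_points:
  assumes D: "D \<in> sets Q" "emeasure Q D < \<top>"
  shows "AE \<omega> in P. finite (\<Xi> \<omega> \<inter> D)"
  using nn_integral_card_points(2)[OF D, of "\<lambda>_. 1"] poisson_sums(1)[of "measure Q D"] by simp

lemma nn_integral_num_points:
  assumes D: "D \<in> sets Q"
  shows "(\<integral>\<^sup>+\<omega>. num_points \<Xi> D \<omega> \<partial>P) = emeasure Q D"
proof (cases "emeasure Q D = \<top>")
  case True
  have "(\<integral>\<^sup>+\<omega>. num_points \<Xi> D \<omega> \<partial>P) = (\<integral>\<^sup>+\<omega>. \<top> \<partial>P)"
    using num_points_infinite[OF D True] by (rule nn_integral_cong_AE)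
  then show ?thesis using True by (simp add: emeasure_space_1)
next
  case False
  then have D': "emeasure Q D < \<top>" by (simp add: top.not_eq_extremum)
  have "(\<integral>\<^sup>+\<omega>. num_points \<Xi> D \<omega> \<partial>P) = (\<integral>\<^sup>+\<omega>. ennreal (real (card (\<Xi> \<omega> \<inter> D))) \<partial>P)"
    using finite_points[OF D D'] by (intro nn_integral_cong_AE) (auto elim!: eventually_mono simp: num_points_eq_card ennreal_of_nat_eq_real_of_nat)
  also have "\<dots> = ennreal (measure Q D)"
    using poisson_sums(2)[of "measure Q D"] by (intro nn_integral_card_points[OF D D']) auto
  finally show ?thesis using False by (simp add: emeasure_eq_ennreal_measure)
qed

lemma no_points:
  assumes "D \<in> sets Q" "emeasure Q D = 0"
  shows "AE \<omega> in P. \<Xi> \<omega> \<inter> D = {}"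
proof -
  have "AE \<omega> in P. num_points \<Xi> D \<omega> = 0"
    using nn_integral_num_points[OF assms(1)] assms num_points_measurable[OF assms(1)]
    by (subst nn_integral_0_iff_AE[symmetric]) auto
  then show ?thesis by eventually_elim (auto simp: num_points_eq_card split: if_splits)
qed

lemma prob_points_exist:
  assumes D: "D \<in> sets Q"
  shows "emeasure P {\<omega> \<in> space P. \<Xi> \<omega> \<inter> D \<noteq> {}} \<le> emeasure Q D"
    and "{\<omega> \<in> space P. \<Xi> \<omega> \<inter> D \<noteq> {}} \<in> events"
proof -
  have N[measurable]: "num_points \<Xi> D \<in> borel_measurable P" using D by (rule num_points_measurable)
  have eq: "{\<omega> \<in> space P. \<Xi> \<omega> \<inter> D \<noteq> {}} = {\<omega> \<in> space P. 1 \<le> 1 * num_points \<Xi> D \<omega>}"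
  proof -
    have "\<Xi> \<omega> \<inter> D \<noteq> {} \<longleftrightarrow> 1 \<le> num_points \<Xi> D \<omega>" for \<omega>
      using of_nat_le_iff[of 1 "card (\<Xi> \<omega> \<inter> D)", where 'a = ennreal]
      by (auto simp: num_points_eq_card Suc_le_eq card_gt_0_iff)
    then show ?thesis by simp
  qed
  show "{\<omega> \<in> space P. \<Xi> \<omega> \<inter> D \<noteq> {}} \<in> events" unfolding eq by measurable
  have "emeasure P {\<omega> \<in> space P. 1 \<le> 1 * num_points \<Xi> D \<omega>} \<le> 1 * (\<integral>\<^sup>+\<omega>. num_points \<Xi> D \<omega> * indicator (space P) \<omega> \<partial>P)"
    by (rule nn_integral_Markov_inequality) auto
  also have "(\<integral>\<^sup>+\<omega>. num_points \<Xi> D \<omega> * indicator (space P) \<omega> \<partial>P) = emeasure Q D"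
    using nn_integral_num_points[OF D] by (simp cong: nn_integral_cong)
  finally show "emeasure P {\<omega> \<in> space P. \<Xi> \<omega> \<inter> D \<noteq> {}} \<le> emeasure Q D"
    unfolding eq by simp
qed

text \<open>With \<open>q\<close> the intensity of \<open>D\<close>, the probability is
  \<open>1 - exp (- q) * (1 + q)\<close>, and \<open>exp (- q)\<close> is at least
  \<open>1 - q\<close>. The quadratic order is what rules out two jumps at the same
  location.\<close>

lemma prob_two_points:
  assumes D: "D \<in> sets Q" "emeasure Q D < \<top>"
  shows "prob {\<omega> \<in> space P. 2 \<le> num_points \<Xi> D \<omega>} \<le> (measure Q D)\<^sup>2"
    and "{\<omega> \<in> space P. 2 \<le> num_points \<Xi> D \<omega>} \<in> events"
proof -
  have N[measurable]: "num_points \<Xi> D \<in> borel_measurable P" using D by (intro num_points_measurable)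
  show "{\<omega> \<in> space P. 2 \<le> num_points \<Xi> D \<omega>} \<in> events" by measurable
  let ?q = "measure Q D" and ?E = "\<lambda>k. {\<omega> \<in> space P. num_points \<Xi> D \<omega> = of_nat k}"
  have E: "?E k \<in> events" for k by measurable
  have "{\<omega> \<in> space P. 2 \<le> num_points \<Xi> D \<omega>} \<subseteq> space P - (?E 0 \<union> ?E 1)"
    by (auto simp: )
  then have "prob {\<omega> \<in> space P. 2 \<le> num_points \<Xi> D \<omega>} \<le> prob (space P - (?E 0 \<union> ?E 1))"
    using E by (intro finite_measure_mono) auto
  also have "\<dots> = 1 - (prob (?E 0) + prob (?E 1))"
    using E[of 0] E[of 1] by (subst prob_compl, force, subst finite_measure_Union) auto
  also have "\<dots> = 1 - (exp (- ?q) + exp (- ?q) * ?q)" unfolding num_points_distr[OF D] by simp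
  also have "\<dots> \<le> ?q\<^sup>2"
  proof -
    have "(1 - ?q) * (1 + ?q) \<le> exp (- ?q) * (1 + ?q)"
      using exp_ge_add_one_self[of "- ?q"] by (intro mult_right_mono) auto
    then show ?thesis by (simp add: algebra_simps power2_eq_square)
  qed
  finally show "prob {\<omega> \<in> space P. 2 \<le> num_points \<Xi> D \<omega>} \<le> ?q\<^sup>2" .
qed

text \<open>Campbell's formula, by induction over measurable functions from the mean number of
  points. Writing the random sum as an integral against the counting measure on the points avoids
  any question of convergence.\<close>

lemma campbell:
  assumes "h \<in> borel_measurable Q"
  shows "(\<lambda>\<omega>. \<integral>\<^sup>+z. h z \<partial>count_space (\<Xi> \<omega>)) \<in> borel_measurable P \<and>
    (\<integral>\<^sup>+\<omega>. (\<integral>\<^sup>+z. h z \<partial>count_space (\<Xi> \<omega>)) \<partial>P) = (\<integral>\<^sup>+z. h z \<partial>Q)"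
  using assms
proof (induction h rule: borel_measurable_induct)
  case (cong f g)
  have "(\<integral>\<^sup>+z. f z \<partial>count_space (\<Xi> \<omega>)) = (\<integral>\<^sup>+z. g z \<partial>count_space (\<Xi> \<omega>))" if "\<omega> \<in> space P" for \<omega>
    using cong(3) points_space[OF that] by (intro nn_integral_cong) auto
  moreover have "(\<integral>\<^sup>+z. f z \<partial>Q) = (\<integral>\<^sup>+z. g z \<partial>Q)" by (intro nn_integral_cong cong(3))
  ultimately show ?case using cong(4) by (simp cong: measurable_cong nn_integral_cong)
next
  case (set D)
  have eq: "(\<integral>\<^sup>+z. indicator D z \<partial>count_space (\<Xi> \<omega>)) = num_points \<Xi> D \<omega>" for \<omega>
  proof -
    have "(\<integral>\<^sup>+z. indicator D z \<partial>count_space (\<Xi> \<omega>)) = (\<integral>\<^sup>+z. indicator (\<Xi> \<omega> \<inter> D) z \<partial>count_space (\<Xi> \<omega>))"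
      by (intro nn_integral_cong) (auto simp: indicator_def)
    then show ?thesis by (simp add: num_points_def emeasure_count_space)
  qed
  show ?case using set nn_integral_num_points[OF set] num_points_measurable[OF set]
    by (simp add: eq)
next
  case (mult u c)
  then show ?case by (auto simp: nn_integral_cmult intro!: borel_measurable_times)
next
  case (add u v)
  then show ?case by (auto simp: nn_integral_add intro!: borel_measurable_add)
next
  case (seq U)
  have eq: "(\<integral>\<^sup>+z. (SUP i. U i z) \<partial>count_space (\<Xi> \<omega>)) = (SUP i. \<integral>\<^sup>+z. U i z \<partial>count_space (\<Xi> \<omega>))" for \<omega>
    using seq by (intro nn_integral_monotone_convergence_SUP) auto
  have inc: "incseq (\<lambda>i \<omega>. \<integral>\<^sup>+z. U i z \<partial>count_space (\<Xi> \<omega>))"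
    using \<open>incseq U\<close> by (auto simp: incseq_def le_fun_def intro!: nn_integral_mono)
  have "(\<integral>\<^sup>+\<omega>. (SUP i. \<integral>\<^sup>+z. U i z \<partial>count_space (\<Xi> \<omega>)) \<partial>P) = (SUP i. \<integral>\<^sup>+\<omega>. (\<integral>\<^sup>+z. U i z \<partial>count_space (\<Xi> \<omega>)) \<partial>P)"
    using seq inc by (intro nn_integral_monotone_convergence_SUP) auto
  also have "\<dots> = (SUP i. \<integral>\<^sup>+z. U i z \<partial>Q)" using seq by simp
  also have "\<dots> = (\<integral>\<^sup>+z. (SUP i. U i z) \<partial>Q)"
    using seq by (intro nn_integral_monotone_convergence_SUP[symmetric]) auto
  finally show ?case using seq by (auto simp: eq image_comp intro!: borel_measurable_SUP)
qed

lemma centered_count_moments: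
  assumes D: "D \<in> sets Q" "emeasure Q D < \<top>"
  shows "(\<lambda>\<omega>. real (card (\<Xi> \<omega> \<inter> D)) - measure Q D) \<in> borel_measurable P"
    and "integrable P (\<lambda>\<omega>. real (card (\<Xi> \<omega> \<inter> D)) - measure Q D)"
    and "expectation (\<lambda>\<omega>. real (card (\<Xi> \<omega> \<inter> D)) - measure Q D) = 0"
    and "integrable P (\<lambda>\<omega>. (real (card (\<Xi> \<omega> \<inter> D)) - measure Q D)\<^sup>2)"
    and "expectation (\<lambda>\<omega>. (real (card (\<Xi> \<omega> \<inter> D)) - measure Q D)\<^sup>2) = measure Q D"
proof -
  let ?q = "measure Q D" and ?N = "\<lambda>\<omega>. real (card (\<Xi> \<omega> \<inter> D))"
  have "?N = (\<lambda>\<omega>. enn2real (num_points \<Xi> D \<omega>))" by (auto simp: num_points_eq_card fun_eq_iff)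
  then have N[measurable]: "?N \<in> borel_measurable P"
    using num_points_measurable[OF D(1)] by simp
  then show "(\<lambda>\<omega>. ?N \<omega> - ?q) \<in> borel_measurable P" by measurable
  have 1: "(\<integral>\<^sup>+\<omega>. ennreal (?N \<omega>) \<partial>P) = ennreal ?q"
    using poisson_sums(2)[of ?q] by (intro nn_integral_card_points[OF D]) auto
  have 2: "(\<integral>\<^sup>+\<omega>. ennreal ((?N \<omega>)\<^sup>2) \<partial>P) = ennreal (?q\<^sup>2 + ?q)"
    using poisson_sums(3)[of ?q] by (intro nn_integral_card_points[OF D, of "\<lambda>k. (real k)\<^sup>2"]) auto
  have i1: "integrable P ?N" using 1 by (intro integrableI_nonneg) auto
  have i2: "integrable P (\<lambda>\<omega>. (?N \<omega>)\<^sup>2)" using 2 by (intro integrableI_nonneg) auto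
  have e1: "expectation ?N = ?q" using 1 by (intro integral_eq_nn_integral[THEN trans]) auto
  have "expectation (\<lambda>\<omega>. (?N \<omega>)\<^sup>2) = enn2real (ennreal (?q\<^sup>2 + ?q))"
    unfolding 2[symmetric] by (rule integral_eq_nn_integral) auto
  then have e2: "expectation (\<lambda>\<omega>. (?N \<omega>)\<^sup>2) = ?q\<^sup>2 + ?q" by (subst (asm) enn2real_ennreal) simp_all
  show "integrable P (\<lambda>\<omega>. ?N \<omega> - ?q)" using i1 by simp
  show "expectation (\<lambda>\<omega>. ?N \<omega> - ?q) = 0" using i1 e1 by (simp add: prob_space)
  have eq: "(\<lambda>\<omega>. (?N \<omega> - ?q)\<^sup>2) = (\<lambda>\<omega>. (?N \<omega>)\<^sup>2 - 2 * ?q * ?N \<omega> + ?q\<^sup>2)"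
    by (auto simp: power2_eq_square algebra_simps)
  show "integrable P (\<lambda>\<omega>. (?N \<omega> - ?q)\<^sup>2)" unfolding eq using i1 i2 by simp
  show "expectation (\<lambda>\<omega>. (?N \<omega> - ?q)\<^sup>2) = ?q" unfolding eq using i1 i2 e1 e2
    by (simp add: prob_space power2_eq_square algebra_simps)
qed

text \<open>Counts over disjoint sets are independent, and the variance of a subfamily is at most
  that of the whole family. Hence Chebyshev's inequality bounds all subfamilies by one constant, as
  the multiparameter inequality requires.\<close>

lemma compensated_sum_maximal:
  fixes c :: "nat \<Rightarrow> real" and \<phi> :: "nat \<Rightarrow> nat \<Rightarrow> nat"
  assumes D: "\<And>i. i < n \<Longrightarrow> D i \<in> sets Q" "\<And>i. i < n \<Longrightarrow> emeasure Q (D i) < \<top>"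
    and disj: "disjoint_family_on D {..<n}" and r: "r > 0"
  defines "Z i \<omega> \<equiv> c i * (real (card (\<Xi> \<omega> \<inter> D i)) - measure Q (D i))"
  shows "prob {\<omega>\<in>space P. \<exists>z. 2 ^ p * r \<le> \<bar>\<Sum>i\<in>{i\<in>{..<n}. \<forall>k<p. \<phi> i k \<le> z k}. Z i \<omega>\<bar>}
    \<le> 2 ^ p * ((\<Sum>i<n. (c i)\<^sup>2 * measure Q (D i)) / r\<^sup>2)" (is "?A \<le> ?B")
    and "{\<omega>\<in>space P. \<exists>z. 2 ^ p * r \<le> \<bar>\<Sum>i\<in>{i\<in>{..<n}. \<forall>k<p. \<phi> i k \<le> z k}. Z i \<omega>\<bar>} \<in> events" (is "?E \<in> _")
proof -
  have "indep_vars (\<lambda>_. borel) (\<lambda>i. num_points \<Xi> (D i)) {..<n}"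
    using prs D(1) disj by (auto simp: poisson_random_set_def)
  then have "indep_vars (\<lambda>_. borel) (\<lambda>i \<omega>. c i * (enn2real (num_points \<Xi> (D i) \<omega>) - measure Q (D i))) {..<n}"
    by (rule indep_vars_compose2) measurable
  moreover have "(\<lambda>i \<omega>. c i * (enn2real (num_points \<Xi> (D i) \<omega>) - measure Q (D i))) = Z"
    by (auto simp: num_points_eq_card fun_eq_iff Z_def)
  ultimately have ind: "indep_vars (\<lambda>_. borel) Z {..<n}" by simp
  have mom: "Z i \<in> borel_measurable P" "integrable P (Z i)" "integrable P (\<lambda>\<omega>. (Z i \<omega>)\<^sup>2)" "expectation (Z i) = 0"
    "expectation (\<lambda>\<omega>. (Z i \<omega>)\<^sup>2) = (c i)\<^sup>2 * measure Q (D i)" if "i < n" for i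
    using centered_count_moments[OF D[OF that]] that unfolding Z_def by (auto simp: power_mult_distrib)
  show "?A \<le> ?B"
  proof (rule etemadi_multiparameter[OF _ ind r _ order_refl])
    fix I assume I: "I \<subseteq> {..<n}"
    then have fin: "finite I" using finite_subset by blast
    have "integrable P (\<lambda>\<omega>. (\<Sum>j\<in>I. Z j \<omega>)\<^sup>2) \<and>
      expectation (\<lambda>\<omega>. (\<Sum>j\<in>I. Z j \<omega>)\<^sup>2) = (\<Sum>j\<in>I. expectation (\<lambda>\<omega>. (Z j \<omega>)\<^sup>2))"
      by (rule indep_vars_second_moment[OF fin indep_vars_subset[OF ind I]]) (use mom I in auto)
    then have sm: "integrable P (\<lambda>\<omega>. (\<Sum>j\<in>I. Z j \<omega>)\<^sup>2)"
      "expectation (\<lambda>\<omega>. (\<Sum>j\<in>I. Z j \<omega>)\<^sup>2) = (\<Sum>j\<in>I. expectation (\<lambda>\<omega>. (Z j \<omega>)\<^sup>2))" by auto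
    have e0: "expectation (\<lambda>\<omega>. \<Sum>j\<in>I. Z j \<omega>) = 0"
      using mom I by (subst Bochner_Integration.integral_sum) (auto intro!: sum.neutral)
    have meas: "(\<lambda>\<omega>. \<Sum>j\<in>I. Z j \<omega>) \<in> borel_measurable P" using mom I by (intro borel_measurable_sum) auto
    have "prob {\<omega>\<in>space P. r \<le> \<bar>\<Sum>j\<in>I. Z j \<omega>\<bar>} \<le> expectation (\<lambda>\<omega>. (\<Sum>j\<in>I. Z j \<omega>)\<^sup>2) / r\<^sup>2"
      using Chebyshev_inequality[OF meas sm(1) r] by (simp add: e0)
    also have "expectation (\<lambda>\<omega>. (\<Sum>j\<in>I. Z j \<omega>)\<^sup>2) = (\<Sum>j\<in>I. (c j)\<^sup>2 * measure Q (D j))"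
      unfolding sm(2) using mom I by (intro sum.cong) auto
    also have "\<dots> \<le> (\<Sum>i<n. (c i)\<^sup>2 * measure Q (D i))"
      using I by (intro sum_mono2) auto
    finally show "prob {\<omega>\<in>space P. r \<le> \<bar>\<Sum>j\<in>I. Z j \<omega>\<bar>} \<le> (\<Sum>i<n. (c i)\<^sup>2 * measure Q (D i)) / r\<^sup>2"
      using r by (simp add: divide_right_mono)
  qed auto
  define QQ where "QQ = range (\<lambda>z. {i\<in>{..<n}. \<forall>k<p. \<phi> i k \<le> z k})"
  have fin: "finite QQ" unfolding QQ_def by (auto intro!: finite_subset[where B = "Pow {..<n}"])
  have m: "(\<lambda>\<omega>. \<Sum>j\<in>I. Z j \<omega>) \<in> borel_measurable P" if "I \<in> QQ" for I
    using mom(1) that by (intro borel_measurable_sum) (auto simp: QQ_def)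
  have "?E = (\<Union>I\<in>QQ. {\<omega>\<in>space P. 2 ^ p * r \<le> \<bar>\<Sum>j\<in>I. Z j \<omega>\<bar>})" by (auto simp: QQ_def)
  also have "\<dots> \<in> events" using fin
  proof (rule sets.finite_UN)
    fix I assume "I \<in> QQ"
    note [measurable] = m[OF this]
    show "{\<omega>\<in>space P. 2 ^ p * r \<le> \<bar>\<Sum>j\<in>I. Z j \<omega>\<bar>} \<in> events" by measurable
  qed
  finally show "?E \<in> events" .
qed

end

section \<open>Indexing collections\<close>

locale indexing =
  fixes \<T> :: "'a set" and \<A> :: "'a set set" and An :: "nat \<Rightarrow> 'a set set"
  assumes ic: "indexing_collection \<T> \<A> An"
begin

abbreviation "PA \<equiv> point_approx \<T> An"
abbreviation "pt \<equiv> point_set \<T> An"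
abbreviation "Cu \<equiv> finite_unions (class_C \<A>)"

lemma A_sub: "A \<in> \<A> \<Longrightarrow> A \<subseteq> \<T>" and A_empty[simp]: "{} \<in> \<A>"
  and An_inc: "incseq An" and An_finite[simp]: "finite (An n)" and An_sub: "An n \<subseteq> \<A>"
  and An_Int: "A \<in> An n \<Longrightarrow> B \<in> An n \<Longrightarrow> A \<inter> B \<in> An n"
  and A_hull: "A \<in> \<A> \<Longrightarrow> A = (\<Inter>n. hull_approx \<T> An n A)"
  and pt_bij: "bij_betw pt \<T> (\<A> - {{}})"
proof -
  note c = ic[unfolded indexing_collection_def]
  have 1: "\<A> \<subseteq> Pow \<T>" using c by (elim conjE)
  have 2: "{} \<in> \<A>" using c by (elim conjE)
  have 3: "incseq An" using c by (elim conjE)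
  have 4: "\<forall>n. finite (An n) \<and> An n \<subseteq> \<A> \<and> {} \<in> An n \<and> \<Inter>(\<A> - {{}}) \<in> An n \<and>
          (\<forall>A\<in>An n. \<forall>A'\<in>An n. A \<inter> A' \<in> An n)" using c by (elim conjE)
  have 5: "\<forall>A\<in>\<A>. A = (\<Inter>n. hull_approx \<T> An n A)" using c by (elim conjE)
  have 6: "bij_betw pt \<T> (\<A> - {{}})" using c by (elim conjE)
  show "A \<in> \<A> \<Longrightarrow> A \<subseteq> \<T>" using 1 by auto
  show "{} \<in> \<A>" "incseq An" "bij_betw pt \<T> (\<A> - {{}})" by fact+
  show "finite (An n)" "An n \<subseteq> \<A>" "A \<in> An n \<Longrightarrow> B \<in> An n \<Longrightarrow> A \<inter> B \<in> An n"
    using 4 by auto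
  show "A \<in> \<A> \<Longrightarrow> A = (\<Inter>n. hull_approx \<T> An n A)" using 5 by (rule bspec)
qed

lemma shape: "A \<in> \<A> \<Longrightarrow> finite F \<Longrightarrow> F \<noteq> {} \<Longrightarrow> F \<subseteq> \<A> \<Longrightarrow> A \<subseteq> \<Union>F \<Longrightarrow> \<exists>A'\<in>F. A \<subseteq> A'"
proof -
  have "\<forall>A\<in>\<A>. \<forall>F. finite F \<and> F \<noteq> {} \<and> F \<subseteq> \<A> \<and> A \<subseteq> \<Union>F \<longrightarrow> (\<exists>A'\<in>F. A \<subseteq> A')"
    using ic[unfolded indexing_collection_def] by (elim conjE)
  then show "A \<in> \<A> \<Longrightarrow> finite F \<Longrightarrow> F \<noteq> {} \<Longrightarrow> F \<subseteq> \<A> \<Longrightarrow> A \<subseteq> \<Union>F \<Longrightarrow> \<exists>A'\<in>F. A \<subseteq> A'"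
    by simp
qed

lemma A_Inter: "S \<noteq> {} \<Longrightarrow> countable S \<Longrightarrow> S \<subseteq> \<A> \<Longrightarrow> \<Inter>S \<in> \<A>"
proof -
  have "\<forall>S. S \<noteq> {} \<and> countable S \<and> S \<subseteq> \<A> \<longrightarrow> \<Inter>S \<in> \<A>"
    using ic[unfolded indexing_collection_def] by (elim conjE)
  then show "S \<noteq> {} \<Longrightarrow> countable S \<Longrightarrow> S \<subseteq> \<A> \<Longrightarrow> \<Inter>S \<in> \<A>" by simp
qed

lemma A_Int: "A \<in> \<A> \<Longrightarrow> B \<in> \<A> \<Longrightarrow> A \<inter> B \<in> \<A>"
  using A_Inter[of "{A, B}"] by simp

lemma An_mono: "m \<le> n \<Longrightarrow> An m \<subseteq> An n"
  using An_inc by (auto simp: incseq_def)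

lemma An_A: "A \<in> An n \<Longrightarrow> A \<in> \<A>" using An_sub by auto

lemma pt_in: "s \<in> \<T> \<Longrightarrow> s \<in> pt s"
  by (auto simp: point_set_def point_approx_def)

lemma pt_A: "s \<in> \<T> \<Longrightarrow> pt s \<in> \<A>" and pt_inj: "s \<in> \<T> \<Longrightarrow> s' \<in> \<T> \<Longrightarrow> pt s = pt s' \<Longrightarrow> s = s'"
  and tip: "A \<in> \<A> \<Longrightarrow> A \<noteq> {} \<Longrightarrow> \<exists>s\<in>\<T>. pt s = A"
proof -
  have b: "inj_on pt \<T>" "pt ` \<T> = \<A> - {{}}" using pt_bij by (auto simp: bij_betw_def)
  show "s \<in> \<T> \<Longrightarrow> pt s \<in> \<A>" using b(2) by blast
  show "s \<in> \<T> \<Longrightarrow> s' \<in> \<T> \<Longrightarrow> pt s = pt s' \<Longrightarrow> s = s'" using b(1) by (auto dest: inj_onD)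
  assume "A \<in> \<A>" "A \<noteq> {}"
  then have "A \<in> pt ` \<T>" using b(2) by blast
  then show "\<exists>s\<in>\<T>. pt s = A" by blast
qed

lemma pt_least: "A \<in> \<A> \<Longrightarrow> s \<in> A \<Longrightarrow> pt s \<subseteq> A"
proof -
  assume A: "A \<in> \<A>" "s \<in> A"
  have "PA n s \<subseteq> hull_approx \<T> An n A" for n
    using A by (auto simp: point_approx_def hull_approx_def)
  then have "pt s \<subseteq> (\<Inter>n. hull_approx \<T> An n A)" by (auto simp: point_set_def)
  then show ?thesis using A_hull[OF A(1)] by simp
qed

lemma An_Inter: "finite S \<Longrightarrow> S \<noteq> {} \<Longrightarrow> S \<subseteq> An n \<Longrightarrow> \<Inter>S \<in> An n"
  by (induction S rule: finite_ne_induct) (auto intro: An_Int)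

text \<open>The intersections behind \<open>point_approx\<close> and \<open>hull_approx\<close>
  always include \<open>\<T>\<close>, which need not belong to \<open>An n\<close>; they stay in
  \<open>An n\<close> as soon as one set of \<open>An n\<close> takes part.\<close>

lemma Inter_An_T:
  assumes "S = {B \<in> An n \<union> {\<T>}. R B}" "R \<T>"
  shows "\<Inter>S \<in> An n \<or> \<Inter>S = \<T>" and "\<exists>B\<in>An n. R B \<Longrightarrow> \<Inter>S \<in> An n"
proof -
  show 1: "\<Inter>S \<in> An n" if ex: "\<exists>B\<in>An n. R B"
  proof -
    have "\<Inter>S = \<Inter>{B \<in> An n. R B}" using ex A_sub[OF An_A] by (auto simp: assms(1))
    also have "\<dots> \<in> An n" using ex by (intro An_Inter) auto
    finally show ?thesis .
  qed
  show "\<Inter>S \<in> An n \<or> \<Inter>S = \<T>"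
  proof (cases "\<exists>B\<in>An n. R B")
    case False
    then have "S = {\<T>}" using assms by auto
    then show ?thesis by simp
  qed (use 1 in auto)
qed

section \<open>Approximation of points and left neighbourhoods\<close>

lemma PA_An: "s \<in> \<Union>(An n) \<Longrightarrow> PA n s \<in> An n"
  unfolding point_approx_def using A_sub[OF An_A] by (intro Inter_An_T(2)[OF refl]) auto

lemma PA_T: "s \<in> \<T> \<Longrightarrow> s \<notin> \<Union>(An n) \<Longrightarrow> PA n s = \<T>"
  unfolding point_approx_def by auto

lemma PA_in: "s \<in> \<T> \<Longrightarrow> s \<in> PA n s"
  by (auto simp: point_approx_def)

lemma PA_least: "A \<in> An n \<Longrightarrow> s \<in> A \<Longrightarrow> PA n s \<subseteq> A"
  by (auto simp: point_approx_def)

lemma PA_dec: "m \<le> n \<Longrightarrow> PA n s \<subseteq> PA m s"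
  using An_mono[of m n] by (auto simp: point_approx_def)

text \<open>The left neighbourhoods partition the union of \<open>An n\<close>, and the cell of a
  covered point is labelled by the least set of \<open>An n\<close> that contains it.\<close>

lemma left_nbhd_iff:
  assumes "B \<in> An n"
  shows "s \<in> B - \<Union>{A' \<in> An n. A' \<subset> B} \<longleftrightarrow> s \<in> \<Union>(An n) \<and> PA n s = B"
proof
  assume s: "s \<in> B - \<Union>{A' \<in> An n. A' \<subset> B}"
  then have "PA n s \<in> An n" "PA n s \<subseteq> B" "s \<in> PA n s"
    using PA_An[of s n] PA_least[OF assms, of s] PA_in[of s n] A_sub[OF An_A[OF assms]] assms s by blast+
  then show "s \<in> \<Union>(An n) \<and> PA n s = B" using s assms by blast
next
  assume s: "s \<in> \<Union>(An n) \<and> PA n s = B"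
  then have "s \<in> B" using PA_in A_sub[OF An_A] by blast
  then show "s \<in> B - \<Union>{A' \<in> An n. A' \<subset> B}" using s PA_least[of _ n s] by blast
qed

text \<open>The cell of \<open>s\<close> in the partition induced by \<open>An n\<close>. Comparing
  approximations instead of subtracting sets keeps the definition meaningful for points covered by
  no set of \<open>An n\<close>.\<close>

definition nb :: "nat \<Rightarrow> 'a \<Rightarrow> 'a set" where
  "nb n s = {s'\<in>\<T>. PA n s' = PA n s}"

lemma nb_left_nbhd: "s \<in> \<Union>(An n) \<Longrightarrow> nb n s = PA n s - \<Union>{A' \<in> An n. A' \<subset> PA n s}"
proof -
  assume s: "s \<in> \<Union>(An n)"
  note PA = PA_An[OF s]
  have "s' \<in> \<Union>(An n)" if "s' \<in> \<T>" "PA n s' = PA n s" for s'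
    using PA_in[OF that(1), of n] that PA by auto
  then have nb: "s' \<in> nb n s \<longleftrightarrow> s' \<in> \<Union>(An n) \<and> PA n s' = PA n s" for s'
    using A_sub[OF An_A] unfolding nb_def by blast
  show ?thesis by (rule set_eqI) (simp only: nb left_nbhd_iff[OF PA])
qed

lemma nb_left_nbhds: "s \<in> \<Union>(An n) \<Longrightarrow> nb n s \<in> left_nbhds (An n)"
  unfolding left_nbhds_def by (rule CollectI, rule exI[of _ "PA n s"]) (simp add: nb_left_nbhd PA_An)

lemma nb_dec: "m \<le> n \<Longrightarrow> s \<in> \<T> \<Longrightarrow> nb n s \<subseteq> nb m s"
proof
  fix s' assume mn: "m \<le> n" and s: "s \<in> \<T>" and "s' \<in> nb n s"
  then have s': "s' \<in> \<T>" "PA n s' = PA n s" by (auto simp: nb_def)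
  have "x \<in> A \<longleftrightarrow> y \<in> A" if "x \<in> \<T>" "y \<in> \<T>" "PA n x = PA n y" "A \<in> An m \<union> {\<T>}" for x y A
    using that PA_least[of A n x] PA_least[of A n y] PA_in[of x n] PA_in[of y n] An_mono[OF mn] by blast
  from this[OF s'(1) s s'(2)] have "PA m s' = PA m s" by (auto simp: point_approx_def)
  then show "s' \<in> nb m s" using s' by (simp add: nb_def)
qed

lemma nb_self: "s \<in> \<T> \<Longrightarrow> s \<in> nb n s" by (simp add: nb_def)

lemma nb_Inter: "s \<in> \<T> \<Longrightarrow> (\<Inter>n. nb n s) = {s}"
  using pt_inj by (auto simp: nb_def point_set_def)

section \<open>Approximation of sets from above and countable domination\<close>

lemma hull_An_T: "A \<in> \<A> \<Longrightarrow> hull_approx \<T> An n A \<in> An n \<or> hull_approx \<T> An n A = \<T>"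
  unfolding hull_approx_def using A_sub by (intro Inter_An_T(1)[OF refl]) auto

lemma hull_dec: "m \<le> n \<Longrightarrow> hull_approx \<T> An n A \<subseteq> hull_approx \<T> An m A"
  using An_mono[of m n] by (auto simp: hull_approx_def)

lemma hull_sup: "A \<in> \<A> \<Longrightarrow> A \<subseteq> hull_approx \<T> An n A"
  using A_hull by blast

text \<open>This is the convergence of indicators that carries estimates from \<open>An n\<close> to
  \<open>\<A>\<close>. Intersecting with the union of \<open>An n\<close> is needed because the hull
  may be \<open>\<T>\<close>, about which \<open>An n\<close> says nothing.\<close>

lemma hull_eventually:
  assumes A: "A \<in> \<A>" and s: "s \<in> (\<Union>n. \<Union>(An n))"
  shows "\<forall>\<^sub>F n in sequentially. s \<in> hull_approx \<T> An n A \<inter> \<Union>(An n) \<longleftrightarrow> s \<in> A"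
proof -
  obtain k where k: "s \<in> \<Union>(An k)" using s by auto
  have cov: "s \<in> \<Union>(An n)" if "n \<ge> k" for n using An_mono[OF that] k by auto
  show ?thesis
  proof (cases "s \<in> A")
    case True
    then show ?thesis using cov hull_sup[OF A]
      by (auto simp: eventually_sequentially intro!: exI[of _ k])
  next
    case False
    then obtain j where "s \<notin> hull_approx \<T> An j A" using A_hull[OF A] by blast
    then have "s \<notin> hull_approx \<T> An n A" if "n \<ge> j" for n using hull_dec[OF that, of A] by auto
    then show ?thesis using False by (auto simp: eventually_sequentially)
  qed
qed

text \<open>All approximations of an uncovered point are \<open>\<T>\<close>. By TIP there is at
  most one such point.\<close>

lemma residual_point: "s \<in> \<T> \<Longrightarrow> s \<notin> (\<Union>n. \<Union>(An n)) \<Longrightarrow> pt s = \<T>"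
  using PA_T[of s] by (auto simp: point_set_def)

lemma cover_A: "A \<in> \<A> \<Longrightarrow> A \<noteq> \<T> \<Longrightarrow> \<exists>n. \<exists>B\<in>An n. A \<subseteq> B"
proof (rule ccontr)
  assume A: "A \<in> \<A>" "A \<noteq> \<T>" and "\<nexists>n. \<exists>B\<in>An n. A \<subseteq> B"
  then have "hull_approx \<T> An n A = \<T>" for n
    using A_sub[OF A(1)] by (auto simp: hull_approx_def)
  then show False using A_hull[OF A(1)] A by auto
qed

text \<open>A countable part of \<open>\<A>\<close> such that each member of \<open>\<A>\<close>
  lies inside one of its sets; it turns statements that hold almost surely for each set into
  statements that hold almost surely for all sets. \<open>\<T>\<close> is added because it can
  belong to \<open>\<A>\<close> without belonging to any \<open>An n\<close>.\<close>

definition dominating :: "'a set set" where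
  "dominating = (\<Union>n. An n) \<union> (if \<T> \<in> \<A> then {\<T>} else {})"

lemma countable_dominating: "countable dominating"
proof -
  have "countable (\<Union>n. An n)" by (rule countable_UN) (auto intro: countable_finite)
  then show ?thesis unfolding dominating_def by auto
qed

lemma dominating_A: "dominating \<subseteq> \<A>"
  using An_A by (auto simp: dominating_def)

lemma dominated: "A \<in> \<A> \<Longrightarrow> \<exists>B\<in>dominating. A \<subseteq> B"
  using cover_A[of A] by (cases "A = \<T>") (auto simp: dominating_def)

lemma Union_dominating: "\<Union>dominating = \<T>"
proof
  show "\<Union>dominating \<subseteq> \<T>" using dominating_A A_sub by blast
  show "\<T> \<subseteq> \<Union>dominating" using dominated pt_A pt_in by blast
qed

subsection \<open>Additive extensions\<close>

lemma C_I: "A \<in> \<A> \<Longrightarrow> finite F \<Longrightarrow> F \<subseteq> \<A> \<Longrightarrow> A - \<Union>F \<in> class_C \<A>"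
  by (auto simp: class_C_def finite_unions_def)

lemma C_E: assumes "C \<in> class_C \<A>" obtains A F where "A \<in> \<A>" "finite F" "F \<subseteq> \<A>" "C = A - \<Union>F"
  using assms by (auto simp: class_C_def finite_unions_def)

lemma A_in_C: "A \<in> \<A> \<Longrightarrow> A \<in> class_C \<A>" using C_I[of A "{}"] by simp

lemma C_Int: "C \<in> class_C \<A> \<Longrightarrow> D \<in> class_C \<A> \<Longrightarrow> C \<inter> D \<in> class_C \<A>"
proof -
  assume "C \<in> class_C \<A>" "D \<in> class_C \<A>"
  then obtain A F A' F' where F: "A \<in> \<A>" "finite F" "F \<subseteq> \<A>" "C = A - \<Union>F"
    "A' \<in> \<A>" "finite F'" "F' \<subseteq> \<A>" "D = A' - \<Union>F'" by (elim C_E)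
  then have "C \<inter> D = (A \<inter> A') - \<Union>(F \<union> F')" by auto
  then show ?thesis using C_I[of "A \<inter> A'" "F \<union> F'"] F A_Int by simp
qed

lemma Ck_sub_C: "class_Ck \<A> k \<subseteq> class_C \<A>"
proof
  fix C assume "C \<in> class_Ck \<A> k"
  then obtain A where A: "C = A 0 - (\<Union>i\<in>{1..k + 1}. A i)" "\<forall>i\<le>k + 1. A i \<in> \<A>"
    by (auto simp: class_Ck_def)
  show "C \<in> class_C \<A>" unfolding A(1) using A(2) by (intro C_I) auto
qed

lemma C_in_Cu: "C \<in> class_C \<A> \<Longrightarrow> C \<in> Cu"
  unfolding finite_unions_def by (auto intro!: exI[of _ "{C}"])

lemma Cu_I: "finite \<D> \<Longrightarrow> \<D> \<subseteq> class_C \<A> \<Longrightarrow> \<Union>\<D> \<in> Cu"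
  by (auto simp: finite_unions_def)

lemma Cu_Un: "U \<in> Cu \<Longrightarrow> V \<in> Cu \<Longrightarrow> U \<union> V \<in> Cu"
proof -
  assume "U \<in> Cu" "V \<in> Cu"
  then obtain F G where "finite F" "F \<subseteq> class_C \<A>" "U = \<Union>F" "finite G" "G \<subseteq> class_C \<A>" "V = \<Union>G"
    by (auto simp: finite_unions_def)
  then show ?thesis using Cu_I[of "F \<union> G"] by (simp add: Union_Un_distrib)
qed

lemma Cu_UN: "finite I \<Longrightarrow> (\<And>i. i \<in> I \<Longrightarrow> U i \<in> Cu) \<Longrightarrow> (\<Union>i\<in>I. U i) \<in> Cu"
proof (induction I rule: finite_induct)
  case empty
  then show ?case using Cu_I[of "{}"] by simp
qed (auto intro: Cu_Un)

lemma C_diff: "C \<in> class_C \<A> \<Longrightarrow> D \<in> class_C \<A> \<Longrightarrow> C - D \<in> Cu"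
proof -
  assume "C \<in> class_C \<A>" "D \<in> class_C \<A>"
  then obtain A F A' F' where F: "A \<in> \<A>" "finite F" "F \<subseteq> \<A>" "C = A - \<Union>F"
    "A' \<in> \<A>" "finite F'" "F' \<subseteq> \<A>" "D = A' - \<Union>F'" by (elim C_E)
  then have "C - D = (A - \<Union>(insert A' F)) \<union> (\<Union>B\<in>F'. (A \<inter> B) - \<Union>F)" by auto
  also have "\<dots> \<in> Cu" using F A_Int by (intro Cu_Un Cu_UN C_in_Cu C_I) auto
  finally show ?thesis .
qed

lemma Cu_diff_C: "U \<in> Cu \<Longrightarrow> D \<in> class_C \<A> \<Longrightarrow> U - D \<in> Cu"
proof -
  assume "U \<in> Cu" and D: "D \<in> class_C \<A>"
  then obtain F where F: "finite F" "F \<subseteq> class_C \<A>" "U = \<Union>F" by (auto simp: finite_unions_def)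
  have "U - D = (\<Union>C\<in>F. C - D)" using F by auto
  then show ?thesis using Cu_UN[OF F(1), of "\<lambda>C. C - D"] C_diff[OF _ D] F by auto
qed

lemma Cu_diff: "finite \<D> \<Longrightarrow> \<D> \<subseteq> class_C \<A> \<Longrightarrow> U \<in> Cu \<Longrightarrow> U - \<Union>\<D> \<in> Cu"
proof (induction \<D> rule: finite_induct)
  case (insert D \<D>)
  have "U - \<Union>(insert D \<D>) = (U - \<Union>\<D>) - D" by auto
  then show ?case using insert Cu_diff_C by auto
qed simp

text \<open>The steps mirror additivity: the value on a disjoint union is determined by the two
  parts, and the value on one part by the union and the other part. Both uniqueness of the additive
  extension and convergence of additive functions follow this pattern.\<close>

lemma Cu_induct[consumes 1, case_names base union diff]:
  assumes U: "U \<in> Cu"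
    and base: "\<And>A. A \<in> \<A> \<Longrightarrow> Q A"
    and union: "\<And>U V. U \<in> Cu \<Longrightarrow> V \<in> Cu \<Longrightarrow> U \<inter> V = {} \<Longrightarrow> Q U \<Longrightarrow> Q V \<Longrightarrow> Q (U \<union> V)"
    and diff: "\<And>U V. U \<in> Cu \<Longrightarrow> V \<in> Cu \<Longrightarrow> U \<inter> V = {} \<Longrightarrow> Q (U \<union> V) \<Longrightarrow> Q U \<Longrightarrow> Q V"
  shows "Q U"
proof -
  have C': "Q (A - \<Union>F)" if "finite F" "F \<subseteq> \<A>" "A \<in> \<A>" for A F
    using that
  proof (induction F arbitrary: A rule: finite_induct)
    case (insert B F)
    have "Q ((A \<inter> B) - \<Union>F)" "Q (A - \<Union>F)" using insert A_Int by auto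
    moreover have "((A \<inter> B) - \<Union>F) \<union> (A - \<Union>(insert B F)) = A - \<Union>F" by auto
    moreover have "(A \<inter> B) - \<Union>F \<in> Cu"
      by (rule C_in_Cu, rule C_I) (use insert A_Int in auto)
    moreover have "A - \<Union>(insert B F) \<in> Cu"
      by (rule C_in_Cu, rule C_I) (use insert in auto)
    ultimately show ?case using diff[of "(A \<inter> B) - \<Union>F" "A - \<Union>(insert B F)"] by auto
  qed (auto intro: base)
  then have C: "Q C" if "C \<in> class_C \<A>" for C using that by (auto elim!: C_E)
  \<comment> \<open>A new set \<open>D\<close> overlaps the union already formed, so it can only be
    attached through \<open>D - \<Union>\<D>\<close>. That set is reached by the difference step
    from \<open>D\<close> and \<open>D \<inter> \<Union>\<D>\<close>, which is why traces of unions
    come first.\<close>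
  have CU: "Q (C \<inter> \<Union>\<D>)" if "finite \<D>" "\<D> \<subseteq> class_C \<A>" "C \<in> class_C \<A>" for C \<D>
    using that
  proof (induction \<D> arbitrary: C rule: finite_induct)
    case (insert D \<D>)
    have CD: "C \<inter> D \<in> class_C \<A>" using insert C_Int by auto
    have inCu: "E \<inter> \<Union>\<D> \<in> Cu" if "E \<in> class_C \<A>" for E
    proof -
      have "E \<inter> \<Union>\<D> = (\<Union>X\<in>\<D>. E \<inter> X)" by auto
      then show ?thesis using Cu_UN[OF insert.hyps(1), of "\<lambda>X. E \<inter> X"] C_Int[OF that] C_in_Cu insert.prems by auto
    qed
    have dCu: "(C \<inter> D) - \<Union>\<D> \<in> Cu" using CD insert by (intro Cu_diff C_in_Cu) auto
    have "(C \<inter> D) \<inter> \<Union>\<D> \<union> ((C \<inter> D) - \<Union>\<D>) = C \<inter> D" by auto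
    then have "Q ((C \<inter> D) - \<Union>\<D>)"
      using diff[OF inCu[OF CD] dCu] insert.IH[OF _ CD] insert.prems C[OF CD] by auto
    moreover have "(C \<inter> \<Union>\<D>) \<union> ((C \<inter> D) - \<Union>\<D>) = C \<inter> \<Union>(insert D \<D>)" by auto
    moreover have "Q (C \<inter> \<Union>\<D>)" "C \<inter> \<Union>\<D> \<in> Cu" using insert inCu by auto
    ultimately show ?case using union[of "C \<inter> \<Union>\<D>" "(C \<inter> D) - \<Union>\<D>"] dCu by auto
  qed (auto intro: base)
  obtain \<D> where "finite \<D>" "\<D> \<subseteq> class_C \<A>" "U = \<Union>\<D>" using U by (auto simp: finite_unions_def)
  then show ?thesis unfolding \<open>U = \<Union>\<D>\<close>
  proof (induction \<D> arbitrary: U rule: finite_induct)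
    case (insert D \<D>)
    have D: "D \<in> class_C \<A>" using insert by auto
    have inCu: "\<Union>\<D> \<in> Cu" "D - \<Union>\<D> \<in> Cu" "D \<inter> \<Union>\<D> \<in> Cu"
    proof -
      have "D \<inter> \<Union>\<D> = (\<Union>X\<in>\<D>. D \<inter> X)" by auto
      then show "D \<inter> \<Union>\<D> \<in> Cu" using Cu_UN[OF insert.hyps(1), of "\<lambda>X. D \<inter> X"] C_Int[OF D] C_in_Cu insert.prems by auto
      show "\<Union>\<D> \<in> Cu" using insert by (intro Cu_I) auto
      show "D - \<Union>\<D> \<in> Cu" using Cu_diff[OF insert.hyps(1) _ C_in_Cu[OF D]] insert.prems by auto
    qed
    have "D \<inter> \<Union>\<D> \<union> (D - \<Union>\<D>) = D" by auto
    then have "Q (D - \<Union>\<D>)"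
      using diff[OF inCu(3,2)] CU[OF insert.hyps(1) _ D] insert.prems C[OF D] by auto
    moreover have "\<Union>\<D> \<union> (D - \<Union>\<D>) = \<Union>(insert D \<D>)" by auto
    ultimately show ?case using union[OF inCu(1,2)] insert by auto
  qed (auto intro: base)
qed

lemma Delta_eqI: assumes g: "additive_extension \<A> h g" shows "Delta \<A> h = g"
  unfolding Delta_def
proof (rule the_equality[where P = "additive_extension \<A> h", OF g])
  fix g' assume g': "additive_extension \<A> h g'"
  have "g' U = g U" if "U \<in> Cu" for U
    using that
  proof (induction U rule: Cu_induct)
    case (base A)
    then show ?case using g g' by (auto simp: additive_extension_def)
  next
    case (union U V)
    then show ?case using g g' by (auto simp: additive_extension_def)
  next
    case (diff U V)
    have "g (U \<union> V) = g U + g V" "g' (U \<union> V) = g' U + g' V"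
      using diff g g' unfolding additive_extension_def by blast+
    then show ?case using diff by auto
  qed
  moreover have "g \<in> extensional Cu" "g' \<in> extensional Cu" using g g' by (auto simp: additive_extension_def)
  ultimately show "g' = g" by (auto intro: extensionalityI)
qed

text \<open>\<open>Delta\<close> is a definite description and can be used only once an additive
  extension is known to exist. Here the extension is constructed as a pointwise limit: convergence
  spreads from \<open>\<A>\<close> to all finite unions by the preceding induction, and the limit
  inherits additivity.\<close>

lemma tendsto_Delta:
  fixes Y :: "'e \<Rightarrow> 'a set \<Rightarrow> real"
  assumes F: "F \<noteq> bot" and h: "\<And>A. A \<in> \<A> \<Longrightarrow> ((\<lambda>e. Y e A) \<longlongrightarrow> h A) F"
    and add: "\<And>U V. U \<in> Cu \<Longrightarrow> V \<in> Cu \<Longrightarrow> U \<inter> V = {} \<Longrightarrow> \<forall>\<^sub>F e in F. Y e (U \<union> V) = Y e U + Y e V"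
    and U: "U \<in> Cu"
  shows "((\<lambda>e. Y e U) \<longlongrightarrow> Delta \<A> h U) F"
proof -
  define g where "g U = (if U \<in> Cu then Lim F (\<lambda>e. Y e U) else undefined)" for U
  have conv: "\<exists>l. ((\<lambda>e. Y e U) \<longlongrightarrow> l) F" if "U \<in> Cu" for U
    using that
  proof (induction U rule: Cu_induct)
    case (base A)
    then show ?case using h by auto
  next
    case (union U V)
    then obtain l l' where "((\<lambda>e. Y e U) \<longlongrightarrow> l) F" "((\<lambda>e. Y e V) \<longlongrightarrow> l') F" by auto
    then have "((\<lambda>e. Y e U + Y e V) \<longlongrightarrow> l + l') F" by (rule tendsto_add)
    then have "((\<lambda>e. Y e (U \<union> V)) \<longlongrightarrow> l + l') F"
      by (rule Lim_transform_eventually) (use add[OF union(1-3)] in \<open>auto elim: eventually_mono\<close>)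
    then show ?case by auto
  next
    case (diff U V)
    then obtain l l' where "((\<lambda>e. Y e (U \<union> V)) \<longlongrightarrow> l) F" "((\<lambda>e. Y e U) \<longlongrightarrow> l') F" by auto
    then have "((\<lambda>e. Y e (U \<union> V) - Y e U) \<longlongrightarrow> l - l') F" by (rule tendsto_diff)
    then have "((\<lambda>e. Y e V) \<longlongrightarrow> l - l') F"
      by (rule Lim_transform_eventually) (use add[OF diff(1-3)] in \<open>auto elim: eventually_mono\<close>)
    then show ?case by auto
  qed
  have lim: "((\<lambda>e. Y e U) \<longlongrightarrow> g U) F" if "U \<in> Cu" for U
    using conv[OF that] that tendsto_Lim[OF F] by (auto simp: g_def)
  have "additive_extension \<A> h g"
    unfolding additive_extension_def
  proof (intro conjI ballI impI)
    show "g \<in> extensional Cu" by (auto simp: g_def extensional_def)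
    fix A assume "A \<in> \<A>"
    then show "g A = h A" using tendsto_unique[OF F lim h] A_in_C C_in_Cu by blast
  next
    fix U V assume UV: "U \<in> Cu" "V \<in> Cu" "U \<inter> V = {}"
    have "((\<lambda>e. Y e U + Y e V) \<longlongrightarrow> g U + g V) F" by (intro tendsto_add lim UV)
    then have "((\<lambda>e. Y e (U \<union> V)) \<longlongrightarrow> g U + g V) F"
      by (rule Lim_transform_eventually) (use add[OF UV] in \<open>auto elim: eventually_mono\<close>)
    then show "g (U \<union> V) = g U + g V" using tendsto_unique[OF F lim[OF Cu_Un[OF UV(1,2)]]] by blast
  qed
  then show ?thesis using Delta_eqI lim[OF U] by simp
qed

subsection \<open>Extremal representations\<close>

text \<open>If the tip of \<open>A\<close> lay in some \<open>B\<close> of \<open>F\<close>, then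
  \<open>A\<close> would be contained in \<open>B\<close> and the difference would be empty.\<close>

lemma tip_of_difference:
  assumes "A \<in> \<A>" "F \<subseteq> \<A>" "A - \<Union>F \<noteq> {}"
  shows "\<exists>s\<in>\<T>. pt s = A \<and> s \<in> A - \<Union>F"
proof -
  obtain s where s: "s \<in> \<T>" "pt s = A" using tip[OF assms(1)] assms by auto
  then have "s \<notin> B" if "B \<in> F" for B using pt_least[of B s] assms that by auto
  then show ?thesis using s pt_in by auto
qed

text \<open>The subtracted sets are replaced by their traces on \<open>A\<close>, of which only the
  nonempty maximal ones are kept.\<close>

lemma extremal_rep_ex:
  assumes "C \<in> class_C \<A>" shows "\<exists>A0 F. extremal_rep \<A> C A0 F"
proof -
  obtain A F where F: "A \<in> \<A>" "finite F" "F \<subseteq> \<A>" "C = A - \<Union>F" using assms by (rule C_E)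
  define G where "G = (\<inter>) A ` F"
  define H where "H = {B\<in>G. B \<noteq> {} \<and> (\<forall>B'\<in>G. B \<subseteq> B' \<longrightarrow> B = B')}"
  have G: "finite G" "G \<subseteq> \<A>" using F A_Int by (auto simp: G_def)
  have "\<exists>B'\<in>H. B \<subseteq> B'" if B: "B \<in> G" "B \<noteq> {}" for B
  proof -
    obtain B' where B': "B' \<in> G" "B \<subseteq> B'" "\<forall>b\<in>G. B' \<subseteq> b \<longrightarrow> B' = b"
      using finite_has_maximal2[OF G(1) B(1)] by blast
    then have "B' \<in> H" using B(2) by (simp add: H_def) (use B' in blast)
    then show ?thesis using B' by blast
  qed
  then have "\<Union>G \<subseteq> \<Union>H" by blast
  moreover have "\<Union>H \<subseteq> \<Union>G" unfolding H_def by blast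
  ultimately have "\<Union>G = \<Union>H" by blast
  then have "C = A - \<Union>H" using F by (auto simp: G_def)
  then have "extremal_rep \<A> C A H"
    unfolding extremal_rep_def
  proof (intro conjI)
    show "finite H" using G(1) by (simp add: H_def)
    show "H \<subseteq> \<A>" using G(2) unfolding H_def by blast
    show "{} \<notin> H" by (simp add: H_def)
    show "\<forall>B\<in>H. B \<subseteq> A" unfolding H_def G_def by blast
    show "\<forall>B\<in>H. \<forall>B'\<in>H. B \<subseteq> B' \<longrightarrow> B = B'" unfolding H_def by blast
  qed (use F in auto)
  then show ?thesis by blast
qed

lemma extremal_rep_tip:
  assumes "extremal_rep \<A> C A0 F" "C \<noteq> {}"
  shows "\<exists>s\<in>\<T>. pt s = A0 \<and> s \<in> C"
proof -
  have "A0 \<in> \<A>" "F \<subseteq> \<A>" "C = A0 - \<Union>F" using assms(1) by (auto simp: extremal_rep_def)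
  then show ?thesis using tip_of_difference[of A0 F] assms(2) by blast
qed

text \<open>The tip of the outer set lies in \<open>C\<close>, so the outer set is the least set of
  \<open>\<A>\<close> containing \<open>C\<close>. For the subtracted sets, SHAPE places each member
  of one family inside a member of the other; going back and forth, incomparability forces
  equality.\<close>

lemma extremal_rep_unique:
  assumes C: "C \<noteq> {}" and 1: "extremal_rep \<A> C A F" and 2: "extremal_rep \<A> C B G"
  shows "A = B" "F = G"
proof -
  show AB: "A = B"
  proof
    show "A \<subseteq> B" using extremal_rep_tip[OF 1 C] 2 pt_least[of B] by (auto simp: extremal_rep_def)
    show "B \<subseteq> A" using extremal_rep_tip[OF 2 C] 1 pt_least[of A] by (auto simp: extremal_rep_def)
  qed
  have U: "\<Union>F = \<Union>G"
  proof -
    have "\<Union>F = A - C" "\<Union>G = B - C" using 1 2 by (auto simp: extremal_rep_def)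
    then show ?thesis using AB by simp
  qed
  have "F \<subseteq> G" if F: "extremal_rep \<A> C A F" and G: "extremal_rep \<A> C B G" and U: "\<Union>F = \<Union>G" for F G A B
  proof
    have dom: "\<exists>Y\<in>G. X \<subseteq> Y" if "X \<in> F" "extremal_rep \<A> C A F" "extremal_rep \<A> C B G" "\<Union>F = \<Union>G" for X F G A B
    proof -
      have "X \<noteq> {}" "X \<in> \<A>" "X \<subseteq> \<Union>G" "finite G" "G \<subseteq> \<A>" using that by (auto simp: extremal_rep_def)
      moreover from this have "G \<noteq> {}" by auto
      ultimately show ?thesis using shape by blast
    qed
    fix X assume X: "X \<in> F"
    obtain Y where Y: "Y \<in> G" "X \<subseteq> Y" using dom[OF X F G U] by auto
    obtain Z where Z: "Z \<in> F" "Y \<subseteq> Z" using dom[OF Y(1) G F U[symmetric]] by auto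
    have "\<forall>A\<in>F. \<forall>A'\<in>F. A \<subseteq> A' \<longrightarrow> A = A'" using F by (simp add: extremal_rep_def)
    then have "X = Z" using X Z Y by (meson order_trans)
    then show "X \<in> G" using Y Z by auto
  qed
  from this[OF 1 2 U] this[OF 2 1 U[symmetric]] show "F = G" by auto
qed

lemma extremal_sets_eq:
  assumes "extremal_rep \<A> C A F" "C \<noteq> {}"
  shows "extremal_sets \<A> C = insert A F"
proof -
  have "(THE E. \<exists>A0 F. extremal_rep \<A> C A0 F \<and> E = insert A0 F) = insert A F"
    by (rule the_equality) (use assms extremal_rep_unique[OF assms(2,1)] in blast)+
  then show ?thesis using assms(2) by (simp add: extremal_sets_def)
qed

lemma extremal_sets_self: "A \<in> \<A> \<Longrightarrow> A \<noteq> {} \<Longrightarrow> extremal_sets \<A> A = {A}"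
  using extremal_sets_eq[of A A "{}"] by (simp add: extremal_rep_def)

lemma class_C_dist_self:
  assumes "A \<in> \<A>" "A \<noteq> {}" "extremal_rep \<A> C A0 F" "C \<noteq> {}"
  shows "class_C_dist \<A> d A C = Max ((\<lambda>y. d A y) ` insert A0 F)"
proof -
  let ?E = "insert A0 F"
  have E: "finite ?E" using assms by (auto simp: extremal_rep_def)
  have le: "Min (d A ` ?E) \<le> Max (d A ` ?E)"
    using E by (intro order_trans[OF Min_le Max_ge, of _ "d A A0"]) auto
  have "(MAX x\<in>{A}. MIN y\<in>?E. d x y) = Min (d A ` ?E)" by simp
  moreover have "(MAX y\<in>?E. MIN x\<in>{A}. d x y) = Max (d A ` ?E)" by simp
  ultimately show ?thesis
    unfolding class_C_dist_def hausdorff_dist_def extremal_sets_eq[OF assms(3,4)] extremal_sets_self[OF assms(1,2)]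
    using le by (simp only: max_def if_True)
qed

end

subsection \<open>Compatible metrics\<close>

locale indexing_metric = indexing +
  fixes d :: "'a set \<Rightarrow> 'a set \<Rightarrow> real"
  assumes compat: "compatible_metric \<T> \<A> An d"
begin

abbreviation "dT \<equiv> point_dist \<T> An d"

lemma d_nonneg: "A \<in> \<A> \<Longrightarrow> B \<in> \<A> \<Longrightarrow> 0 \<le> d A B"
  and d_sym: "A \<in> \<A> \<Longrightarrow> B \<in> \<A> \<Longrightarrow> d A B = d B A"
  and d_self: "A \<in> \<A> \<Longrightarrow> d A A = 0"
  and d_tri: "A \<in> \<A> \<Longrightarrow> B \<in> \<A> \<Longrightarrow> C \<in> \<A> \<Longrightarrow> d A C \<le> d A B + d B C"
  and d_half: "A \<in> \<A> \<Longrightarrow> B \<in> \<A> \<Longrightarrow> A \<subseteq> B \<Longrightarrow>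
        (\<exists>A''\<in>\<A>. A \<subseteq> A'' \<and> A'' \<subseteq> B \<and> d A A'' = d A B / 2 \<and> d A'' B = d A B / 2)"
  and d_diam: "(\<lambda>n. SUP C\<in>left_nbhds (An n). point_diam \<T> An d C) \<longlonglongrightarrow> 0"
  and d_cont: "(\<And>n. S n \<in> \<A>) \<Longrightarrow> decseq S \<Longrightarrow> (\<lambda>n. d (S n) (\<Inter>k. S k)) \<longlonglongrightarrow> 0"
proof -
  note c = compat[unfolded compatible_metric_def pseudo_metric_on_def]
  show "A \<in> \<A> \<Longrightarrow> B \<in> \<A> \<Longrightarrow> 0 \<le> d A B" "A \<in> \<A> \<Longrightarrow> B \<in> \<A> \<Longrightarrow> d A B = d B A" "A \<in> \<A> \<Longrightarrow> d A A = 0"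
    "A \<in> \<A> \<Longrightarrow> B \<in> \<A> \<Longrightarrow> C \<in> \<A> \<Longrightarrow> d A C \<le> d A B + d B C"
    using c by auto
  have 1: "\<forall>A\<in>\<A>. \<forall>A'\<in>\<A>. A \<subseteq> A' \<longrightarrow>
        (\<exists>A''\<in>\<A>. A \<subseteq> A'' \<and> A'' \<subseteq> A' \<and> d A A'' = d A A' / 2 \<and> d A'' A' = d A A' / 2)"
    using c by (elim conjE)
  then show "A \<in> \<A> \<Longrightarrow> B \<in> \<A> \<Longrightarrow> A \<subseteq> B \<Longrightarrow>
        (\<exists>A''\<in>\<A>. A \<subseteq> A'' \<and> A'' \<subseteq> B \<and> d A A'' = d A B / 2 \<and> d A'' B = d A B / 2)"
    by simp
  show "(\<lambda>n. SUP C\<in>left_nbhds (An n). point_diam \<T> An d C) \<longlonglongrightarrow> 0" using c by (elim conjE)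
  have "\<forall>S. range S \<subseteq> \<A> \<and> decseq S \<longrightarrow> (\<lambda>n. d (S n) (\<Inter>k. S k)) \<longlonglongrightarrow> 0" using c by (elim conjE)
  then show "(\<And>n. S n \<in> \<A>) \<Longrightarrow> decseq S \<Longrightarrow> (\<lambda>n. d (S n) (\<Inter>k. S k)) \<longlonglongrightarrow> 0" by (simp add: image_subset_iff)
qed

lemma point_diam_dist: "s \<in> C \<Longrightarrow> s' \<in> C \<Longrightarrow> ennreal (dT s s') \<le> point_diam \<T> An d C"
  unfolding point_diam_def by (meson SUP_upper2 order_refl)

text \<open>Halving the step from \<open>B\<close> to \<open>A0\<close> produces a set whose tip lies in \<open>C\<close>.\<close>

lemma dist_le_diam:
  assumes B: "B \<in> \<A>" "B \<subseteq> A0" and s0: "s0 \<in> \<T>" "pt s0 = A0" "s0 \<in> C"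
    and C: "\<And>s. s \<in> \<T> \<Longrightarrow> B \<subset> pt s \<Longrightarrow> pt s \<subseteq> A0 \<Longrightarrow> s \<in> C"
    and diam: "point_diam \<T> An d C \<le> ennreal r" "0 \<le> r"
  shows "d B A0 \<le> 2 * r"
proof (cases "d B A0 = 0")
  case False
  have A0: "A0 \<in> \<A>" using pt_A s0 by auto
  obtain A where A: "A \<in> \<A>" "B \<subseteq> A" "A \<subseteq> A0" "d B A = d B A0 / 2" "d A A0 = d B A0 / 2"
    using d_half[OF B(1) A0 B(2)] by auto
  have "A \<noteq> B" using A False d_self[OF B(1)] by auto
  then have "A \<noteq> {}" using A by auto
  then obtain s where s: "s \<in> \<T>" "pt s = A" using tip[OF A(1)] by blast
  have "s \<in> C" using C[OF s(1)] s A \<open>A \<noteq> B\<close> by auto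
  then have "ennreal (dT s s0) \<le> ennreal r" using point_diam_dist[OF _ s0(3)] diam order_trans by blast
  then have "d A A0 \<le> r" using s s0 diam by (simp add: point_dist_def)
  then show ?thesis using A by simp
qed (use diam in simp)

text \<open>A point whose set lies strictly between \<open>B\<close> and \<open>A0\<close> belongs
  to no other subtracted set \<open>X\<close>, since then \<open>B\<close> would be contained in
  \<open>X\<close>, against incomparability. So it belongs to \<open>C\<close>, and the halving
  argument applies.\<close>

lemma extremal_dist_le_diam:
  assumes rep: "extremal_rep \<A> C A0 F" "C \<noteq> {}" and B: "B \<in> F"
    and diam: "point_diam \<T> An d C \<le> ennreal r" "0 \<le> r"
  shows "d B A0 \<le> 2 * r"
proof -
  obtain s0 where s0: "s0 \<in> \<T>" "pt s0 = A0" "s0 \<in> C" using extremal_rep_tip[OF rep] by auto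
  have r: "A0 \<in> \<A>" "F \<subseteq> \<A>" "C = A0 - \<Union>F" "B \<subseteq> A0" "\<And>X Y. X \<in> F \<Longrightarrow> Y \<in> F \<Longrightarrow> X \<subseteq> Y \<Longrightarrow> X = Y"
    using rep B by (auto simp: extremal_rep_def)
  show ?thesis
  proof (rule dist_le_diam[OF _ r(4) s0 _ diam])
    fix s assume s: "s \<in> \<T>" "B \<subset> pt s" "pt s \<subseteq> A0"
    have "s \<notin> X" if "X \<in> F" for X
    proof
      assume "s \<in> X"
      then have "pt s \<subseteq> X" using pt_least that r(2) by auto
      then have "B = X" using r(5)[OF B that] s by auto
      then show False using s \<open>pt s \<subseteq> X\<close> by auto
    qed
    then show "s \<in> C" using s pt_in[OF s(1)] r(3) by auto
  qed (use B r in auto)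
qed

text \<open>Only the outer set has to be close to \<open>pt t\<close>, as each subtracted set is
  within \<open>2 * r\<close> of it by the diameter bound.\<close>

lemma class_C_ballI:
  assumes t: "t \<in> \<T>" and C: "C \<in> class_C \<A>" "C \<noteq> {}" and diam: "point_diam \<T> An d C \<le> ennreal r" "0 \<le> r"
    and rep: "extremal_rep \<A> C A0 F" and \<rho>: "d (pt t) A0 + 2 * r < \<rho>"
  shows "C \<in> class_C_ball \<A> d (pt t) \<rho>"
proof -
  have r: "A0 \<in> \<A>" "F \<subseteq> \<A>" "finite F" using rep by (auto simp: extremal_rep_def)
  have "d (pt t) B < \<rho>" if "B \<in> insert A0 F" for B
  proof (cases "B = A0")
    case False
    then have "d B A0 \<le> 2 * r" using extremal_dist_le_diam[OF rep C(2) _ diam] that by auto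
    then show ?thesis using \<rho> d_tri[OF pt_A[OF t] r(1), of B] d_sym[OF r(1), of B] that r by auto
  qed (use \<rho> diam in simp)
  then have "Max ((\<lambda>y. d (pt t) y) ` insert A0 F) < \<rho>" using r by (subst Max_less_iff) auto
  moreover have "pt t \<noteq> {}" using pt_in[OF t] by auto
  ultimately show ?thesis using class_C_dist_self[OF pt_A[OF t] _ rep C(2), of d] C(1)
    by (simp add: class_C_ball_def)
qed

text \<open>The tip of the outer set is a point of \<open>C\<close> at distance less than \<rho>
  from \<open>t\<close>, and the diameter adds less than another \<rho>; hence the factor 2.\<close>

lemma class_C_ballD:
  assumes t: "t \<in> \<T>" and C: "C \<in> class_C_ball \<A> d (pt t) \<rho>" "point_diam \<T> An d C < ennreal \<rho>"
  shows "C \<subseteq> point_ball \<T> An d t (2 * \<rho>)"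
proof (cases "C = {}")
  case False
  have CC: "C \<in> class_C \<A>" using C by (auto simp: class_C_ball_def)
  obtain A0 F where rep: "extremal_rep \<A> C A0 F" using extremal_rep_ex[OF CC] by auto
  have r: "A0 \<in> \<A>" "finite F" "C \<subseteq> A0" using rep by (auto simp: extremal_rep_def)
  have "pt t \<noteq> {}" using pt_in[OF t] by auto
  then have "Max ((\<lambda>y. d (pt t) y) ` insert A0 F) < \<rho>"
    using C(1) class_C_dist_self[OF pt_A[OF t] _ rep False, of d] by (simp add: class_C_ball_def)
  then have d0: "d (pt t) A0 < \<rho>" using r by (subst (asm) Max_less_iff) auto
  obtain s0 where s0: "s0 \<in> \<T>" "pt s0 = A0" "s0 \<in> C" using extremal_rep_tip[OF rep False] by auto
  show ?thesis
  proof
    fix s assume s: "s \<in> C"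
    then have sT: "s \<in> \<T>" using r A_sub by auto
    have "ennreal (dT s0 s) < ennreal \<rho>" using point_diam_dist[OF s0(3) s] C(2) by (rule order.strict_trans1)
    then have "d A0 (pt s) < \<rho>" using s0 d_nonneg[OF r(1) pt_A[OF sT]] by (simp add: point_dist_def ennreal_less_iff)
    then show "s \<in> point_ball \<T> An d t (2 * \<rho>)"
      using d0 d_tri[OF pt_A[OF t] r(1) pt_A[OF sT]] sT by (simp add: point_ball_def point_dist_def)
  qed
qed simp

lemma tendsto_PA:
  assumes s: "s \<in> \<T>" "s \<in> \<Union>(An k)" and t: "t \<in> \<T>"
  shows "(\<lambda>n. d (PA n s) (pt t)) \<longlonglongrightarrow> d (pt s) (pt t)"
proof -
  \<comment> \<open>The offset skips the stages at which \<open>s\<close> is uncovered: there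
    \<open>PA n s\<close> is \<open>\<T>\<close>, possibly outside \<open>\<A>\<close>, where the
    axioms of \<open>d\<close> do not apply.\<close>
  define S where "S n = PA (n + k) s" for n
  have cov: "s \<in> \<Union>(An (n + k))" for n using An_mono[of k "n + k"] s by auto
  have S: "S n \<in> \<A>" for n unfolding S_def using PA_An[OF cov] An_A by auto
  have dec: "decseq S" unfolding S_def decseq_def using PA_dec by auto
  have "(\<Inter>n. S n) = pt s"
  proof
    show "pt s \<subseteq> (\<Inter>n. S n)" by (auto simp: S_def point_set_def)
    have "S n \<subseteq> PA n s" for n unfolding S_def by (rule PA_dec) simp
    then show "(\<Inter>n. S n) \<subseteq> pt s" by (auto simp: point_set_def)
  qed
  then have lim: "(\<lambda>n. d (S n) (pt s)) \<longlonglongrightarrow> 0" using d_cont[OF S dec] by simp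
  have "(\<lambda>n. d (S n) (pt t)) \<longlonglongrightarrow> d (pt s) (pt t)"
  proof (rule tendsto_sandwich)
    show "(\<lambda>n. d (pt s) (pt t) - d (S n) (pt s)) \<longlonglongrightarrow> d (pt s) (pt t)"
      using tendsto_diff[OF tendsto_const lim] by auto
    show "(\<lambda>n. d (pt s) (pt t) + d (S n) (pt s)) \<longlonglongrightarrow> d (pt s) (pt t)"
      using tendsto_add[OF tendsto_const lim] by auto
    show "\<forall>\<^sub>F n in sequentially. d (pt s) (pt t) - d (S n) (pt s) \<le> d (S n) (pt t)"
      using d_tri[OF pt_A[OF s(1)] S pt_A[OF t]] d_sym[OF pt_A[OF s(1)] S] by (auto intro!: always_eventually simp: algebra_simps)
    show "\<forall>\<^sub>F n in sequentially. d (S n) (pt t) \<le> d (pt s) (pt t) + d (S n) (pt s)"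
      using d_tri[OF S pt_A[OF s(1)] pt_A[OF t]] by (auto intro!: always_eventually simp: algebra_simps)
  qed
  then show ?thesis unfolding S_def by (rule LIMSEQ_offset)
qed

text \<open>The distance is a limit of functions that are constant on left neighbourhoods. On points
  that are never covered the approximating value \<open>d \<T> (pt t)\<close> is already
  exact.\<close>

lemma point_dist_measurable:
  assumes m: "space m = \<T>" "sets m = sigma_sets \<T> \<A>" and t: "t \<in> \<T>"
  shows "(\<lambda>s. dT s t) \<in> borel_measurable m"
proof -
  have A_m: "A \<in> sets m" if "A \<in> \<A>" for A using that m by auto
  have T_m: "\<T> \<in> sets m" using m sets.top by metis
  define L where "L n B = B - \<Union>{A' \<in> An n. A' \<subset> B}" for n B
  define g where "g n s = (\<Sum>B\<in>An n. d B (pt t) * indicator (L n B) s) + d \<T> (pt t) * indicator (\<T> - \<Union>(An n)) s" for n s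
  have L_m: "L n B \<in> sets m" if "B \<in> An n" for n B
    unfolding L_def using that An_A A_m by (intro sets.Diff sets.finite_Union) (auto)
  have U_m: "\<T> - \<Union>(An n) \<in> sets m" for n
    using T_m An_A A_m by (intro sets.Diff sets.finite_Union) auto
  have g_m: "g n \<in> borel_measurable m" for n
    unfolding g_def using L_m U_m by (intro borel_measurable_add borel_measurable_sum borel_measurable_times borel_measurable_const borel_measurable_indicator) auto
  have gcov: "g n s = d (PA n s) (pt t)" if "s \<in> \<Union>(An n)" for n s
  proof -
    have "d B (pt t) * indicator (L n B) s = (if B = PA n s then d (PA n s) (pt t) else 0)" if "B \<in> An n" for B
      using left_nbhd_iff[OF that, of s] \<open>s \<in> \<Union>(An n)\<close> by (auto simp: L_def indicator_def)
    then have "(\<Sum>B\<in>An n. d B (pt t) * indicator (L n B) s) = d (PA n s) (pt t)"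
      using PA_An[OF that] by simp
    then show ?thesis using that by (simp add: g_def)
  qed
  have gunc: "g n s = d \<T> (pt t)" if "s \<in> \<T>" "s \<notin> \<Union>(An n)" for n s
    using that by (auto simp: g_def L_def indicator_def intro!: sum.neutral)
  have lim: "(\<lambda>n. g n s) \<longlonglongrightarrow> dT s t" if s: "s \<in> \<T>" for s
  proof (cases "s \<in> (\<Union>n. \<Union>(An n))")
    case True
    then obtain k where k: "s \<in> \<Union>(An k)" by auto
    have "\<forall>\<^sub>F n in sequentially. g n s = d (PA n s) (pt t)"
      unfolding eventually_sequentially using An_mono[of k] k by (intro exI[of _ k]) (auto intro!: gcov)
    then show ?thesis using tendsto_PA[OF s k t] unfolding point_dist_def
      by (simp cong: tendsto_cong)
  next
    case False
    then show ?thesis using gunc[OF s] residual_point[OF s False] by (simp add: point_dist_def)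
  qed
  show ?thesis by (rule borel_measurable_LIMSEQ_real[OF _ g_m]) (use lim m in auto)
qed

end

section \<open>Sample paths of the jump integral\<close>

text \<open>Each subtracted set writes a value of \<open>g\<close> as a difference of two values
  with one subtracted set less, which doubles the bound; \<open>class_Ck \<A> k\<close> subtracts
  \<open>k + 1\<close> sets.\<close>

lemma (in indexing) Ck_bound:
  fixes g :: "'a set \<Rightarrow> real"
  assumes add: "\<And>U V. U \<in> Cu \<Longrightarrow> V \<in> Cu \<Longrightarrow> U \<inter> V = {} \<Longrightarrow> g (U \<union> V) = g U + g V"
    and bnd: "\<And>B. B \<in> \<A> \<Longrightarrow> B \<subseteq> A \<Longrightarrow> \<bar>g B\<bar> \<le> \<eta>"
    and A: "A \<in> \<A>" and C: "C \<in> class_Ck \<A> k" "C \<subseteq> A"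
  shows "\<bar>g C\<bar> \<le> 2 ^ (k + 1) * \<eta>"
proof -
  obtain X where X: "C = X 0 - (\<Union>i\<in>{1..k + 1}. X i)" "\<And>i. i \<le> k + 1 \<Longrightarrow> X i \<in> \<A>"
    using C by (auto simp: class_Ck_def)
  have main: "\<bar>g (B - (\<Union>i\<in>{1..j}. X i))\<bar> \<le> 2 ^ j * \<eta>" if "j \<le> k + 1" "B \<in> \<A>" "B \<subseteq> A" for j B
    using that
  proof (induction j arbitrary: B)
    case (Suc j)
    let ?U = "\<lambda>B. B - (\<Union>i\<in>{1..j}. X i)"
    let ?S = "B - (\<Union>i\<in>{1..Suc j}. X i)"
    have BX: "B \<inter> X (Suc j) \<in> \<A>" "B \<inter> X (Suc j) \<subseteq> A" using Suc.prems X A_Int by auto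
    have un: "(\<Union>i\<in>{1..Suc j}. X i) = (\<Union>i\<in>{1..j}. X i) \<union> X (Suc j)"
      by (subst atLeastAtMostSuc_conv) auto
    have split: "?U B = ?U (B \<inter> X (Suc j)) \<union> ?S" "?U (B \<inter> X (Suc j)) \<inter> ?S = {}"
      unfolding un by auto
    have "?U (B \<inter> X (Suc j)) \<in> Cu" "?S \<in> Cu"
      using Suc.prems X BX by (auto intro!: C_in_Cu C_I simp del: atLeastAtMostSuc_conv)
    then have "g (?U B) = g (?U (B \<inter> X (Suc j))) + g ?S" using add split by metis
    moreover have "\<bar>g (?U B)\<bar> \<le> 2 ^ j * \<eta>" using Suc by auto
    moreover have "\<bar>g (?U (B \<inter> X (Suc j)))\<bar> \<le> 2 ^ j * \<eta>" using Suc.IH[OF _ BX] Suc.prems by auto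
    ultimately show ?case by simp
  qed (use bnd in auto)
  \<comment> \<open>The sets in the representation of \<open>C\<close> may leave \<open>A\<close>,
    where no bound is known; cutting the outer set with \<open>A\<close> does not change
    \<open>C\<close>.\<close>
  have "C = (X 0 \<inter> A) - (\<Union>i\<in>{1..k + 1}. X i)" using X C by auto
  then show ?thesis using main[of "k + 1" "X 0 \<inter> A"] A_Int[OF X(2)[of 0] A] by auto
qed

text \<open>With a vanishing Gaussian part, \<open>Y\<close> itself is the uniform limit of the
  truncated jump integrals. Integrability of \<open>f\<close> enters in the case where a compensator
  has to be formed.\<close>

locale levy_setting = indexing_metric \<T> \<A> An d + poisson_set P "m \<Otimes>\<^sub>M \<nu>" \<Xi>
  for \<T> :: "'a set" and \<A> An d and P :: "'w measure" and m :: "'a measure" and \<nu> :: "real measure" and \<Xi> +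
  fixes f :: "'a \<Rightarrow> real" and Y :: "'a set \<Rightarrow> 'w \<Rightarrow> real" and t :: 'a
  assumes fd: "finite_dim \<A> An"
    and m_space: "space m = \<T>" and m_sets: "sets m = sigma_sets \<T> \<A>"
    and m_fin: "\<And>A. A \<in> \<A> \<Longrightarrow> emeasure m A < \<top>"
    and m_compat: "compatible_metric \<T> \<A> An (measure_dist m)"
    and levy: "L2_levy_measure \<nu>"
    and f_meas[measurable]: "f \<in> borel_measurable m"
    and f_int: "\<And>A. \<not> summable_small_jumps \<nu> \<Longrightarrow> A \<in> \<A> \<Longrightarrow> set_integrable m A f"
    and Y_lim: "jump_integral P \<A> m \<nu> \<Xi> f Y"
    and t: "t \<in> \<T>"
begin

sublocale mm: indexing_metric \<T> \<A> An "measure_dist m"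
  by unfold_locales (rule m_compat)

abbreviation "p \<equiv> ic_dim \<A> An"

lemma p_adm: "admissible_dim \<A> An p"
  unfolding ic_dim_def using fd by (auto simp: finite_dim_def intro: LeastI)

lemma A_m: "A \<in> \<A> \<Longrightarrow> A \<in> sets m" using m_sets by auto

lemma An_m: "A \<in> An n \<Longrightarrow> A \<in> sets m" using A_m An_A by auto

lemma T_m: "\<T> \<in> sets m" using m_space sets.top by metis

lemma Cu_m: "U \<in> Cu \<Longrightarrow> U \<in> sets m"
proof -
  have "C \<in> sets m" if C: "C \<in> class_C \<A>" for C
  proof -
    obtain A F where "A \<in> \<A>" "finite F" "F \<subseteq> \<A>" "C = A - \<Union>F" using C by (rule C_E)
    then show ?thesis using A_m by (auto intro!: sets.Diff sets.finite_Union)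
  qed
  then show "U \<in> Cu \<Longrightarrow> U \<in> sets m" by (auto simp: finite_unions_def intro!: sets.finite_Union)
qed

lemma nu_sets[measurable_cong]: "sets \<nu> = sets borel" and nu_0: "emeasure \<nu> {0} = 0"
  and nu_sq: "(\<integral>\<^sup>+ x. ennreal (x\<^sup>2) \<partial>\<nu>) < \<top>"
  using levy by (auto simp: L2_levy_measure_def)

lemma nu_space: "space \<nu> = UNIV" using sets_eq_imp_space_eq[OF nu_sets] by simp

lemma nu_tail: assumes "e > 0" shows "emeasure \<nu> {x. e \<le> \<bar>x\<bar>} < \<top>"
proof -
  have "emeasure \<nu> {x. e \<le> \<bar>x\<bar>} = (\<integral>\<^sup>+x. indicator {x. e \<le> \<bar>x\<bar>} x \<partial>\<nu>)"
    by simp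
  also have "\<dots> \<le> (\<integral>\<^sup>+x. ennreal (1 / e\<^sup>2) * ennreal (x\<^sup>2) \<partial>\<nu>)"
  proof (rule nn_integral_mono)
    fix x :: real
    have "1 \<le> (1 / e\<^sup>2) * x\<^sup>2" if "e \<le> \<bar>x\<bar>"
      using power_mono[OF that, of 2] assms by (simp add: field_simps)
    then show "(indicator {x. e \<le> \<bar>x\<bar>} x :: ennreal) \<le> ennreal (1 / e\<^sup>2) * ennreal (x\<^sup>2)"
      by (auto simp: indicator_def ennreal_mult[symmetric] simp flip: ennreal_1 intro!: ennreal_leI)
  qed
  also have "\<dots> = ennreal (1 / e\<^sup>2) * (\<integral>\<^sup>+x. ennreal (x\<^sup>2) \<partial>\<nu>)" by (rule nn_integral_cmult) simp
  also have "\<dots> < \<top>" using nu_sq by (simp add: ennreal_mult_less_top)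
  finally show ?thesis .
qed

sublocale m: sigma_finite_measure m
proof
  have "emeasure m a \<noteq> \<infinity>" if "a \<in> dominating" for a
    using m_fin[of a] that dominating_A by auto
  then show "\<exists>A. countable A \<and> A \<subseteq> sets m \<and> \<Union>A = space m \<and> (\<forall>a\<in>A. emeasure m a \<noteq> \<infinity>)"
    using countable_dominating dominating_A Union_dominating A_m m_space
    by (intro exI[of _ dominating]) auto
qed

sublocale nu: sigma_finite_measure \<nu>
proof
  let ?S = "insert {0} (range (\<lambda>n. {x::real. 1 / real (Suc n) \<le> \<bar>x\<bar>}))"
  have "x \<in> \<Union>?S" for x :: real
  proof (cases "x = 0")
    case False
    then obtain n where "inverse (real (Suc n)) < \<bar>x\<bar>" using reals_Archimedean[of "\<bar>x\<bar>"] by auto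
    then show ?thesis by (auto simp: inverse_eq_divide intro: less_imp_le)
  qed auto
  then have "\<Union>?S = UNIV" by blast
  moreover have "emeasure \<nu> {x. 1 / real (Suc n) \<le> \<bar>x\<bar>} \<noteq> \<infinity>" for n
    using nu_tail[of "1 / real (Suc n)"] by simp
  ultimately show "\<exists>A. countable A \<and> A \<subseteq> sets \<nu> \<and> \<Union>A = space \<nu> \<and> (\<forall>a\<in>A. emeasure \<nu> a \<noteq> \<infinity>)"
    using nu_0 nu_sets nu_space by (intro exI[of _ ?S]) auto
qed

sublocale mn: pair_sigma_finite m \<nu> ..

lemma Q_Times: "A \<in> sets m \<Longrightarrow> S \<in> sets borel \<Longrightarrow> emeasure (m \<Otimes>\<^sub>M \<nu>) (A \<times> S) = emeasure m A * emeasure \<nu> S"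
  using nu_sets by (intro nu.emeasure_pair_measure_Times) auto

lemma Q_Times_sets: "A \<in> sets m \<Longrightarrow> S \<in> sets borel \<Longrightarrow> A \<times> S \<in> sets (m \<Otimes>\<^sub>M \<nu>)"
  using nu_sets by (intro pair_measureI) auto

abbreviation "tail e \<equiv> {x::real. e \<le> \<bar>x\<bar>}"

lemma tail_borel[simp]: "tail e \<in> sets borel" by measurable

lemma finite_points_tail:
  assumes "B \<in> sets m" "emeasure m B < \<top>" "e > 0"
  shows "AE \<omega> in P. finite (\<Xi> \<omega> \<inter> B \<times> tail e)"
proof (rule finite_points)
  show "B \<times> tail e \<in> sets (m \<Otimes>\<^sub>M \<nu>)" by (rule Q_Times_sets[OF assms(1) tail_borel])
  show "emeasure (m \<Otimes>\<^sub>M \<nu>) (B \<times> tail e) < \<top>"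
    unfolding Q_Times[OF assms(1) tail_borel] using assms(2) nu_tail[OF assms(3)] by (simp add: ennreal_mult_less_top)
qed

definition residual :: "'a set" where "residual = \<T> - (\<Union>n. \<Union>(An n))"

lemma residual_m: "residual \<in> sets m"
  unfolding residual_def using T_m An_m by (intro sets.Diff sets.countable_UN sets.finite_Union) auto

lemma measure_dist_diff:
  assumes "A \<in> \<A>" "B \<in> \<A>" "S \<in> sets m" "S \<subseteq> A - B"
  shows "measure m S \<le> measure_dist m B A"
  unfolding measure_dist_def
proof (rule measure_mono_fmeasurable[OF _ assms(3)])
  have "emeasure m ((B - A) \<union> (A - B)) \<le> emeasure m (A \<union> B)"
    using assms A_m by (intro emeasure_mono) auto
  also have "\<dots> \<le> emeasure m A + emeasure m B" using assms A_m by (intro emeasure_subadditive) auto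
  also have "\<dots> < \<top>" using m_fin assms by auto
  finally show "(B - A) \<union> (A - B) \<in> fmeasurable m" using assms A_m by (intro fmeasurableI) auto
  show "S \<subseteq> (B - A) \<union> (A - B)" using assms(4) by blast
qed

text \<open>
  When \<open>\<T>\<close> belongs to \<open>\<A>\<close> but to no \<open>An n\<close>, its tip is covered by no \<open>An n\<close>. Halving the distance
  to \<open>\<T>\<close> repeatedly shows that this point is null.
\<close>

lemma residual_null: "emeasure m residual = 0"
proof (cases "residual = {}")
  case False
  then obtain s where s: "s \<in> residual" by auto
  then have sT: "s \<in> \<T>" "pt s = \<T>" using residual_point by (auto simp: residual_def)
  then have TA: "\<T> \<in> \<A>" using pt_A by metis
  have sub: "residual \<subseteq> \<T> - A" if A: "A \<in> \<A>" "s \<notin> A" for A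
  proof
    fix s' assume s': "s' \<in> residual"
    then have "s' \<in> \<T>" "pt s' = \<T>" using residual_point by (auto simp: residual_def)
    then show "s' \<in> \<T> - A" using pt_inj[of s' s] sT A by auto
  qed
  let ?d = "measure_dist m"
  have ex: "\<exists>A\<in>\<A>. s \<notin> A \<and> ?d A \<T> \<le> (1 / 2) ^ n * ?d {} \<T>" for n
  proof (induction n)
    case 0
    then show ?case by (intro bexI[of _ "{}"]) auto
  next
    case (Suc n)
    then obtain A where A: "A \<in> \<A>" "s \<notin> A" "?d A \<T> \<le> (1 / 2) ^ n * ?d {} \<T>" by auto
    obtain A' where A': "A' \<in> \<A>" "?d A A' = ?d A \<T> / 2" "?d A' \<T> = ?d A \<T> / 2"
      using mm.d_half[OF A(1) TA A_sub[OF A(1)]] by auto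
    show ?case
    proof (cases "s \<in> A'")
      case True
      then have "A' = \<T>" using pt_least[OF A'(1) True] sT A_sub[OF A'(1)] by auto
      then have "?d A \<T> = 0" using A' mm.d_self[OF TA] by simp
      then show ?thesis using A mm.d_nonneg[OF A_empty TA] by (intro bexI[of _ A]) auto
    next
      case False
      then show ?thesis using A A' by (intro bexI[of _ A']) auto
    qed
  qed
  have le: "measure m residual \<le> (1 / 2) ^ n * ?d {} \<T>" for n
    using ex[of n] sub measure_dist_diff[OF TA _ residual_m] by fastforce
  have "(\<lambda>n. (1 / 2) ^ n * ?d {} \<T>) \<longlonglongrightarrow> 0 * ?d {} \<T>"
    by (intro tendsto_mult LIMSEQ_power_zero) auto
  then have "measure m residual \<le> 0" using le by (intro LIMSEQ_le_const[of _ 0]) auto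
  then have 0: "measure m residual = 0" using measure_nonneg[of m residual] by linarith
  have "emeasure m residual \<le> emeasure m \<T>" using T_m by (intro emeasure_mono) (auto simp: residual_def)
  then have "emeasure m residual < \<top>" using m_fin[OF TA] by auto
  then show ?thesis using 0 by (simp add: emeasure_eq_ennreal_measure)
qed simp

subsection \<open>Truncated integrals\<close>

definition comp :: "real \<Rightarrow> 'a set \<Rightarrow> real" where
  "comp \<epsilon> A = (if summable_small_jumps \<nu> then 0
      else (LINT s:A|m. f s) * (LINT x:{x. \<epsilon> \<le> \<bar>x\<bar> \<and> \<bar>x\<bar> \<le> 1}|\<nu>. x))"

abbreviation "Ye \<equiv> jump_integral_eps m \<nu> \<Xi> f"

lemma Ye_eq:
  assumes "finite (\<Xi> \<omega> \<inter> A \<times> tail \<epsilon>)"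
  shows "Ye \<epsilon> A \<omega> = (\<Sum>z\<in>\<Xi> \<omega> \<inter> A \<times> tail \<epsilon>. f (fst z) * snd z) - comp \<epsilon> A"
proof -
  have "{(s, x) \<in> \<Xi> \<omega>. s \<in> A \<and> \<epsilon> \<le> \<bar>x\<bar>} = \<Xi> \<omega> \<inter> A \<times> tail \<epsilon>" by auto
  then show ?thesis using assms by (simp add: jump_integral_eps_def comp_def case_prod_beta)
qed

definition regular :: "'w \<Rightarrow> bool" where
  "regular \<omega> \<longleftrightarrow> \<omega> \<in> space P \<and> (\<forall>A\<in>\<A>. \<forall>e>0. finite (\<Xi> \<omega> \<inter> A \<times> tail e)) \<and>
     (\<forall>A\<in>\<A>. uniform_limit {A' \<in> \<A>. A' \<subseteq> A} (\<lambda>\<epsilon> A'. Ye \<epsilon> A' \<omega>) (\<lambda>A'. Y A' \<omega>) (at_right 0)) \<and>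
     \<Xi> \<omega> \<inter> residual \<times> UNIV = {}"

text \<open>Finiteness and uniform convergence pass to smaller sets and larger levels, so that the
  countably many dominating sets and the levels \<open>1 / real (Suc n)\<close> decide all cases
  outside one null set.\<close>

lemma AE_regular: "AE \<omega> in P. regular \<omega>"
proof -
  have 1: "AE \<omega> in P. \<forall>A\<in>dominating. \<forall>n. finite (\<Xi> \<omega> \<inter> A \<times> tail (1 / real (Suc n)))"
    using dominating_A A_m m_fin countable_dominating
    by (subst AE_ball_countable) (auto simp: AE_all_countable intro!: finite_points_tail)
  have 2: "AE \<omega> in P. \<forall>A\<in>dominating. uniform_limit {A' \<in> \<A>. A' \<subseteq> A} (\<lambda>\<epsilon> A'. Ye \<epsilon> A' \<omega>) (\<lambda>A'. Y A' \<omega>) (at_right 0)"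
    using dominating_A Y_lim countable_dominating
    by (subst AE_ball_countable) (auto simp: jump_integral_def)
  have 3: "AE \<omega> in P. \<Xi> \<omega> \<inter> residual \<times> UNIV = {}"
    using residual_m residual_null by (intro no_points) (auto simp: Q_Times Q_Times_sets)
  show ?thesis using 1 2 3 AE_space
  proof eventually_elim
    case (elim \<omega>)
    have "finite (\<Xi> \<omega> \<inter> A \<times> tail e)" if A: "A \<in> \<A>" and e: "e > 0" for A e
    proof -
      obtain B where B: "B \<in> dominating" "A \<subseteq> B" using dominated[OF A] by auto
      obtain n where "inverse (real (Suc n)) < e" using reals_Archimedean[OF e] by auto
      then have "\<Xi> \<omega> \<inter> A \<times> tail e \<subseteq> \<Xi> \<omega> \<inter> B \<times> tail (1 / real (Suc n))"
        using B by (auto simp: inverse_eq_divide)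
      then show ?thesis using elim(1) B finite_subset by blast
    qed
    moreover have "uniform_limit {A' \<in> \<A>. A' \<subseteq> A} (\<lambda>\<epsilon> A'. Ye \<epsilon> A' \<omega>) (\<lambda>A'. Y A' \<omega>) (at_right 0)" if A: "A \<in> \<A>" for A
    proof -
      obtain B where B: "B \<in> dominating" "A \<subseteq> B" using dominated[OF A] by auto
      have "uniform_limit {A' \<in> \<A>. A' \<subseteq> B} (\<lambda>\<epsilon> A'. Ye \<epsilon> A' \<omega>) (\<lambda>A'. Y A' \<omega>) (at_right 0)"
        using elim(2) B by auto
      then show ?thesis by (rule uniform_limit_on_subset) (use B in auto)
    qed
    ultimately show ?case using elim by (auto simp: regular_def)
  qed
qed

lemma Cu_dominated: "U \<in> Cu \<Longrightarrow> \<exists>F. finite F \<and> F \<subseteq> \<A> \<and> U \<subseteq> \<Union>F"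
proof (induction U rule: Cu_induct)
  case (base A)
  then show ?case by (intro exI[of _ "{A}"]) auto
next
  case (union U V)
  then obtain F G where "finite F" "F \<subseteq> \<A>" "U \<subseteq> \<Union>F" "finite G" "G \<subseteq> \<A>" "V \<subseteq> \<Union>G" by auto
  then show ?case by (intro exI[of _ "F \<union> G"]) auto
next
  case (diff U V)
  then obtain F where "finite F" "F \<subseteq> \<A>" "U \<union> V \<subseteq> \<Union>F" by auto
  then show ?case by (intro exI[of _ F]) auto
qed

lemma regular_finite:
  assumes "regular \<omega>" "U \<in> Cu" "e > 0" shows "finite (\<Xi> \<omega> \<inter> U \<times> tail e)"
proof -
  obtain F where F: "finite F" "F \<subseteq> \<A>" "U \<subseteq> \<Union>F" using Cu_dominated[OF assms(2)] by auto
  have "\<Xi> \<omega> \<inter> U \<times> tail e \<subseteq> (\<Union>A\<in>F. \<Xi> \<omega> \<inter> A \<times> tail e)" using F by auto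
  moreover have "finite \<dots>"
  proof (rule finite_UN_I[OF F(1)])
    fix A assume "A \<in> F"
    then have "A \<in> \<A>" using F(2) by auto
    then show "finite (\<Xi> \<omega> \<inter> A \<times> tail e)" using assms by (auto simp: regular_def)
  qed
  ultimately show ?thesis by (rule finite_subset)
qed

lemma f_set_integrable:
  assumes "\<not> summable_small_jumps \<nu>" "U \<in> Cu" shows "set_integrable m U f"
proof -
  obtain F where F: "finite F" "F \<subseteq> \<A>" "U \<subseteq> \<Union>F" using Cu_dominated[OF assms(2)] by auto
  have "set_integrable m (\<Union>A\<in>F. A) f"
    using F f_int[OF assms(1)] A_m by (intro set_integrable_UN) auto
  then show ?thesis by (rule set_integrable_subset[OF _ Cu_m[OF assms(2)]]) (use F in auto)
qed

lemma Ye_additive: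
  assumes r: "regular \<omega>" and UV: "U \<in> Cu" "V \<in> Cu" "U \<inter> V = {}" and e: "\<epsilon> > 0"
  shows "Ye \<epsilon> (U \<union> V) \<omega> = Ye \<epsilon> U \<omega> + Ye \<epsilon> V \<omega>"
proof -
  have eq: "\<Xi> \<omega> \<inter> (U \<union> V) \<times> tail \<epsilon> = (\<Xi> \<omega> \<inter> U \<times> tail \<epsilon>) \<union> (\<Xi> \<omega> \<inter> V \<times> tail \<epsilon>)" by auto
  have "(\<Sum>z\<in>\<Xi> \<omega> \<inter> (U \<union> V) \<times> tail \<epsilon>. f (fst z) * snd z) =
    (\<Sum>z\<in>\<Xi> \<omega> \<inter> U \<times> tail \<epsilon>. f (fst z) * snd z) + (\<Sum>z\<in>\<Xi> \<omega> \<inter> V \<times> tail \<epsilon>. f (fst z) * snd z)"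
    unfolding eq using r UV e regular_finite by (intro sum.union_disjoint) auto
  moreover have "comp \<epsilon> (U \<union> V) = comp \<epsilon> U + comp \<epsilon> V"
    using set_integral_Un[OF UV(3) f_set_integrable[OF _ UV(1)] f_set_integrable[OF _ UV(2)]]
    by (auto simp: comp_def algebra_simps)
  ultimately show ?thesis using r UV e Cu_Un by (simp add: Ye_eq regular_finite)
qed

lemma tendsto_Ye_base:
  assumes "regular \<omega>" "A \<in> \<A>"
  shows "((\<lambda>\<epsilon>. Ye \<epsilon> A \<omega>) \<longlongrightarrow> Y A \<omega>) (at_right 0)"
proof -
  have "uniform_limit {A' \<in> \<A>. A' \<subseteq> A} (\<lambda>\<epsilon> A'. Ye \<epsilon> A' \<omega>) (\<lambda>A'. Y A' \<omega>) (at_right 0)"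
    using assms by (auto simp: regular_def)
  then show ?thesis by (rule tendsto_uniform_limitI) (use assms in auto)
qed

lemma tendsto_Ye:
  assumes r: "regular \<omega>" and U: "U \<in> Cu"
  shows "((\<lambda>\<epsilon>. Ye \<epsilon> U \<omega>) \<longlongrightarrow> Delta \<A> (\<lambda>A. Y A \<omega>) U) (at_right 0)"
proof (rule tendsto_Delta[OF _ _ _ U])
  show "at_right (0::real) \<noteq> bot" by simp
  show "((\<lambda>\<epsilon>. Ye \<epsilon> A \<omega>) \<longlongrightarrow> Y A \<omega>) (at_right 0)" if "A \<in> \<A>" for A
    by (rule tendsto_Ye_base[OF r that])
next
  fix U V assume "U \<in> Cu" "V \<in> Cu" "U \<inter> V = {}"
  then show "\<forall>\<^sub>F \<epsilon> in at_right 0. Ye \<epsilon> (U \<union> V) \<omega> = Ye \<epsilon> U \<omega> + Ye \<epsilon> V \<omega>"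
    using Ye_additive[OF r] by (auto simp: eventually_at_filter intro!: always_eventually)
qed

lemma Delta_additive:
  assumes r: "regular \<omega>" and UV: "U \<in> Cu" "V \<in> Cu" "U \<inter> V = {}"
  shows "Delta \<A> (\<lambda>A. Y A \<omega>) (U \<union> V) = Delta \<A> (\<lambda>A. Y A \<omega>) U + Delta \<A> (\<lambda>A. Y A \<omega>) V"
proof (rule tendsto_unique)
  show "at_right (0::real) \<noteq> bot" by simp
  show "((\<lambda>\<epsilon>. Ye \<epsilon> (U \<union> V) \<omega>) \<longlongrightarrow> Delta \<A> (\<lambda>A. Y A \<omega>) (U \<union> V)) (at_right 0)"
    using UV Cu_Un by (intro tendsto_Ye r) auto
  have "((\<lambda>\<epsilon>. Ye \<epsilon> U \<omega> + Ye \<epsilon> V \<omega>) \<longlongrightarrow> Delta \<A> (\<lambda>A. Y A \<omega>) U + Delta \<A> (\<lambda>A. Y A \<omega>) V) (at_right 0)"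
    using UV by (intro tendsto_add tendsto_Ye r)
  then show "((\<lambda>\<epsilon>. Ye \<epsilon> (U \<union> V) \<omega>) \<longlongrightarrow> Delta \<A> (\<lambda>A. Y A \<omega>) U + Delta \<A> (\<lambda>A. Y A \<omega>) V) (at_right 0)"
    by (rule Lim_transform_eventually) (use Ye_additive[OF r UV] in \<open>auto simp: eventually_at_filter intro!: always_eventually\<close>)
qed

lemma Delta_base: "regular \<omega> \<Longrightarrow> A \<in> \<A> \<Longrightarrow> Delta \<A> (\<lambda>A. Y A \<omega>) A = Y A \<omega>"
  using tendsto_unique[OF trivial_limit_at_right_real tendsto_Ye[OF _ C_in_Cu[OF A_in_C]] tendsto_Ye_base] by simp

subsection \<open>Simple jumps\<close>

lemma left_nbhd_m: "C \<in> left_nbhds (An n) \<Longrightarrow> C \<in> sets m"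
  unfolding left_nbhds_def using An_m by (auto intro!: sets.Diff sets.finite_Union)

lemma left_nbhd_C: "C \<in> left_nbhds (An n) \<Longrightarrow> C \<in> class_C \<A>"
  unfolding left_nbhds_def using An_A by (auto intro!: C_I)

text \<open>\<open>C\<close> is contained in \<open>A0 - B\<close> for each subtracted set
  \<open>B\<close>, or equals \<open>A0 - {}\<close> if there is none, and the measure of such a
  difference is a distance controlled by halving. Shrinking diameters thus force shrinking
  measures.\<close>

lemma measure_left_nbhd:
  assumes C: "C \<in> left_nbhds (An n)" and diam: "point_diam \<T> An (measure_dist m) C \<le> ennreal r" "0 \<le> r"
  shows "measure m C \<le> 2 * r"
proof (cases "C = {}")
  case False
  obtain A0 F where rep: "extremal_rep \<A> C A0 F" using extremal_rep_ex[OF left_nbhd_C[OF C]] by auto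
  then have A0: "A0 \<in> \<A>" "C = A0 - \<Union>F" "F \<subseteq> \<A>" by (auto simp: extremal_rep_def)
  obtain s0 where s0: "s0 \<in> \<T>" "pt s0 = A0" "s0 \<in> C" using extremal_rep_tip[OF rep False] by auto
  show ?thesis
  proof (cases "F = {}")
    case True
    have "measure_dist m {} A0 \<le> 2 * r"
      by (rule mm.dist_le_diam[OF _ _ s0 _ diam]) (use True A0 pt_in in auto)
    moreover have "measure m C \<le> measure_dist m {} A0"
      using A0 left_nbhd_m[OF C] by (intro measure_dist_diff) auto
    ultimately show ?thesis by linarith
  next
    case False
    then obtain B where B: "B \<in> F" by auto
    have "measure_dist m B A0 \<le> 2 * r" by (rule mm.extremal_dist_le_diam[OF rep \<open>C \<noteq> {}\<close> B diam])
    moreover have "measure m C \<le> measure_dist m B A0"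
      using A0 B left_nbhd_m[OF C] by (intro measure_dist_diff) auto
    ultimately show ?thesis by linarith
  qed
qed (use diam in simp)

lemma diam_bound_ev:
  fixes d' :: "'a set \<Rightarrow> 'a set \<Rightarrow> real"
  assumes "(\<lambda>n. SUP C\<in>left_nbhds (An n). point_diam \<T> An d' C) \<longlonglongrightarrow> 0" "e > 0"
  shows "\<forall>\<^sub>F n in sequentially. \<forall>C\<in>left_nbhds (An n). point_diam \<T> An d' C < ennreal e"
proof -
  have "\<forall>\<^sub>F n in sequentially. (SUP C\<in>left_nbhds (An n). point_diam \<T> An d' C) < ennreal e"
    using assms by (intro order_tendstoD(2)[OF assms(1)]) auto
  then show ?thesis by eventually_elim (auto simp: SUP_lessD)
qed

lemma measure_left_nbhd_ev:
  assumes "e > 0"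
  shows "\<forall>\<^sub>F n in sequentially. \<forall>C\<in>left_nbhds (An n). measure m C \<le> e"
proof -
  have e2: "e / 2 > 0" using assms by simp
  from diam_bound_ev[OF mm.d_diam e2] show ?thesis
  proof eventually_elim
    case (elim n)
    show ?case
    proof
      fix C assume C: "C \<in> left_nbhds (An n)"
      have "point_diam \<T> An (measure_dist m) C \<le> ennreal (e / 2)" using elim C by (auto intro: less_imp_le)
      from measure_left_nbhd[OF C this] show "measure m C \<le> e" using assms by auto
    qed
  qed
qed

text \<open>Two points over one location share a cell at every stage. If all cells have measure at
  most \<open>h\<close>, the expected order of a shared cell is the sum of squared cell measures,
  hence at most \<open>h\<close> times a constant, and \<open>h\<close> is arbitrary.\<close>

lemma simple_points:
  assumes A: "A \<in> An k" and e: "e > 0"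
  shows "AE \<omega> in P. inj_on fst (\<Xi> \<omega> \<inter> A \<times> tail e)"
proof -
  define L where "L n B = B - \<Union>{A' \<in> An n. A' \<subset> B}" for n B
  define J where "J n = {B \<in> An n. B \<subseteq> A}" for n
  define v where "v = measure \<nu> (tail e)"
  have L_nb: "L n B \<in> left_nbhds (An n)" if "B \<in> An n" for n B using that by (auto simp: L_def left_nbhds_def)
  have L_m: "L n B \<in> sets m" if "B \<in> J n" for n B using L_nb left_nbhd_m that by (auto simp: J_def)
  have L_sub: "L n B \<subseteq> A" if "B \<in> J n" for n B using that by (auto simp: L_def J_def)
  have L_fin: "emeasure m (L n B) < \<top>" if "B \<in> J n" for n B
    using emeasure_mono[OF L_sub[OF that] An_m[OF A]] m_fin[OF An_A[OF A]] by (auto simp: order.strict_trans1)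
  have J_fin: "finite (J n)" for n by (auto simp: J_def)
  have disj: "disjoint_family_on (L n) (J n)" for n
    unfolding disjoint_family_on_def
  proof (intro ballI impI)
    fix B B' assume B: "B \<in> J n" "B' \<in> J n" "B \<noteq> B'"
    then have "PA n s = B" if "s \<in> L n B" for s
      using that left_nbhd_iff[of B n s] by (auto simp: J_def L_def)
    moreover from B have "PA n s = B'" if "s \<in> L n B'" for s
      using that left_nbhd_iff[of B' n s] by (auto simp: J_def L_def)
    ultimately show "L n B \<inter> L n B' = {}" using B(3) by auto
  qed
  define Dn where "Dn n B = L n B \<times> tail e" for n B
  have D: "Dn n B \<in> sets (m \<Otimes>\<^sub>M \<nu>)" "emeasure (m \<Otimes>\<^sub>M \<nu>) (Dn n B) < \<top>"
    "measure (m \<Otimes>\<^sub>M \<nu>) (Dn n B) = measure m (L n B) * v" if "B \<in> J n" for n B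
    using L_m[OF that] L_fin[OF that] nu_tail[OF e]
    by (auto simp: Dn_def Q_Times Q_Times_sets ennreal_mult_less_top measure_def v_def enn2real_mult)
  define bad where "bad n = (\<Union>B\<in>J n. {\<omega> \<in> space P. 2 \<le> num_points \<Xi> (Dn n B) \<omega>})" for n
  have bad_ev: "bad n \<in> events" for n
    unfolding bad_def using J_fin prob_two_points(2) D by (intro sets.finite_UN) auto
  have sumL: "(\<Sum>B\<in>J n. measure m (L n B)) \<le> measure m A" for n
  proof -
    have "(\<Sum>B\<in>J n. measure m (L n B)) = measure m (\<Union>B\<in>J n. L n B)"
    proof (rule measure_finite_Union[symmetric])
      show "L n ` J n \<subseteq> sets m" using L_m by auto
      show "emeasure m (L n B) \<noteq> \<infinity>" if "B \<in> J n" for B using L_fin[OF that] by simp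
    qed (use J_fin disj in auto)
    also have "\<dots> \<le> measure m A"
      using L_sub L_m J_fin An_m[OF A] m_fin[OF An_A[OF A]] by (intro measure_mono_fmeasurable) (auto simp: fmeasurable_def)
    finally show ?thesis .
  qed
  have bad_le: "\<forall>\<^sub>F n in sequentially. prob (bad n) \<le> h * (v\<^sup>2 * measure m A)" if "h > 0" for h
    using measure_left_nbhd_ev[OF that]
  proof eventually_elim
    case (elim n)
    have "prob (bad n) \<le> (\<Sum>B\<in>J n. prob {\<omega> \<in> space P. 2 \<le> num_points \<Xi> (Dn n B) \<omega>})"
      unfolding bad_def using J_fin prob_two_points(2) D by (intro finite_measure_subadditive_finite) auto
    also have "\<dots> \<le> (\<Sum>B\<in>J n. (measure m (L n B) * v)\<^sup>2)"
      using prob_two_points(1)[OF D(1,2)] D(3) by (intro sum_mono) auto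
    also have "\<dots> \<le> (\<Sum>B\<in>J n. (h * v\<^sup>2) * measure m (L n B))"
    proof (rule sum_mono)
      fix B assume "B \<in> J n"
      then have "measure m (L n B) \<le> h" using elim L_nb by (auto simp: J_def)
      then have "measure m (L n B) * (measure m (L n B) * v\<^sup>2) \<le> h * (measure m (L n B) * v\<^sup>2)"
        by (intro mult_right_mono) auto
      then show "(measure m (L n B) * v)\<^sup>2 \<le> h * v\<^sup>2 * measure m (L n B)"
        by (simp add: power2_eq_square algebra_simps)
    qed
    also have "\<dots> = (h * v\<^sup>2) * (\<Sum>B\<in>J n. measure m (L n B))" by (simp add: sum_distrib_left)
    also have "\<dots> \<le> (h * v\<^sup>2) * measure m A" using sumL that by (intro mult_left_mono) auto
    finally show ?case by (simp add: mult.assoc)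
  qed
  \<comment> \<open>A coincidence of locations in \<open>A\<close> makes every stage from
    \<open>k\<close> on bad, so only the intersection of the bad events matters, and any single
    stage bounds its probability.\<close>
  define N where "N = (\<Inter>n\<in>{k..}. bad n)"
  have N_ev: "N \<in> events" unfolding N_def using bad_ev by (intro sets.countable_INT') auto
  have N_le: "prob N \<le> h * (v\<^sup>2 * measure m A)" if h: "h > 0" for h
  proof -
    from eventually_conj[OF bad_le[OF h] eventually_ge_at_top[of k]]
    obtain n where n: "prob (bad n) \<le> h * (v\<^sup>2 * measure m A)" "k \<le> n"
      using eventually_happens'[OF sequentially_bot] by blast
    have "prob N \<le> prob (bad n)" using n bad_ev by (intro finite_measure_mono) (auto simp: N_def)
    then show ?thesis using n by simp
  qed
  have "prob N \<le> 0 + h" if h: "h > 0" for h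
  proof -
    let ?c = "v\<^sup>2 * measure m A"
    have c: "?c \<ge> 0" by simp
    have c1: "?c + 1 > 0" using c by linarith
    then have "h / (?c + 1) > 0" using h by (intro divide_pos_pos)
    then have "prob N \<le> (h / (?c + 1)) * ?c" by (rule N_le)
    also have "\<dots> \<le> h" using c1 h by (simp add: pos_divide_le_eq algebra_simps)
    finally show ?thesis by simp
  qed
  then have "prob N \<le> 0" by (rule field_le_epsilon)
  then have "prob N = 0" using measure_nonneg[of P N] by linarith
  then have "AE \<omega> in P. \<omega> \<notin> N"
    using N_ev by (intro AE_not_in) (simp add: null_sets_def emeasure_eq_measure)
  then show ?thesis using AE_space finite_points_tail[OF An_m[OF A] m_fin[OF An_A[OF A]] e]
  proof eventually_elim
    case (elim \<omega>)
    show ?case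
    proof (rule inj_onI)
      fix z z' assume z: "z \<in> \<Xi> \<omega> \<inter> A \<times> tail e" "z' \<in> \<Xi> \<omega> \<inter> A \<times> tail e" "fst z = fst z'"
      obtain n where n: "n \<ge> k" "\<omega> \<notin> bad n" using elim(1) by (auto simp: N_def)
      have s: "fst z \<in> A" "A \<in> An n" using z A An_mono[OF n(1)] by auto
      then have cov: "fst z \<in> \<Union>(An n)" by auto
      define B where "B = PA n (fst z)"
      have B: "B \<in> J n" using PA_An[OF cov] PA_least[OF s(2,1)] by (auto simp: J_def B_def)
      have "fst z \<in> L n B" using left_nbhd_iff[OF PA_An[OF cov], of "fst z"] cov by (simp add: L_def B_def)
      then have zD: "z \<in> \<Xi> \<omega> \<inter> Dn n B" "z' \<in> \<Xi> \<omega> \<inter> Dn n B" using z by (auto simp: Dn_def mem_Times_iff)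
      have fin: "finite (\<Xi> \<omega> \<inter> Dn n B)"
        using L_sub[OF B] by (intro finite_subset[OF _ elim(3)]) (auto simp: Dn_def)
      have "\<not> 2 \<le> num_points \<Xi> (Dn n B) \<omega>" using n(2) B elim(2) by (auto simp: bad_def)
      then have "card (\<Xi> \<omega> \<inter> Dn n B) < 2"
        using fin of_nat_le_iff[of 2 "card (\<Xi> \<omega> \<inter> Dn n B)", where 'a = ennreal]
        by (auto simp: num_points_eq_card)
      then have "card (\<Xi> \<omega> \<inter> Dn n B) \<le> Suc 0" by simp
      from this[unfolded card_le_Suc0_iff_eq[OF fin]] show "z = z'" using zD by blast
    qed
  qed
qed

definition simple_jumps :: "'w \<Rightarrow> bool" where
  "simple_jumps \<omega> \<longleftrightarrow> (\<forall>k. \<forall>A\<in>An k. \<forall>e>0. inj_on fst (\<Xi> \<omega> \<inter> A \<times> tail e))"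

lemma AE_simple_jumps: "AE \<omega> in P. simple_jumps \<omega>"
proof -
  have "AE \<omega> in P. \<forall>k. \<forall>A\<in>An k. \<forall>n. inj_on fst (\<Xi> \<omega> \<inter> A \<times> tail (1 / real (Suc n)))"
    by (subst AE_all_countable, intro allI, subst AE_ball_countable)
      (auto simp: AE_all_countable intro!: simple_points countable_finite)
  then show ?thesis
  proof eventually_elim
    case (elim \<omega>)
    show ?case unfolding simple_jumps_def
    proof (intro allI ballI impI)
      fix k A and e :: real assume A: "A \<in> An k" and e: "e > 0"
      obtain n where "inverse (real (Suc n)) < e" using reals_Archimedean[OF e] by auto
      then have "\<Xi> \<omega> \<inter> A \<times> tail e \<subseteq> \<Xi> \<omega> \<inter> A \<times> tail (1 / real (Suc n))"
        by (auto simp: inverse_eq_divide)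
      then show "inj_on fst (\<Xi> \<omega> \<inter> A \<times> tail e)" using elim A inj_on_subset by blast
    qed
  qed
qed

end

section \<open>The upper bound\<close>

lemma ennreal_divide_mult_cancel: "0 < x \<Longrightarrow> a / ennreal x * ennreal x = a"
  by (subst mult.commute, subst ennreal_times_divide, subst mult.commute, subst ennreal_mult_divide_eq) auto

lemma powr_at_right_0: "b > 0 \<Longrightarrow> ((\<lambda>r::real. r powr b) \<longlongrightarrow> 0) (at_right 0)"
  using tendsto_powr'[of "\<lambda>r. r" 0 "at_right 0" "\<lambda>_. b" b] by (auto simp: eventually_at_filter)

context levy_setting
begin

section \<open>Increments over shrinking left neighbourhoods\<close>

abbreviation "DY \<omega> \<equiv> Delta \<A> (\<lambda>A. Y A \<omega>)"
abbreviation "\<beta> \<equiv> blumenthal_getoor \<nu>"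

text \<open>An extremal representation of a cell could a priori have a smaller outer set than
  \<open>PA n s\<close>. Both sets have their tips in the cell, however, so each contains the
  other.\<close>

lemma nb_extremal:
  assumes s: "s \<in> \<Union>(An n)"
  shows "\<exists>F. extremal_rep \<A> (nb n s) (PA n s) F"
proof -
  have sT: "s \<in> \<T>" using s A_sub[OF An_A] by auto
  have PA: "PA n s \<in> \<A>" using PA_An[OF s] An_A by auto
  obtain A0 F where rep: "extremal_rep \<A> (nb n s) A0 F"
    using extremal_rep_ex[OF left_nbhd_C[OF nb_left_nbhds[OF s]]] by auto
  have ne: "nb n s \<noteq> {}" using nb_self[OF sT] by auto
  have A0: "A0 \<in> \<A>" "nb n s \<subseteq> A0" using rep by (auto simp: extremal_rep_def)
  let ?G = "{A' \<in> An n. A' \<subset> PA n s}"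
  have G: "?G \<subseteq> \<A>" using An_A by auto
  obtain s1 where s1: "s1 \<in> \<T>" "pt s1 = PA n s" "s1 \<in> nb n s"
    using tip_of_difference[OF PA G] ne unfolding nb_left_nbhd[OF s] by auto
  obtain s0 where s0: "s0 \<in> \<T>" "pt s0 = A0" "s0 \<in> nb n s" using extremal_rep_tip[OF rep ne] by auto
  have "s0 \<in> PA n s" using s0(3) unfolding nb_left_nbhd[OF s] by auto
  then have "A0 \<subseteq> PA n s" using pt_least[OF PA] s0 by auto
  moreover have "PA n s \<subseteq> A0" using pt_least[OF A0(1), of s1] s1 A0(2) by auto
  ultimately show ?thesis using rep by auto
qed

lemma cover_ge: "s \<in> \<Union>(An k) \<Longrightarrow> k \<le> n \<Longrightarrow> s \<in> \<Union>(An n)"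
  using An_mono[of k n] by auto

lemma nb_in_ball:
  assumes s: "s \<in> \<Union>(An k)" and \<rho>: "dT s t < \<rho>"
  shows "\<forall>\<^sub>F n in sequentially. nb n s \<in> class_Ck \<A> (p - 1) \<inter> class_C_ball \<A> d (pt t) \<rho> \<and>
    point_diam \<T> An d (nb n s) < ennreal \<rho>"
proof -
  have sT: "s \<in> \<T>" using s A_sub[OF An_A] by auto
  \<comment> \<open>The outer set is within \<open>dT s t + e\<close> of \<open>pt t\<close> and the
    subtracted sets add \<open>2 * e\<close>, so a quarter of the gap leaves room to spare.\<close>
  define e where "e = (\<rho> - dT s t) / 4"
  have e: "e > 0" using \<rho> by (simp add: e_def)
  have e4: "4 * e = \<rho> - dT s t" by (simp add: e_def)
  have dT0: "0 \<le> dT s t" using d_nonneg[OF pt_A[OF sT] pt_A[OF t]] by (simp add: point_dist_def)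
  have "\<forall>\<^sub>F n in sequentially. d (PA n s) (pt t) < dT s t + e"
    using order_tendstoD(2)[OF tendsto_PA[OF sT s t], of "dT s t + e"] e by (auto simp: point_dist_def)
  from this diam_bound_ev[OF d_diam e] eventually_ge_at_top[of k] show ?thesis
  proof eventually_elim
    case (elim n)
    have cov: "s \<in> \<Union>(An n)" by (rule cover_ge[OF s elim(3)])
    have nbl: "nb n s \<in> left_nbhds (An n)" by (rule nb_left_nbhds[OF cov])
    obtain F where rep: "extremal_rep \<A> (nb n s) (PA n s) F" using nb_extremal[OF cov] by auto
    have diam: "point_diam \<T> An d (nb n s) < ennreal e" using elim(2) nbl by auto
    have PA: "PA n s \<in> \<A>" using PA_An[OF cov] An_A by auto
    have "nb n s \<in> class_Ck \<A> (p - 1)" using p_adm nbl by (auto simp: admissible_dim_def)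
    moreover have "nb n s \<in> class_C_ball \<A> d (pt t) \<rho>"
    proof (rule class_C_ballI[OF t left_nbhd_C[OF nbl] _ _ _ rep])
      show "nb n s \<noteq> {}" using nb_self[OF sT] by auto
      show "point_diam \<T> An d (nb n s) \<le> ennreal e" using diam by simp
      show "d (pt t) (PA n s) + 2 * e < \<rho>" using elim(1) d_sym[OF PA pt_A[OF t]] e4 e by linarith
    qed (use e in simp)
    moreover have "ennreal e \<le> ennreal \<rho>" using e dT0 by (intro ennreal_leI) (simp add: e_def)
    ultimately show ?case using diam by auto
  qed
qed

text \<open>A covered point is the decreasing intersection of its cells, whose measures tend to 0
  because \<open>measure_dist m\<close> is compatible.\<close>

lemma point_null:
  assumes s: "s \<in> \<Union>(An k)"
  shows "{s} \<in> sets m" "emeasure m {s} = 0"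
proof -
  have sT: "s \<in> \<T>" using s A_sub[OF An_A] by auto
  have cov: "s \<in> \<Union>(An (n + k))" for n using cover_ge[OF s] by simp
  have eq: "{s} = (\<Inter>n. nb (n + k) s)"
    using nb_Inter[OF sT] nb_dec[OF _ sT, of n "n + k" for n] nb_self[OF sT] by fastforce
  have nbm: "nb (n + k) s \<in> sets m" for n using left_nbhd_m[OF nb_left_nbhds[OF cov]] .
  then show sm: "{s} \<in> sets m" unfolding eq by auto
  have fin: "emeasure m (nb (n + k) s) < \<top>" for n
  proof -
    have "emeasure m (nb (n + k) s) \<le> emeasure m (PA (n + k) s)"
      using nb_left_nbhd[OF cov] An_m[OF PA_An[OF cov]] by (intro emeasure_mono) auto
    also have "\<dots> < \<top>" using m_fin An_A[OF PA_An[OF cov]] by auto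
    finally show ?thesis .
  qed
  have "measure m {s} \<le> 0 + e" if e: "e > 0" for e
  proof -
    obtain N where N: "\<And>n. n \<ge> N \<Longrightarrow> \<forall>C\<in>left_nbhds (An n). measure m C \<le> e"
      using measure_left_nbhd_ev[OF e] by (auto simp: eventually_sequentially)
    have "measure m {s} \<le> measure m (nb (N + k) s)"
      using sm nbm fin nb_self[OF sT] by (intro measure_mono_fmeasurable) (auto simp: fmeasurable_def)
    also have "\<dots> \<le> e" using N[of "N + k"] nb_left_nbhds[OF cov] by auto
    finally show ?thesis by simp
  qed
  then have "measure m {s} \<le> 0" by (rule field_le_epsilon)
  then have "measure m {s} = 0" using measure_nonneg[of m "{s}"] by linarith
  moreover have "emeasure m {s} \<le> emeasure m (nb (0 + k) s)" using nbm[of 0] nb_self[OF sT] by (intro emeasure_mono) auto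
  then have "emeasure m {s} < \<top>" using fin[of 0] by (rule order.strict_trans1)
  ultimately show "emeasure m {s} = 0" by (simp add: emeasure_eq_ennreal_measure)
qed

lemma comp_tendsto:
  assumes s: "s \<in> \<Union>(An k)"
  shows "(\<lambda>n. comp \<epsilon> (nb n s)) \<longlonglongrightarrow> 0"
proof (cases "summable_small_jumps \<nu>")
  case False
  have sT: "s \<in> \<T>" using s A_sub[OF An_A] by auto
  have cov: "s \<in> \<Union>(An (n + k))" for n using cover_ge[OF s] by simp
  define A where "A = PA k s"
  have A: "A \<in> \<A>" using PA_An[OF s] An_A by (auto simp: A_def)
  have nbA: "nb (n + k) s \<subseteq> A" for n using nb_dec[of k "n + k", OF _ sT] nb_left_nbhd[OF s] by (auto simp: A_def)
  have nbm: "nb (n + k) s \<in> sets m" for n using left_nbhd_m[OF nb_left_nbhds[OF cov]] .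
  note pn = point_null[OF s]
  have "(\<lambda>n. LINT x|m. indicator (nb (n + k) s) x *\<^sub>R f x) \<longlonglongrightarrow> (LINT x|m. indicator {s} x *\<^sub>R f x)"
  proof (rule integral_dominated_convergence)
    show "(\<lambda>x. indicator {s} x *\<^sub>R f x) \<in> borel_measurable m" using pn f_meas
      by (intro borel_measurable_scaleR borel_measurable_indicator)
    show "(\<lambda>x. indicator (nb (n + k) s) x *\<^sub>R f x) \<in> borel_measurable m" for n
      using nbm[of n] f_meas by (intro borel_measurable_scaleR borel_measurable_indicator)
    show "integrable m (\<lambda>x. norm (indicator A x *\<^sub>R f x))"
      using f_int[OF False A] unfolding set_integrable_def by (rule integrable_norm)
    show "AE x in m. (\<lambda>n. indicator (nb (n + k) s) x *\<^sub>R f x) \<longlonglongrightarrow> indicator {s} x *\<^sub>R f x"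
    proof (rule AE_I2)
      fix x assume "x \<in> space m"
      have "\<forall>\<^sub>F n in sequentially. indicator (nb (n + k) s) x *\<^sub>R f x = indicator {s} x *\<^sub>R f x"
      proof (cases "x = s")
        case True
        then show ?thesis using nb_self[OF sT] by simp
      next
        case False
        then obtain j where j: "x \<notin> nb j s" using nb_Inter[OF sT] by auto
        then have "x \<notin> nb (n + k) s" if "n \<ge> j" for n using nb_dec[of j "n + k", OF _ sT] that by auto
        then show ?thesis using False unfolding eventually_sequentially by (intro exI[of _ j]) auto
      qed
      then show "(\<lambda>n. indicator (nb (n + k) s) x *\<^sub>R f x) \<longlonglongrightarrow> indicator {s} x *\<^sub>R f x"
        by (rule tendsto_eventually)
    qed
    show "AE x in m. norm (indicator (nb (n + k) s) x *\<^sub>R f x) \<le> norm (indicator A x *\<^sub>R f x)" for n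
      using nbA[of n] by (intro AE_I2) (auto simp: indicator_def)
  qed
  moreover have "(LINT x|m. indicator {s} x *\<^sub>R f x) = 0"
  proof (rule integral_eq_zero_AE)
    have "AE x in m. x \<notin> {s}" using pn by (intro AE_not_in) auto
    then show "AE x in m. indicator {s} x *\<^sub>R f x = 0" by eventually_elim auto
  qed
  ultimately have "(\<lambda>n. LINT x:nb (n + k) s|m. f x) \<longlonglongrightarrow> 0" by (simp add: set_lebesgue_integral_def)
  then have "(\<lambda>n. LINT x:nb n s|m. f x) \<longlonglongrightarrow> 0" by (rule LIMSEQ_offset)
  then show ?thesis using False by (auto simp: comp_def intro!: tendsto_mult_left_zero)
qed (simp add: comp_def)

text \<open>Fix one truncation level \<epsilon> below the jump size. The error of the truncated
  integral on a cell is uniformly small in \<open>n\<close>, as cells lie in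
  \<open>class_Ck \<A> (p - 1)\<close>. For this \<epsilon> only finitely many jumps remain near
  \<open>s\<close>, the cells eventually isolate the one at \<open>s\<close>, and the compensator of
  the cells vanishes.\<close>

lemma tendsto_jump:
  assumes r: "regular \<omega>" and sj: "simple_jumps \<omega>" and z: "(s, x) \<in> \<Xi> \<omega>" "s \<in> \<Union>(An k)" "x \<noteq> 0"
  shows "(\<lambda>n. DY \<omega> (nb n s)) \<longlonglongrightarrow> f s * x"
proof (rule LIMSEQ_I)
  fix e :: real assume e: "e > 0"
  have sT: "s \<in> \<T>" using z A_sub[OF An_A] by auto
  define A where "A = PA k s"
  have Ak: "A \<in> An k" using PA_An[OF z(2)] by (simp add: A_def)
  have A: "A \<in> \<A>" using Ak An_A by auto
  \<comment> \<open>Calibrated so that the factor lost in \<open>Ck_bound\<close> turns \<eta> into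
    \<open>e / 2\<close>; the other half is for the compensator.\<close>
  define \<eta> where "\<eta> = e / (2 * 2 ^ (p - 1 + 1))"
  have \<eta>: "\<eta> > 0" using e by (simp add: \<eta>_def)
  have "\<forall>\<^sub>F \<epsilon> in at_right 0. \<forall>B\<in>{B\<in>\<A>. B \<subseteq> A}. dist (Ye \<epsilon> B \<omega>) (Y B \<omega>) < \<eta>"
    using r A \<eta> by (auto simp: regular_def uniform_limit_iff)
  from eventually_conj[OF this eventually_at_right_real[of 0 "\<bar>x\<bar>"]] z(3) obtain \<epsilon> where \<epsilon>: "\<And>B. B \<in> \<A> \<Longrightarrow> B \<subseteq> A \<Longrightarrow> dist (Ye \<epsilon> B \<omega>) (Y B \<omega>) < \<eta>" "0 < \<epsilon>" "\<epsilon> < \<bar>x\<bar>"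
    using eventually_happens'[OF trivial_limit_at_right_real] by fastforce
  define g where "g U = DY \<omega> U - Ye \<epsilon> U \<omega>" for U
  have g: "\<bar>g (nb n s)\<bar> \<le> e / 2" if n: "n \<ge> k" for n
  proof -
    have nbl: "nb n s \<in> left_nbhds (An n)" using nb_left_nbhds[OF cover_ge[OF z(2) n]] .
    have "\<bar>g (nb n s)\<bar> \<le> 2 ^ (p - 1 + 1) * \<eta>"
    proof (rule Ck_bound[where A = A])
      show "g (U \<union> V) = g U + g V" if "U \<in> Cu" "V \<in> Cu" "U \<inter> V = {}" for U V
        using Delta_additive[OF r that] Ye_additive[OF r that \<epsilon>(2)] by (simp add: g_def)
      show "\<bar>g B\<bar> \<le> \<eta>" if "B \<in> \<A>" "B \<subseteq> A" for B
        using \<epsilon>(1)[OF that] Delta_base[OF r that(1)] by (simp add: g_def dist_real_def abs_minus_commute)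
      show "nb n s \<in> class_Ck \<A> (p - 1)" using p_adm nbl by (auto simp: admissible_dim_def)
      show "nb n s \<subseteq> A" using nb_dec[OF n sT] nb_left_nbhd[OF z(2)] by (auto simp: A_def)
    qed (rule A)
    also have "\<dots> = e / 2" by (simp add: \<eta>_def)
    finally show ?thesis .
  qed
  define S where "S = \<Xi> \<omega> \<inter> A \<times> tail \<epsilon>"
  have S: "finite S" using r A \<epsilon> by (auto simp: S_def regular_def)
  have inj: "inj_on fst S" using sj Ak \<epsilon>(2) by (auto simp: S_def simple_jumps_def)
  have "s \<in> A" using PA_in[OF sT] by (simp add: A_def)
  then have zS: "(s, x) \<in> S" using z \<epsilon> by (auto simp: S_def)
  have "\<forall>\<^sub>F n in sequentially. \<forall>z\<in>S. z \<noteq> (s, x) \<longrightarrow> fst z \<notin> nb n s"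
  proof (rule eventually_ball_finite[OF S], rule ballI)
    fix z assume zz: "z \<in> S"
    show "\<forall>\<^sub>F n in sequentially. z \<noteq> (s, x) \<longrightarrow> fst z \<notin> nb n s"
    proof (cases "z = (s, x)")
      case False
      then have "fst z \<noteq> s" using inj_onD[OF inj _ zz zS] by auto
      then obtain j where j: "fst z \<notin> nb j s" using nb_Inter[OF sT] by auto
      have "fst z \<notin> nb n s" if "n \<ge> j" for n using nb_dec[OF that sT] j by auto
      then show ?thesis unfolding eventually_sequentially by (intro exI[of _ j]) auto
    qed simp
  qed
  moreover have "\<forall>\<^sub>F n in sequentially. \<bar>comp \<epsilon> (nb n s)\<bar> < e / 2"
    using tendstoD[OF comp_tendsto[OF z(2), of \<epsilon>], of "e / 2"] e by simp
  ultimately have "\<forall>\<^sub>F n in sequentially. norm (DY \<omega> (nb n s) - f s * x) < e"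
    using eventually_ge_at_top[of k]
  proof eventually_elim
    case (elim n)
    have nbA: "nb n s \<subseteq> A" using nb_dec[OF elim(3) sT] nb_left_nbhd[OF z(2)] by (auto simp: A_def)
    have eq: "\<Xi> \<omega> \<inter> nb n s \<times> tail \<epsilon> = {(s, x)}"
    proof
      show "\<Xi> \<omega> \<inter> nb n s \<times> tail \<epsilon> \<subseteq> {(s, x)}"
      proof
        fix z assume z': "z \<in> \<Xi> \<omega> \<inter> nb n s \<times> tail \<epsilon>"
        then have "z \<in> S" "fst z \<in> nb n s" using nbA by (auto simp: S_def)
        then show "z \<in> {(s, x)}" using elim(1) by auto
      qed
      show "{(s, x)} \<subseteq> \<Xi> \<omega> \<inter> nb n s \<times> tail \<epsilon>" using zS nb_self[OF sT] by (auto simp: S_def)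
    qed
    then have "Ye \<epsilon> (nb n s) \<omega> = f s * x - comp \<epsilon> (nb n s)" by (subst Ye_eq) simp_all
    then have "DY \<omega> (nb n s) - f s * x = g (nb n s) - comp \<epsilon> (nb n s)" by (simp add: g_def)
    then show ?case using g[OF elim(3)] elim(2) by (simp add: abs_less_iff) linarith
  qed
  then show "\<exists>no. \<forall>n\<ge>no. norm (DY \<omega> (nb n s) - f s * x) < e" by (simp add: eventually_sequentially)
qed

lemma dT_m[measurable]: "(\<lambda>s. dT s t) \<in> borel_measurable m"
  by (rule point_dist_measurable[OF m_space m_sets t])

lemma dT_commute: "s \<in> \<T> \<Longrightarrow> dT t s = dT s t"
  using d_sym pt_A t by (simp add: point_dist_def)

lemma dT_nonneg: "s \<in> \<T> \<Longrightarrow> 0 \<le> dT s t"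
  using d_nonneg pt_A t by (simp add: point_dist_def)

lemma ball_eq: "point_ball \<T> An d t \<rho> = {s \<in> space m. dT s t < \<rho>}"
  using dT_commute by (auto simp: point_ball_def m_space)

lemma large_eq: "large_set \<T> An d f t \<alpha> = {s \<in> space m. rpow (dT s t) \<alpha> < \<bar>f s\<bar>}"
  by (auto simp: large_set_def m_space)

lemma rpow_m[measurable]: "(\<lambda>s. rpow (dT s t) \<alpha>) \<in> borel_measurable m"
  unfolding rpow_def by (cases "\<alpha> = 0") auto

lemma ball_m: "point_ball \<T> An d t \<rho> \<in> sets m"
  unfolding ball_eq by measurable

lemma large_m: "large_set \<T> An d f t \<alpha> \<in> sets m"
  unfolding large_eq by measurable

text \<open>
  A jump in \<open>W n\<close> has a location at distance \<open>r < 1 / (n + 1)\<close> from \<open>t\<close> and contributes more than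
  \<open>r\<close> to the power \<open>\<alpha> + \<kappa>\<close>.
\<close>

definition W :: "real \<Rightarrow> real \<Rightarrow> nat \<Rightarrow> ('a \<times> real) set" where
  "W \<alpha> \<kappa> n = {z \<in> space (m \<Otimes>\<^sub>M \<nu>). rpow (dT (fst z) t) \<alpha> < \<bar>f (fst z)\<bar> \<and> dT (fst z) t < 1 / real (Suc n) \<and>
     dT (fst z) t < \<bar>snd z\<bar> powr (1 / \<kappa>) \<and> snd z \<noteq> 0}"

lemma W_m: "W \<alpha> \<kappa> n \<in> sets (m \<Otimes>\<^sub>M \<nu>)"
  unfolding W_def by measurable

text \<open>Jumps bounded away from 0 have finite intensity, so a divergence of the integral sits at
  0.\<close>

lemma small_jumps_infinite:
  assumes inf: "(\<integral>\<^sup>+ x\<in>{x. \<bar>x\<bar> \<le> 1}. ennreal (\<bar>x\<bar> powr \<delta>) \<partial>\<nu>) = \<top>" and x1: "0 < x1" "x1 \<le> 1" and \<delta>: "\<delta> > 0"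
  shows "(\<integral>\<^sup>+ x\<in>{x. \<bar>x\<bar> \<le> x1}. ennreal (\<bar>x\<bar> powr \<delta>) \<partial>\<nu>) = \<top>"
proof -
  have "(\<integral>\<^sup>+ x\<in>{x. \<bar>x\<bar> \<le> 1}. ennreal (\<bar>x\<bar> powr \<delta>) \<partial>\<nu>) \<le>
    (\<integral>\<^sup>+ x. ennreal (\<bar>x\<bar> powr \<delta>) * indicator {x. \<bar>x\<bar> \<le> x1} x + indicator (tail x1) x \<partial>\<nu>)"
  proof (rule nn_integral_mono)
    fix x :: real
    have "\<bar>x\<bar> powr \<delta> \<le> 1" if "\<bar>x\<bar> \<le> 1" using powr_mono2[of \<delta> "\<bar>x\<bar>" 1] that \<delta> by simp
    then have "ennreal (\<bar>x\<bar> powr \<delta>) \<le> 1" if "\<bar>x\<bar> \<le> 1" using that ennreal_leI by fastforce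
    then show "ennreal (\<bar>x\<bar> powr \<delta>) * indicator {x. \<bar>x\<bar> \<le> 1} x \<le> ennreal (\<bar>x\<bar> powr \<delta>) * indicator {x. \<bar>x\<bar> \<le> x1} x + indicator (tail x1) x"
      by (auto simp: indicator_def)
  qed
  also have "\<dots> = (\<integral>\<^sup>+ x\<in>{x. \<bar>x\<bar> \<le> x1}. ennreal (\<bar>x\<bar> powr \<delta>) \<partial>\<nu>) + emeasure \<nu> (tail x1)"
    by (subst nn_integral_add) auto
  finally show ?thesis using inf nu_tail[OF x1(1)] by (auto simp: top_unique)
qed

text \<open>The slice of \<open>W\<close> at a small jump size \<open>x\<close> is the part of the
  ball of radius \<open>\<bar>x\<bar> powr (1 / \<kappa>)\<close> on which \<open>f\<close> is
  large. Its measure is at least a constant times \<open>\<bar>x\<bar> powr (q / \<kappa>)\<close>,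
  hence times \<open>\<bar>x\<bar> powr \<delta>\<close>, whose integral near 0 diverges.\<close>

lemma W_infinite:
  assumes reg: "(\<alpha>, q) \<in> upper_region \<T> An d m f t" and \<kappa>: "\<kappa> > 0" and \<delta>: "\<delta> > 0" "q / \<kappa> \<le> \<delta>"
    and inf: "(\<integral>\<^sup>+ x\<in>{x. \<bar>x\<bar> \<le> 1}. ennreal (\<bar>x\<bar> powr \<delta>) \<partial>\<nu>) = \<top>"
  shows "emeasure (m \<Otimes>\<^sub>M \<nu>) (W \<alpha> \<kappa> n) = \<top>"
proof -
  define D where "D \<rho> = point_ball \<T> An d t \<rho> \<inter> large_set \<T> An d f t \<alpha>" for \<rho>
  have "0 < Liminf (at_right 0) (\<lambda>\<rho>. emeasure m (D \<rho>) / ennreal (\<rho> powr q))"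
    using reg by (simp add: upper_region_def D_def)
  then obtain c where c: "0 < c" "c < Liminf (at_right 0) (\<lambda>\<rho>. emeasure m (D \<rho>) / ennreal (\<rho> powr q))"
    using dense by blast
  have "\<forall>\<^sub>F \<rho> in at_right 0. c < emeasure m (D \<rho>) / ennreal (\<rho> powr q)" by (rule less_LiminfD[OF c(2)])
  then obtain \<rho>1 where \<rho>1: "\<rho>1 > 0" "\<And>\<rho>. 0 < \<rho> \<Longrightarrow> \<rho> < \<rho>1 \<Longrightarrow> c < emeasure m (D \<rho>) / ennreal (\<rho> powr q)"
    by (auto simp: eventually_at_right_field)
  have cD: "c * ennreal (\<rho> powr q) \<le> emeasure m (D \<rho>)" if "0 < \<rho>" "\<rho> < \<rho>1" for \<rho>
  proof -
    have "c * ennreal (\<rho> powr q) \<le> emeasure m (D \<rho>) / ennreal (\<rho> powr q) * ennreal (\<rho> powr q)"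
      using \<rho>1(2)[OF that] by (intro mult_right_mono) auto
    also have "\<dots> = emeasure m (D \<rho>)" using that
      by (intro ennreal_divide_mult_cancel) auto
    finally show ?thesis .
  qed
  \<comment> \<open>Below \<open>b\<close> the lower bound on the measure holds and the cutoff
    \<open>1 / real (Suc n)\<close> in \<open>W\<close> is inactive; \<open>x1\<close> is the jump
    size whose radius is at most \<open>b\<close>.\<close>
  define b where "b = min \<rho>1 (1 / real (Suc n)) / 2"
  have b: "b > 0" "b < \<rho>1" "b < 1 / real (Suc n)" using \<rho>1(1) by (auto simp: b_def min_def field_simps)
  define x1 where "x1 = min 1 (b powr \<kappa>)"
  have x1: "0 < x1" "x1 \<le> 1" using b by (auto simp: x1_def)
  have px: "\<bar>x\<bar> powr (1 / \<kappa>) \<le> b" if "\<bar>x\<bar> \<le> x1" for x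
  proof -
    have "\<bar>x\<bar> powr (1 / \<kappa>) \<le> (b powr \<kappa>) powr (1 / \<kappa>)" using that \<kappa> by (intro powr_mono2) (auto simp: x1_def)
    also have "\<dots> = b" using b \<kappa> by (simp add: powr_powr)
    finally show ?thesis .
  qed
  have "\<top> = c * (\<integral>\<^sup>+ x\<in>{x. \<bar>x\<bar> \<le> x1}. ennreal (\<bar>x\<bar> powr \<delta>) \<partial>\<nu>)"
    using small_jumps_infinite[OF inf x1 \<delta>(1)] c(1) by (simp add: ennreal_mult_top)
  also have "\<dots> = (\<integral>\<^sup>+ x. c * (ennreal (\<bar>x\<bar> powr \<delta>) * indicator {x. \<bar>x\<bar> \<le> x1} x) \<partial>\<nu>)"
    by (rule nn_integral_cmult[symmetric]) measurable
  also have "\<dots> \<le> (\<integral>\<^sup>+ x. emeasure m ((\<lambda>s. (s, x)) -` W \<alpha> \<kappa> n) \<partial>\<nu>)"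
  proof (rule nn_integral_mono)
    fix x :: real
    show "c * (ennreal (\<bar>x\<bar> powr \<delta>) * indicator {x. \<bar>x\<bar> \<le> x1} x) \<le> emeasure m ((\<lambda>s. (s, x)) -` W \<alpha> \<kappa> n)"
    proof (cases "\<bar>x\<bar> \<le> x1 \<and> x \<noteq> 0")
      case True
      define \<rho> where "\<rho> = \<bar>x\<bar> powr (1 / \<kappa>)"
      have \<rho>: "0 < \<rho>" "\<rho> \<le> b" using True px by (auto simp: \<rho>_def)
      have "(\<lambda>s. (s, x)) -` W \<alpha> \<kappa> n = D \<rho>"
        using True \<rho> b by (auto simp: W_def D_def ball_eq large_eq space_pair_measure nu_space \<rho>_def)
      moreover have "\<bar>x\<bar> powr \<delta> \<le> \<rho> powr q"
      proof -
        have "\<bar>x\<bar> powr \<delta> \<le> \<bar>x\<bar> powr (q / \<kappa>)" using True x1 \<delta> by (intro powr_mono') auto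
        then show ?thesis by (simp add: \<rho>_def powr_powr)
      qed
      then have "c * ennreal (\<bar>x\<bar> powr \<delta>) \<le> c * ennreal (\<rho> powr q)"
        by (intro mult_left_mono ennreal_leI) auto
      moreover have "\<dots> \<le> emeasure m (D \<rho>)" using \<rho> b by (intro cD) auto
      ultimately show ?thesis using True by (simp add: order_trans)
    qed (auto simp: indicator_def)
  qed
  also have "\<dots> = emeasure (m \<Otimes>\<^sub>M \<nu>) (W \<alpha> \<kappa> n)" by (rule mn.emeasure_pair_measure_alt2[OF W_m, symmetric])
  finally show ?thesis by (simp add: top_unique)
qed

abbreviation "small_C \<rho> \<equiv> {C \<in> class_Ck \<A> (p - 1) \<inter> class_C_ball \<A> d (pt t) \<rho>. point_diam \<T> An d C < ennreal \<rho>}"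
abbreviation "osc \<omega> a \<rho> \<equiv> (SUP C\<in>small_C \<rho>. ennreal (\<bar>DY \<omega> C\<bar> / \<rho> powr a))"

text \<open>If the limsup were finite, each jump at distance \<open>r\<close> from \<open>t\<close>
  would be at most a constant times \<open>(2 * r) powr a\<close>, since the cells around its
  location enter the supremum at radius \<open>2 * r\<close>. The jumps in \<open>W\<close> exceed
  \<open>r powr (\<alpha> + \<kappa>)\<close> with \<open>r\<close> as small as desired, which is a
  larger order.\<close>

lemma upper_single:
  assumes reg: "(\<alpha>, q) \<in> upper_region \<T> An d m f t" and \<kappa>: "\<kappa> > 0" and \<delta>: "\<delta> > 0" "q / \<kappa> \<le> \<delta>"
    and inf: "(\<integral>\<^sup>+ x\<in>{x. \<bar>x\<bar> \<le> 1}. ennreal (\<bar>x\<bar> powr \<delta>) \<partial>\<nu>) = \<top>" and a: "\<alpha> + \<kappa> < a"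
  shows "AE \<omega> in P. \<not> Limsup (at_right 0) (osc \<omega> a) < \<top>"
proof -
  have \<alpha>: "\<alpha> \<ge> 0" using reg by (simp add: upper_region_def)
  have "AE \<omega> in P. \<forall>n. num_points \<Xi> (W \<alpha> \<kappa> n) \<omega> = \<top>"
    unfolding AE_all_countable using W_infinite[OF assms(1-5)] num_points_infinite[OF W_m] by blast
  then show ?thesis using AE_regular AE_simple_jumps
  proof eventually_elim
    case (elim \<omega>)
    have W: "\<exists>z. z \<in> \<Xi> \<omega> \<inter> W \<alpha> \<kappa> n" for n
    proof (rule ccontr)
      assume "\<nexists>z. z \<in> \<Xi> \<omega> \<inter> W \<alpha> \<kappa> n"
      then have "\<Xi> \<omega> \<inter> W \<alpha> \<kappa> n = {}" by blast
      then have "num_points \<Xi> (W \<alpha> \<kappa> n) \<omega> = 0" by (simp add: num_points_def)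
      then show False using elim(1) by (metis ennreal_zero_neq_top)
    qed
    show ?case
    proof
      assume "Limsup (at_right 0) (osc \<omega> a) < \<top>"
      then obtain K' where K': "Limsup (at_right 0) (osc \<omega> a) < K'" "K' < \<top>" using dense by blast
      define K where "K = enn2real K'"
      have K: "K \<ge> 0" "K' = ennreal K" using K'(2) by (auto simp: K_def)
      have "\<forall>\<^sub>F \<rho> in at_right 0. osc \<omega> a \<rho> < K'" by (rule Limsup_lessD[OF K'(1)])
      then obtain \<rho>2 where \<rho>2: "\<rho>2 > 0" "\<And>\<rho>. 0 < \<rho> \<Longrightarrow> \<rho> < \<rho>2 \<Longrightarrow> osc \<omega> a \<rho> < K'"
        by (auto simp: eventually_at_right_field)
      \<comment> \<open>The increments over cells only converge to the jump; the factor 2 allows a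
        cell that carries at least half of it.\<close>
      have bnd: "\<bar>f s * x\<bar> \<le> 2 * K * \<rho> powr a"
        if z: "(s, x) \<in> \<Xi> \<omega>" "s \<in> \<T>" "x \<noteq> 0" "f s \<noteq> 0" and \<rho>: "dT s t < \<rho>" "\<rho> < \<rho>2" for s x \<rho>
      proof -
        have "s \<notin> residual" using elim(2) z by (auto simp: regular_def)
        then obtain k where k: "s \<in> \<Union>(An k)" using z by (auto simp: residual_def)
        have \<rho>0: "\<rho> > 0" using dT_nonneg[OF z(2)] \<rho> by linarith
        have "(\<lambda>n. \<bar>DY \<omega> (nb n s)\<bar>) \<longlonglongrightarrow> \<bar>f s * x\<bar>"
          by (intro tendsto_rabs tendsto_jump[OF elim(2,3) z(1) k z(3)])
        then have "\<forall>\<^sub>F n in sequentially. \<bar>f s * x\<bar> / 2 < \<bar>DY \<omega> (nb n s)\<bar>"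
          using z by (intro order_tendstoD(1)) auto
        from eventually_conj[OF this nb_in_ball[OF k \<rho>(1)]]
        obtain n where n: "\<bar>f s * x\<bar> / 2 < \<bar>DY \<omega> (nb n s)\<bar>" "nb n s \<in> small_C \<rho>"
          using eventually_happens'[OF sequentially_bot] by blast
        have "ennreal (\<bar>DY \<omega> (nb n s)\<bar> / \<rho> powr a) \<le> osc \<omega> a \<rho>" by (rule SUP_upper[OF n(2)])
        also have "\<dots> \<le> ennreal K" using \<rho>2(2)[OF \<rho>0 \<rho>(2)] K by simp
        finally have "\<bar>DY \<omega> (nb n s)\<bar> / \<rho> powr a \<le> K" using K by (simp add: ennreal_le_iff)
        then have "\<bar>DY \<omega> (nb n s)\<bar> \<le> K * \<rho> powr a" using \<rho>0 by (simp add: pos_divide_le_eq)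
        then show ?thesis using n(1) by simp
      qed
      define b where "b = a - (\<alpha> + \<kappa>)"
      have b: "b > 0" using a by (simp add: b_def)
      have "((\<lambda>r. 2 * K * 2 powr a * r powr b) \<longlongrightarrow> 2 * K * 2 powr a * 0) (at_right 0)"
        by (intro tendsto_mult tendsto_const powr_at_right_0 b)
      then have "\<forall>\<^sub>F r in at_right 0. 2 * K * 2 powr a * r powr b < 1"
        by (intro order_tendstoD(2)) auto
      then obtain r1 where r1: "r1 > 0" "\<And>r. 0 < r \<Longrightarrow> r < r1 \<Longrightarrow> 2 * K * 2 powr a * r powr b < 1"
        by (auto simp: eventually_at_right_field)
      obtain n where n: "inverse (real (Suc n)) < min r1 (\<rho>2 / 2)" using reals_Archimedean[of "min r1 (\<rho>2 / 2)"] r1 \<rho>2 by auto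
      obtain s x where sx: "(s, x) \<in> \<Xi> \<omega>" "(s, x) \<in> W \<alpha> \<kappa> n" using W[of n] by auto
      define r where "r = dT s t"
      have w: "s \<in> \<T>" "rpow r \<alpha> < \<bar>f s\<bar>" "r < r1" "2 * r < \<rho>2" "r < \<bar>x\<bar> powr (1 / \<kappa>)" "x \<noteq> 0"
        using sx(2) n by (auto simp: W_def r_def space_pair_measure m_space inverse_eq_divide)
      have r0: "r \<ge> 0" using dT_nonneg[OF w(1)] by (simp add: r_def)
      have "0 \<le> rpow r \<alpha>" by (simp add: rpow_def)
      then have f0: "f s \<noteq> 0" using w(2) by auto
      show False
      proof (cases "r = 0")
        case True
        \<comment> \<open>At distance 0 from \<open>t\<close> no power of \<open>r\<close> is
          available for comparison. The bound then holds at every small radius \<rho>, and letting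
          \<rho> tend to 0 would annihilate the jump.\<close>
        have "((\<lambda>\<rho>. 2 * K * \<rho> powr a) \<longlongrightarrow> 2 * K * 0) (at_right 0)"
          using a \<alpha> \<kappa> by (intro tendsto_mult tendsto_const powr_at_right_0) auto
        then have "\<forall>\<^sub>F \<rho> in at_right 0. 2 * K * \<rho> powr a < \<bar>f s * x\<bar>"
          using f0 w by (intro order_tendstoD(2)) auto
        then obtain r2 where r2: "r2 > 0" "\<And>\<rho>. 0 < \<rho> \<Longrightarrow> \<rho> < r2 \<Longrightarrow> 2 * K * \<rho> powr a < \<bar>f s * x\<bar>"
          by (auto simp: eventually_at_right_field)
        define \<rho> where "\<rho> = min r2 \<rho>2 / 2"
        have "0 < \<rho>" "\<rho> < r2" "\<rho> < \<rho>2" using r2(1) \<rho>2(1) by (auto simp: \<rho>_def min_def)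
        then show False using r2(2)[of \<rho>] bnd[OF sx(1) w(1,6) f0, of \<rho>] True by (auto simp: r_def)
      next
        case False
        then have rpos: "r > 0" using r0 by simp
        have fr: "r powr \<alpha> < \<bar>f s\<bar>" using w(2) rpos by (simp add: rpow_def split: if_splits)
        have "r powr \<kappa> < (\<bar>x\<bar> powr (1 / \<kappa>)) powr \<kappa>" using w(5) rpos \<kappa> by (intro powr_less_mono2) auto
        then have xr: "r powr \<kappa> < \<bar>x\<bar>" using \<kappa> w(6) by (simp add: powr_powr)
        have "r powr (\<alpha> + \<kappa>) < \<bar>f s * x\<bar>"
          unfolding powr_add abs_mult using fr xr by (intro mult_strict_mono') auto
        also have "\<dots> \<le> 2 * K * (2 * r) powr a"
          using bnd[OF sx(1) w(1,6) f0, of "2 * r"] rpos w(4) by (simp add: r_def)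
        also have "\<dots> = (2 * K * 2 powr a * r powr b) * r powr (\<alpha> + \<kappa>)"
          using rpos by (simp add: powr_mult b_def powr_add[symmetric])
        also have "\<dots> < 1 * r powr (\<alpha> + \<kappa>)"
          using r1(2)[OF rpos w(3)] rpos by (intro mult_strict_right_mono) auto
        finally show False by simp
      qed
    qed
  qed
qed

end

context levy_setting
begin

section \<open>Upper bound in terms of the Blumenthal-Getoor exponent\<close>

lemma blumenthal_getoor_le:
  "\<delta> > 0 \<Longrightarrow> (\<integral>\<^sup>+ x\<in>{x. \<bar>x\<bar> \<le> 1}. ennreal (\<bar>x\<bar> powr \<delta>) \<partial>\<nu>) < \<top> \<Longrightarrow> \<beta> \<le> ennreal \<delta>"
  unfolding blumenthal_getoor_def by (rule Inf_lower) auto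

lemma jumps_square_small: "(\<integral>\<^sup>+ x\<in>{x. \<bar>x\<bar> \<le> 1}. ennreal (\<bar>x\<bar> powr 2) \<partial>\<nu>) < \<top>"
proof -
  have "(\<integral>\<^sup>+ x\<in>{x. \<bar>x\<bar> \<le> 1}. ennreal (\<bar>x\<bar> powr 2) \<partial>\<nu>) \<le> (\<integral>\<^sup>+ x. ennreal (x\<^sup>2) \<partial>\<nu>)"
    by (intro nn_integral_mono) (auto simp: indicator_def intro!: ennreal_leI)
  then show ?thesis using nu_sq by simp
qed

lemma blumenthal_getoor_le_2: "\<beta> \<le> ennreal 2"
  by (rule blumenthal_getoor_le[OF _ jumps_square_small]) simp

lemma osc_Limsup_mono:
  assumes "a \<le> b" "Limsup (at_right 0) (osc \<omega> b) < \<top>"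
  shows "Limsup (at_right 0) (osc \<omega> a) < \<top>"
proof -
  have "Limsup (at_right 0) (osc \<omega> a) \<le> Limsup (at_right 0) (osc \<omega> b)"
  proof (rule Limsup_mono)
    have "osc \<omega> a \<rho> \<le> osc \<omega> b \<rho>" if "0 < \<rho>" "\<rho> < 1" for \<rho> :: real
    proof (rule SUP_mono)
      fix C assume C: "C \<in> small_C \<rho>"
      have "\<rho> powr b \<le> \<rho> powr a" using that assms(1) by (intro powr_mono') auto
      then have "\<bar>DY \<omega> C\<bar> / \<rho> powr a \<le> \<bar>DY \<omega> C\<bar> / \<rho> powr b" using that by (intro divide_left_mono) auto
      then show "\<exists>C'\<in>small_C \<rho>. ennreal (\<bar>DY \<omega> C\<bar> / \<rho> powr a) \<le> ennreal (\<bar>DY \<omega> C'\<bar> / \<rho> powr b)"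
        using C by (intro bexI[of _ C] ennreal_leI)
    qed
    then show "\<forall>\<^sub>F \<rho> in at_right 0. osc \<omega> a \<rho> \<le> osc \<omega> b \<rho>"
      unfolding eventually_at_right_field by (intro exI[of _ 1]) auto
  qed
  then show ?thesis using assms(2) by (rule order.strict_trans1)
qed

abbreviation "expo \<omega> \<equiv> localized_exponent \<T> \<A> An d (\<lambda>A. Y A \<omega>) (pt t)"

text \<open>For \<beta> equal to 0 the bound is infinite by the convention of
  \<open>quot_upper\<close>. Otherwise every exponent above \<gamma> leaves room for a choice of
  \<kappa> and \<delta> that makes the limsup infinite.\<close>

lemma upper_AE:
  assumes reg: "(\<alpha>, q) \<in> upper_region \<T> An d m f t"
  shows "AE \<omega> in P. expo \<omega> \<le> quot_upper q \<beta> + ennreal \<alpha>"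
proof (cases "\<beta> = 0")
  case True
  then show ?thesis by (simp add: quot_upper_def)
next
  case False
  have \<alpha>q: "\<alpha> \<ge> 0" "q \<ge> 0" using reg by (auto simp: upper_region_def)
  define b where "b = enn2real \<beta>"
  have "\<beta> < \<top>" using blumenthal_getoor_le_2 by (rule order.strict_trans1) simp
  then have b: "\<beta> = ennreal b" "b > 0" using False by (auto simp: b_def enn2real_positive_iff zero_less_iff_neq_zero)
  define \<gamma> where "\<gamma> = q / b + \<alpha>"
  have quot: "quot_upper q \<beta> + ennreal \<alpha> = ennreal \<gamma>"
    using b \<alpha>q by (simp add: quot_upper_def divide_ennreal \<gamma>_def ennreal_plus)
  \<comment> \<open>The null set depends on the exponent; rational exponents suffice because
    finiteness of the limsup is inherited by smaller exponents.\<close>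
  have "AE \<omega> in P. \<forall>a::rat. \<gamma> < real_of_rat a \<longrightarrow> \<not> Limsup (at_right 0) (osc \<omega> (real_of_rat a)) < \<top>"
    unfolding AE_all_countable
  proof
    fix a' :: rat
    define a where "a = real_of_rat a'"
    show "AE \<omega> in P. \<gamma> < real_of_rat a' \<longrightarrow> \<not> Limsup (at_right 0) (osc \<omega> (real_of_rat a')) < \<top>"
    proof (cases "\<gamma> < a")
      case True
      have qb: "q / b \<ge> 0" using \<alpha>q b by simp
      have qa: "q / b < a - \<alpha>" using True unfolding \<gamma>_def by linarith
      \<comment> \<open>Taking \<kappa> above \<open>q / b\<close> is the same as
        \<open>q / \<kappa> < b\<close>, so some \<delta> fits between \<open>q / \<kappa>\<close>
        and \<open>b\<close>; below \<open>b\<close> the integral of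
        \<open>\<bar>x\<bar> powr \<delta>\<close> near 0 diverges.\<close>
      obtain \<kappa> where \<kappa>: "q / b < \<kappa>" "\<kappa> < a - \<alpha>" using dense[OF qa] by auto
      then have \<kappa>a: "\<alpha> + \<kappa> < a" by simp
      have \<kappa>0: "\<kappa> > 0" using order.strict_trans1[OF qb \<kappa>(1)] .
      then have qk: "q / \<kappa> < b" using \<kappa>(1) b(2) by (simp add: field_simps)
      obtain \<delta> where \<delta>': "q / \<kappa> < \<delta>" "\<delta> < b" using dense[OF qk] by auto
      have "0 \<le> q / \<kappa>" using \<alpha>q \<kappa>0 by simp
      then have \<delta>: "\<delta> > 0" "q / \<kappa> \<le> \<delta>" "\<delta> < b" using \<delta>' by auto
      have "(\<integral>\<^sup>+ x\<in>{x. \<bar>x\<bar> \<le> 1}. ennreal (\<bar>x\<bar> powr \<delta>) \<partial>\<nu>) = \<top>"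
      proof (rule ccontr)
        assume "(\<integral>\<^sup>+ x\<in>{x. \<bar>x\<bar> \<le> 1}. ennreal (\<bar>x\<bar> powr \<delta>) \<partial>\<nu>) \<noteq> \<top>"
        then have "\<beta> \<le> ennreal \<delta>" using \<delta>(1) by (intro blumenthal_getoor_le) (auto simp: less_top)
        then show False using b \<delta> by (simp add: ennreal_le_iff)
      qed
      from upper_single[OF reg \<kappa>0 \<delta>(1,2) this \<kappa>a] show ?thesis by (auto simp: a_def)
    qed (simp add: a_def)
  qed
  then show ?thesis
  proof eventually_elim
    case (elim \<omega>)
    have "\<alpha>' \<le> \<gamma>" if "Limsup (at_right 0) (osc \<omega> \<alpha>') < \<top>" for \<alpha>'
    proof (rule ccontr)
      assume "\<not> \<alpha>' \<le> \<gamma>"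
      then obtain a :: rat where a: "\<gamma> < real_of_rat a" "real_of_rat a < \<alpha>'" using of_rat_dense[of \<gamma> \<alpha>'] by auto
      then show False using elim osc_Limsup_mono[OF _ that, of "real_of_rat a"] by auto
    qed
    then have "expo \<omega> \<le> ennreal \<gamma>"
      unfolding localized_exponent_def by (intro Sup_least) (auto intro!: ennreal_leI)
    then show ?case by (simp add: quot)
  qed
qed

end

section \<open>A maximal inequality for compensated jumps\<close>

text \<open>Outside the lim inf, infinitely many of the events fail. That is enough to pass a closed
  bound to a limit, and it keeps the probability bound without monotonicity of the events.\<close>

lemma (in prob_space) prob_liminf_le:
  fixes A :: "nat \<Rightarrow> 'a set"
  assumes "\<And>n. A n \<in> events" "\<And>n. prob (A n) \<le> c"
  shows "prob (\<Union>N. \<Inter>n\<in>{N..}. A n) \<le> c" "(\<Union>N. \<Inter>n\<in>{N..}. A n) \<in> events"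
proof -
  have I: "(\<Inter>n\<in>{N..}. A n) \<in> events" for N using assms(1) by (intro sets.countable_INT') auto
  then show "(\<Union>N. \<Inter>n\<in>{N..}. A n) \<in> events" by auto
  have "(\<lambda>N. prob (\<Inter>n\<in>{N..}. A n)) \<longlonglongrightarrow> prob (\<Union>N. \<Inter>n\<in>{N..}. A n)"
    using I by (intro finite_Lim_measure_incseq) (auto simp: incseq_def)
  moreover have "prob (\<Inter>n\<in>{N..}. A n) \<le> c" for N
  proof -
    have "prob (\<Inter>n\<in>{N..}. A n) \<le> prob (A N)" using assms(1) by (intro finite_measure_mono) auto
    then show ?thesis using assms(2)[of N] by linarith
  qed
  ultimately show "prob (\<Union>N. \<Inter>n\<in>{N..}. A n) \<le> c" by (intro LIMSEQ_le_const2) auto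
qed

text \<open>Transfer to an arbitrary finite index set, since \<open>poisson_random_set\<close>
  states independence for families indexed by an initial segment of the naturals.\<close>

lemma (in poisson_set) compensated_sum_maximal_finite:
  fixes c :: "'i \<Rightarrow> real" and \<phi> :: "'i \<Rightarrow> nat \<Rightarrow> nat"
  assumes J: "finite J" and D: "\<And>i. i \<in> J \<Longrightarrow> D i \<in> sets Q" "\<And>i. i \<in> J \<Longrightarrow> emeasure Q (D i) < \<top>"
    and disj: "disjoint_family_on D J" and r: "r > 0"
  defines "Z i \<omega> \<equiv> c i * (real (card (\<Xi> \<omega> \<inter> D i)) - measure Q (D i))"
  shows "prob {\<omega>\<in>space P. \<exists>z. 2 ^ p * r \<le> \<bar>\<Sum>i\<in>{i\<in>J. \<forall>k<p. \<phi> i k \<le> z k}. Z i \<omega>\<bar>}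
    \<le> 2 ^ p * ((\<Sum>i\<in>J. (c i)\<^sup>2 * measure Q (D i)) / r\<^sup>2)"
    and "{\<omega>\<in>space P. \<exists>z. 2 ^ p * r \<le> \<bar>\<Sum>i\<in>{i\<in>J. \<forall>k<p. \<phi> i k \<le> z k}. Z i \<omega>\<bar>} \<in> events"
proof -
  obtain h where h: "bij_betw h {..<card J} J"
    using ex_bij_betw_nat_finite[OF J] by (auto simp: lessThan_atLeast0)
  have hJ: "h i \<in> J" if "i < card J" for i using h that by (auto simp: bij_betw_def)
  have inj: "inj_on h {..<card J}" using h by (auto simp: bij_betw_def)
  have disj': "disjoint_family_on (\<lambda>i. D (h i)) {..<card J}"
    using disj hJ inj unfolding disjoint_family_on_def by (metis inj_onD lessThan_iff)
  have sums: "(\<Sum>i\<in>{i\<in>{..<card J}. R (h i)}. g (h i)) = (\<Sum>i\<in>{i\<in>J. R i}. g i)" for R and g :: "'i \<Rightarrow> real"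
  proof (rule sum.reindex_bij_betw)
    have "{i\<in>J. R i} = h ` {i\<in>{..<card J}. R (h i)}" using h by (auto simp: bij_betw_def)
    then show "bij_betw h {i\<in>{..<card J}. R (h i)} {i\<in>J. R i}"
      using inj by (auto simp: bij_betw_def intro: inj_on_subset)
  qed
  have sumJ: "(\<Sum>i<card J. g (h i)) = (\<Sum>i\<in>J. g i)" for g :: "'i \<Rightarrow> real"
    using sum.reindex_bij_betw[OF h] .
  note max = compensated_sum_maximal[where n = "card J" and D = "\<lambda>i. D (h i)" and c = "\<lambda>i. c (h i)" and \<phi> = "\<lambda>i. \<phi> (h i)" and p = p,
      OF D(1)[OF hJ] D(2)[OF hJ] disj' r]
  have eq: "(\<Sum>i\<in>{i\<in>{..<card J}. \<forall>k<p. \<phi> (h i) k \<le> z k}. c (h i) * (real (card (\<Xi> \<omega> \<inter> D (h i))) - measure Q (D (h i)))) =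
     (\<Sum>i\<in>{i\<in>J. \<forall>k<p. \<phi> i k \<le> z k}. Z i \<omega>)" for z \<omega>
    unfolding Z_def by (rule sums)
  have eq2: "(\<Sum>i<card J. (c (h i))\<^sup>2 * measure Q (D (h i))) = (\<Sum>i\<in>J. (c i)\<^sup>2 * measure Q (D i))"
    by (rule sumJ)
  show "prob {\<omega>\<in>space P. \<exists>z. 2 ^ p * r \<le> \<bar>\<Sum>i\<in>{i\<in>J. \<forall>k<p. \<phi> i k \<le> z k}. Z i \<omega>\<bar>}
    \<le> 2 ^ p * ((\<Sum>i\<in>J. (c i)\<^sup>2 * measure Q (D i)) / r\<^sup>2)"
    using max(1) unfolding eq eq2 .
  show "{\<omega>\<in>space P. \<exists>z. 2 ^ p * r \<le> \<bar>\<Sum>i\<in>{i\<in>J. \<forall>k<p. \<phi> i k \<le> z k}. Z i \<omega>\<bar>} \<in> events"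
    using max(2) unfolding eq .
qed

text \<open>Rounding towards 0 decreases the second moment.\<close>

definition rnd :: "nat \<Rightarrow> real \<Rightarrow> int" where
  "rnd n y = (if y \<ge> 0 then \<lfloor>y * real (Suc n)\<rfloor> else - \<lfloor>- y * real (Suc n)\<rfloor>)"

lemma rnd_error: "\<bar>real_of_int (rnd n y) / real (Suc n) - y\<bar> \<le> 1 / real (Suc n)"
proof -
  have "\<bar>real_of_int (rnd n y) - y * real (Suc n)\<bar> \<le> 1" unfolding rnd_def by (auto split: if_splits) linarith+
  then have "\<bar>real_of_int (rnd n y) - y * real (Suc n)\<bar> / real (Suc n) \<le> 1 / real (Suc n)"
    by (intro divide_right_mono) auto
  moreover have "real_of_int (rnd n y) / real (Suc n) - y = (real_of_int (rnd n y) - y * real (Suc n)) / real (Suc n)"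
    by (simp add: diff_divide_distrib del: of_nat_Suc)
  ultimately show ?thesis by (simp only: abs_divide abs_of_nat)
qed

lemma rnd_abs_le: "\<bar>real_of_int (rnd n y) / real (Suc n)\<bar> \<le> \<bar>y\<bar>"
proof -
  have "\<bar>real_of_int (rnd n y)\<bar> \<le> \<bar>y\<bar> * real (Suc n)"
  proof (cases "y \<ge> 0")
    case True
    then have "0 \<le> y * real (Suc n)" by simp
    then show ?thesis using True by (simp add: rnd_def del: of_nat_Suc)
  next
    case False
    then have "0 \<le> - y * real (Suc n)" by (simp del: of_nat_Suc add: mult_nonpos_nonneg)
    then have "0 \<le> \<lfloor>- y * real (Suc n)\<rfloor>" "real_of_int \<lfloor>- y * real (Suc n)\<rfloor> \<le> - y * real (Suc n)" by (auto simp del: of_nat_Suc)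
    then show ?thesis using False by (simp add: rnd_def del: of_nat_Suc)
  qed
  then show ?thesis by (simp add: abs_divide pos_divide_le_eq del: of_nat_Suc)
qed

lemma rnd_bounded: "\<bar>y\<bar> \<le> r \<Longrightarrow> rnd n y \<in> {- \<lceil>r * real (Suc n)\<rceil>..\<lceil>r * real (Suc n)\<rceil>}"
proof -
  assume y: "\<bar>y\<bar> \<le> r"
  have "\<bar>real_of_int (rnd n y)\<bar> \<le> \<bar>y\<bar> * real (Suc n)"
    using rnd_abs_le[of n y] by (simp add: abs_divide pos_divide_le_eq del: of_nat_Suc)
  also have "\<dots> \<le> r * real (Suc n)" using y by (intro mult_right_mono) auto
  also have "\<dots> \<le> of_int \<lceil>r * real (Suc n)\<rceil>" by simp
  finally show ?thesis by (simp del: of_nat_Suc) linarith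
qed

context levy_setting
begin

section \<open>Compensated sums of truncated and rounded jumps\<close>

definition trunc :: "real \<Rightarrow> 'a \<times> real \<Rightarrow> real" where
  "trunc r z = (if \<bar>f (fst z) * snd z\<bar> \<le> r then f (fst z) * snd z else 0)"

lemma jump_m[measurable]: "(\<lambda>z. f (fst z) * snd z) \<in> borel_measurable (m \<Otimes>\<^sub>M \<nu>)"
  by measurable

lemma trunc_m[measurable]: "trunc r \<in> borel_measurable (m \<Otimes>\<^sub>M \<nu>)"
  unfolding trunc_def by measurable

lemma trunc_le: "0 \<le> r \<Longrightarrow> \<bar>trunc r z\<bar> \<le> r"
  by (simp add: trunc_def)

context
  fixes B :: "'a set" and r e :: real
  assumes B: "B \<in> sets m" "emeasure m B < \<top>" and r: "r > 0" and e: "e > 0"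
begin

abbreviation "Q \<equiv> m \<Otimes>\<^sub>M \<nu>"
abbreviation "E \<equiv> B \<times> tail e"

lemma E_Q: "E \<in> sets Q" "emeasure Q E < \<top>"
  using B nu_tail[OF e] by (simp_all add: Q_Times_sets Q_Times ennreal_mult_less_top)

definition rtrunc :: "nat \<Rightarrow> 'a \<times> real \<Rightarrow> real" where
  "rtrunc n z = real_of_int (rnd n (trunc r z)) / real (Suc n)"

lemma rnd_trunc_m[measurable]: "(\<lambda>z. rnd n (trunc r z)) \<in> measurable Q (count_space UNIV)"
  unfolding rnd_def by measurable

lemma rtrunc_m[measurable]: "rtrunc n \<in> borel_measurable Q"
  unfolding rtrunc_def by measurable

lemma rtrunc_le: "\<bar>rtrunc n z\<bar> \<le> \<bar>trunc r z\<bar>"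
  unfolding rtrunc_def by (rule rnd_abs_le)

lemma rtrunc_le_r: "\<bar>rtrunc n z\<bar> \<le> r"
  using rtrunc_le[of n z] trunc_le[of r z] r by linarith

lemma rtrunc_tendsto: "(\<lambda>n. rtrunc n z) \<longlonglongrightarrow> trunc r z"
proof -
  have "(\<lambda>n. rtrunc n z - trunc r z) \<longlonglongrightarrow> 0"
  proof (rule Lim_null_comparison)
    show "\<forall>\<^sub>F n in sequentially. norm (rtrunc n z - trunc r z) \<le> 1 / real (Suc n)"
      using rnd_error[of _ "trunc r z"] by (intro always_eventually) (auto simp: rtrunc_def)
    show "(\<lambda>n. 1 / real (Suc n)) \<longlonglongrightarrow> 0" using LIMSEQ_inverse_real_of_nat by (simp add: inverse_eq_divide)
  qed
  then show ?thesis by (rule LIM_zero_cancel)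
qed

lemma integrable_bounded_E:
  assumes [measurable]: "g \<in> borel_measurable Q" and g: "\<And>z. \<bar>g z\<bar> \<le> r"
  shows "integrable Q (\<lambda>z. indicator E z * g z)"
proof (rule Bochner_Integration.integrable_bound)
  show "integrable Q (\<lambda>z. indicator E z * r)" using E_Q by (intro integrable_mult_left integrable_real_indicator) auto
  show "(\<lambda>z. indicator E z * g z) \<in> borel_measurable Q" using E_Q(1) by measurable
  show "AE z in Q. norm (indicator E z * g z) \<le> norm (indicator E z * r)"
    using g r by (intro AE_I2) (auto simp: indicator_def)
qed

definition Mr :: "nat \<Rightarrow> 'a set \<Rightarrow> 'w \<Rightarrow> real" where
  "Mr n A \<omega> = (\<Sum>z\<in>\<Xi> \<omega> \<inter> E. rtrunc n z * indicator A (fst z)) - (\<integral>z. indicator E z * (rtrunc n z * indicator A (fst z)) \<partial>Q)"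

text \<open>The compensator here is that of the jumps \<open>f s * x\<close> truncated at
  \<open>r\<close>, whereas \<open>comp\<close> truncates \<open>x\<close> at 1. Only this version
  is centered with small variance; the discrepancy is estimated in \<open>Ye_Mt\<close>.\<close>

definition Mt :: "'a set \<Rightarrow> 'w \<Rightarrow> real" where
  "Mt A \<omega> = (\<Sum>z\<in>\<Xi> \<omega> \<inter> E. trunc r z * indicator A (fst z)) - (\<integral>z. indicator E z * (trunc r z * indicator A (fst z)) \<partial>Q)"

text \<open>Rounded jumps take finitely many values, so on products of cells and values the
  compensated sum is a linear combination of independent centered counts. The cells making up a set
  \<open>A\<close> of \<open>An n\<close> are labelled by the sets below \<open>A\<close>, which the
  order embedding describes by \<open>p\<close> coordinate inequalities.\<close>

lemma rounded_maximal:
  assumes v: "(\<integral>\<^sup>+z. ennreal ((trunc r z)\<^sup>2) * indicator E z \<partial>Q) \<le> ennreal v" "0 \<le> v"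
  shows "\<exists>bad\<in>events. prob bad \<le> 2 ^ p * (v / r\<^sup>2) \<and>
    (\<forall>\<omega>\<in>space P - bad. finite (\<Xi> \<omega> \<inter> E) \<longrightarrow> (\<forall>A\<in>insert (\<Union>(An n)) (An n). \<bar>Mr n A \<omega>\<bar> < 2 ^ p * r))"
proof -
  obtain \<phi> :: "'a set \<Rightarrow> nat \<Rightarrow> nat" where \<phi>: "\<And>A A'. A \<in> An n \<Longrightarrow> A' \<in> An n \<Longrightarrow> A \<subseteq> A' \<longleftrightarrow> (\<forall>i<p. \<phi> A i \<le> \<phi> A' i)"
    using p_adm unfolding admissible_dim_def order_embeds_nat_def by metis
  define L where "L B = B - \<Union>{A' \<in> An n. A' \<subset> B}" for B
  have L_iff: "s \<in> L X \<longleftrightarrow> s \<in> \<Union>(An n) \<and> PA n s = X" if "X \<in> An n" for s X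
    unfolding L_def by (rule left_nbhd_iff[OF that])
  have L_m: "L X \<in> sets m" if "X \<in> An n" for X
    unfolding L_def using that An_m by (intro sets.Diff sets.finite_Union) auto
  \<comment> \<open>Jumps truncated at \<open>r\<close> are rounded to multiples of
    \<open>1 / real (Suc n)\<close>, with numerators between \<open>-K\<close> and
    \<open>K\<close>.\<close>
  define K where "K = \<lceil>r * real (Suc n)\<rceil>"
  define J where "J = An n \<times> {-K..K}"
  define D where "D i = {z \<in> E. fst z \<in> L (fst i) \<and> rnd n (trunc r z) = snd i}" for i :: "'a set \<times> int"
  define c where "c i = real_of_int (snd i) / real (Suc n)" for i :: "'a set \<times> int"
  have J: "finite J" by (simp add: J_def)
  have D_Q: "D i \<in> sets Q" "emeasure Q (D i) < \<top>" if i: "i \<in> J" for i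
  proof -
    have Li: "L (fst i) \<in> sets m" using i by (intro L_m) (auto simp: J_def)
    have "D i = ((L (fst i) \<inter> B) \<times> tail e) \<inter> {z \<in> space Q. rnd n (trunc r z) = snd i}"
      using sets.sets_into_space[OF E_Q(1)] by (auto simp: D_def)
    also have "\<dots> \<in> sets Q" using Li B(1) by (intro sets.Int Q_Times_sets) (auto intro: tail_borel)
    finally show DQ: "D i \<in> sets Q" .
    have "emeasure Q (D i) \<le> emeasure Q E" using E_Q(1) by (intro emeasure_mono) (auto simp: D_def)
    then show "emeasure Q (D i) < \<top>" using E_Q(2) by (rule order.strict_trans1)
  qed
  have disj: "disjoint_family_on D J"
    unfolding disjoint_family_on_def
  proof (intro ballI impI)
    fix i i' assume ii: "i \<in> J" "i' \<in> J" "i \<noteq> i'"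
    have An: "fst i \<in> An n" "fst i' \<in> An n" using ii by (auto simp: J_def)
    have "i = i'" if "z \<in> D i" "z \<in> D i'" for z
      using that L_iff[OF An(1), of "fst z"] L_iff[OF An(2), of "fst z"] by (auto simp: D_def prod_eq_iff)
    then show "D i \<inter> D i' = {}" using ii(3) by auto
  qed
  define Z where "Z i \<omega> = c i * (real (card (\<Xi> \<omega> \<inter> D i)) - measure Q (D i))" for i \<omega>
  define bad where "bad = {\<omega>\<in>space P. \<exists>z. 2 ^ p * r \<le> \<bar>\<Sum>i\<in>{i\<in>J. \<forall>k<p. \<phi> (fst i) k \<le> z k}. Z i \<omega>\<bar>}"
  note max = compensated_sum_maximal_finite[where D = D and J = J and c = c and \<phi> = "\<lambda>i. \<phi> (fst i)" and p = p,
      OF J D_Q disj r, folded Z_def, folded bad_def]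
  \<comment> \<open>One pointwise identity serves twice: summed over the points it gives the random
    part of \<open>Mr\<close>, integrated against the intensity it gives the compensator.\<close>
  have pointwise: "(\<Sum>i\<in>{i\<in>J. fst i \<in> DD}. c i * indicator (D i) z) = indicator E z * (rtrunc n z * indicator {s\<in>\<Union>(An n). PA n s \<in> DD} (fst z))"
    if DD: "DD \<subseteq> An n" for DD z
  proof (cases "z \<in> E \<and> fst z \<in> \<Union>(An n) \<and> PA n (fst z) \<in> DD")
    case True
    let ?i = "(PA n (fst z), rnd n (trunc r z))"
    have iJ: "?i \<in> {i\<in>J. fst i \<in> DD}"
      using True PA_An[of "fst z" n] rnd_bounded[of "trunc r z" r n] trunc_le[of r z] r by (auto simp: J_def K_def)
    have "c i * indicator (D i) z = (if i = ?i then rtrunc n z else 0)" if "i \<in> {i\<in>J. fst i \<in> DD}" for i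
    proof -
      have "fst i \<in> An n" using that by (auto simp: J_def)
      from L_iff[OF this, of "fst z"] True show ?thesis
        by (auto simp: D_def c_def rtrunc_def indicator_def prod_eq_iff)
    qed
    then have "(\<Sum>i\<in>{i\<in>J. fst i \<in> DD}. c i * indicator (D i) z) = (\<Sum>i\<in>{i\<in>J. fst i \<in> DD}. if i = ?i then rtrunc n z else 0)"
      by (rule sum.cong[OF refl])
    also have "\<dots> = rtrunc n z" using iJ J by (subst sum.delta) auto
    finally show ?thesis using True by (auto simp: indicator_def)
  next
    case False
    have "c i * indicator (D i) z = 0" if "i \<in> {i\<in>J. fst i \<in> DD}" for i
    proof -
      have "fst i \<in> An n" using that by (auto simp: J_def)
      from L_iff[OF this, of "fst z"] False that show ?thesis by (auto simp: D_def indicator_def)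
    qed
    then show ?thesis using False by (auto simp: indicator_def intro!: sum.neutral)
  qed
  have D_int: "integrable Q (\<lambda>z. c i * indicator (D i) z)" if "i \<in> J" for i
    using D_Q[OF that] by (intro integrable_mult_right integrable_real_indicator) auto
  have sumZ: "(\<Sum>i\<in>{i\<in>J. fst i \<in> DD}. Z i \<omega>) = Mr n {s\<in>\<Union>(An n). PA n s \<in> DD} \<omega>"
    if DD: "DD \<subseteq> An n" and fin: "finite (\<Xi> \<omega> \<inter> E)" for DD \<omega>
  proof -
    let ?J = "{i\<in>J. fst i \<in> DD}"
    have card: "c i * real (card (\<Xi> \<omega> \<inter> D i)) = (\<Sum>z\<in>\<Xi> \<omega> \<inter> E. c i * indicator (D i) z)" for i
    proof -
      have "(\<Sum>z\<in>\<Xi> \<omega> \<inter> E. indicator (D i) z :: real) = real (card (\<Xi> \<omega> \<inter> E \<inter> D i))"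
        using fin by (simp add: indicator_def sum.If_cases Int_def)
      moreover have "\<Xi> \<omega> \<inter> E \<inter> D i = \<Xi> \<omega> \<inter> D i" by (auto simp: D_def)
      ultimately show ?thesis by (simp add: sum_distrib_left[symmetric])
    qed
    have "(\<Sum>i\<in>?J. c i * real (card (\<Xi> \<omega> \<inter> D i))) = (\<Sum>z\<in>\<Xi> \<omega> \<inter> E. \<Sum>i\<in>?J. c i * indicator (D i) z)"
      unfolding card by (rule sum.swap)
    also have "\<dots> = (\<Sum>z\<in>\<Xi> \<omega> \<inter> E. rtrunc n z * indicator {s\<in>\<Union>(An n). PA n s \<in> DD} (fst z))"
      unfolding pointwise[OF DD] by (intro sum.cong) auto
    finally have 1: "(\<Sum>i\<in>?J. c i * real (card (\<Xi> \<omega> \<inter> D i))) = \<dots>" .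
    have "(\<Sum>i\<in>?J. c i * measure Q (D i)) = (\<Sum>i\<in>?J. \<integral>z. c i * indicator (D i) z \<partial>Q)"
      using D_Q by (intro sum.cong) auto
    also have "\<dots> = (\<integral>z. (\<Sum>i\<in>?J. c i * indicator (D i) z) \<partial>Q)"
      by (rule Bochner_Integration.integral_sum[symmetric]) (rule D_int, simp)
    also have "\<dots> = (\<integral>z. indicator E z * (rtrunc n z * indicator {s\<in>\<Union>(An n). PA n s \<in> DD} (fst z)) \<partial>Q)"
      unfolding pointwise[OF DD] ..
    finally show ?thesis using 1 by (simp add: Z_def Mr_def right_diff_distrib sum_subtractf)
  qed
  have "(\<Sum>i\<in>J. (c i)\<^sup>2 * measure Q (D i)) \<le> v"
  proof -
    \<comment> \<open>At most one cell contains \<open>z\<close>, and rounding goes towards 0; so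
      the variance of the discretized sum does not exceed the bound for the truncated jumps.\<close>
    have sq: "(\<Sum>i\<in>J. (c i)\<^sup>2 * indicator (D i) z) \<le> (trunc r z)\<^sup>2 * indicator E z" for z
    proof (cases "\<exists>i\<in>J. z \<in> D i")
      case True
      then obtain i where i: "i \<in> J" "z \<in> D i" by auto
      have "(\<Sum>i\<in>J. (c i)\<^sup>2 * indicator (D i) z) = (\<Sum>i'\<in>J. if i' = i then (c i)\<^sup>2 else 0)"
        using i disj by (intro sum.cong) (auto simp: disjoint_family_on_def indicator_def)
      also have "\<dots> = (c i)\<^sup>2" using i J by simp
      also have "\<dots> = (rtrunc n z)\<^sup>2" using i by (simp add: D_def c_def rtrunc_def)
      also have "\<dots> \<le> (trunc r z)\<^sup>2" using rtrunc_le[of n z] by (simp add: abs_le_square_iff)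
      finally show ?thesis using i by (simp add: D_def)
    next
      case False
      then have "(\<Sum>i\<in>J. (c i)\<^sup>2 * indicator (D i) z) = 0" by (intro sum.neutral) auto
      then show ?thesis by simp
    qed
    have em: "emeasure Q (D i) = ennreal (measure Q (D i))" if "i \<in> J" for i
      using D_Q(2)[OF that] by (intro emeasure_eq_ennreal_measure) auto
    have "ennreal (\<Sum>i\<in>J. (c i)\<^sup>2 * measure Q (D i)) = (\<Sum>i\<in>J. ennreal ((c i)\<^sup>2) * emeasure Q (D i))"
      using D_Q by (subst sum_ennreal[symmetric]) (auto intro!: sum.cong simp: ennreal_mult em)
    also have "\<dots> = (\<integral>\<^sup>+z. (\<Sum>i\<in>J. ennreal ((c i)\<^sup>2) * indicator (D i) z) \<partial>Q)"
      using D_Q(1) by (subst nn_integral_sum) (auto simp: nn_integral_cmult_indicator)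
    also have "\<dots> \<le> (\<integral>\<^sup>+z. ennreal ((trunc r z)\<^sup>2) * indicator E z \<partial>Q)"
    proof (rule nn_integral_mono)
      fix z
      have "(\<Sum>i\<in>J. ennreal ((c i)\<^sup>2) * indicator (D i) z) = ennreal (\<Sum>i\<in>J. (c i)\<^sup>2 * indicator (D i) z)"
      proof -
        have "ennreal ((c i)\<^sup>2) * indicator (D i) z = ennreal ((c i)\<^sup>2 * indicator (D i) z)" for i
          by (simp add: indicator_def)
        then show ?thesis by (simp only:) (rule sum_ennreal, simp)
      qed
      also have "\<dots> \<le> ennreal ((trunc r z)\<^sup>2 * indicator E z)" by (intro ennreal_leI sq)
      also have "\<dots> = ennreal ((trunc r z)\<^sup>2) * indicator E z" by (simp add: indicator_def)
      finally show "(\<Sum>i\<in>J. ennreal ((c i)\<^sup>2) * indicator (D i) z) \<le> ennreal ((trunc r z)\<^sup>2) * indicator E z" .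
    qed
    also have "\<dots> \<le> ennreal v" by (rule v(1))
    finally show ?thesis using v(2) by (simp add: ennreal_le_iff)
  qed
  then have "2 ^ p * ((\<Sum>i\<in>J. (c i)\<^sup>2 * measure Q (D i)) / r\<^sup>2) \<le> 2 ^ p * (v / r\<^sup>2)"
    by (intro mult_left_mono divide_right_mono) auto
  moreover have "prob bad \<le> 2 ^ p * ((\<Sum>i\<in>J. (c i)\<^sup>2 * measure Q (D i)) / r\<^sup>2)" using max(1) by blast
  ultimately have "prob bad \<le> 2 ^ p * (v / r\<^sup>2)" by linarith
  moreover have "\<bar>Mr n A \<omega>\<bar> < 2 ^ p * r" if \<omega>: "\<omega> \<in> space P - bad" and fin: "finite (\<Xi> \<omega> \<inter> E)" and A: "A \<in> insert (\<Union>(An n)) (An n)" for \<omega> A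
  proof -
    define DD where "DD = {X\<in>An n. X \<subseteq> A}"
    have DD: "DD \<subseteq> An n" by (auto simp: DD_def)
    have eqA: "{s\<in>\<Union>(An n). PA n s \<in> DD} = A"
    proof
      show "{s\<in>\<Union>(An n). PA n s \<in> DD} \<subseteq> A"
      proof
        fix s assume s: "s \<in> {s\<in>\<Union>(An n). PA n s \<in> DD}"
        then have "s \<in> \<T>" using A_sub[OF An_A] by blast
        then show "s \<in> A" using s PA_in[of s n] by (auto simp: DD_def)
      qed
      show "A \<subseteq> {s\<in>\<Union>(An n). PA n s \<in> DD}"
      proof
        fix s assume s: "s \<in> A"
        then have cov: "s \<in> \<Union>(An n)" using A by auto
        have "PA n s \<subseteq> A" using PA_An[OF cov] PA_least[of A n s] A s by auto
        then show "s \<in> {s\<in>\<Union>(An n). PA n s \<in> DD}" using cov PA_An[OF cov] by (auto simp: DD_def)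
      qed
    qed
    have "\<exists>z. \<forall>X\<in>An n. X \<in> DD \<longleftrightarrow> (\<forall>k<p. \<phi> X k \<le> z k)"
    proof (cases "A \<in> An n")
      case True
      then show ?thesis using \<phi> by (intro exI[of _ "\<phi> A"]) (auto simp: DD_def)
    next
      case False
      then have "A = \<Union>(An n)" using A by auto
      then have "X \<in> DD" if "X \<in> An n" for X using that by (auto simp: DD_def)
      \<comment> \<open>The whole union of \<open>An n\<close> corresponds to no constraint at all;
        the sum over \<open>An n\<close> is a parameter that dominates every coordinate.\<close>
      moreover have "\<phi> X k \<le> (\<Sum>X\<in>An n. \<phi> X k)" if "X \<in> An n" for X k
        using that by (intro member_le_sum) auto
      ultimately show ?thesis by (intro exI[of _ "\<lambda>k. \<Sum>X\<in>An n. \<phi> X k"]) auto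
    qed
    then obtain z where z: "\<And>X. X \<in> An n \<Longrightarrow> X \<in> DD \<longleftrightarrow> (\<forall>k<p. \<phi> X k \<le> z k)" by auto
    then have "{i\<in>J. fst i \<in> DD} = {i\<in>J. \<forall>k<p. \<phi> (fst i) k \<le> z k}" by (auto simp: J_def)
    then have eqM: "(\<Sum>i\<in>{i\<in>J. \<forall>k<p. \<phi> (fst i) k \<le> z k}. Z i \<omega>) = Mr n A \<omega>"
      using sumZ[OF DD fin] unfolding eqA by simp
    have "\<not> 2 ^ p * r \<le> \<bar>\<Sum>i\<in>{i\<in>J. \<forall>k<p. \<phi> (fst i) k \<le> z k}. Z i \<omega>\<bar>"
      using \<omega> unfolding bad_def by blast
    then show ?thesis unfolding eqM by simp
  qed
  moreover have "bad \<in> events" using max(2) by blast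
  ultimately show ?thesis by (intro bexI[of _ bad]) auto
qed

text \<open>Let the grid and the approximation of \<open>A\<close> by \<open>An n\<close> be refined
  together. Indicators converge off \<open>residual\<close>, which has no mass and, on regular
  paths, no points. Outside the lim inf of the bad events infinitely many stages satisfy the bound,
  hence so does the limit.\<close>

lemma trunc_maximal:
  assumes v: "(\<integral>\<^sup>+z. ennreal ((trunc r z)\<^sup>2) * indicator E z \<partial>Q) \<le> ennreal v" "0 \<le> v"
  shows "\<exists>bad\<in>events. prob bad \<le> 2 ^ p * (v / r\<^sup>2) \<and>
    (\<forall>\<omega>\<in>space P - bad. regular \<omega> \<longrightarrow> finite (\<Xi> \<omega> \<inter> E) \<longrightarrow> (\<forall>A\<in>\<A>. \<bar>Mt A \<omega>\<bar> \<le> 2 ^ p * r))"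
proof -
  have "\<forall>n. \<exists>bad\<in>events. prob bad \<le> 2 ^ p * (v / r\<^sup>2) \<and>
    (\<forall>\<omega>\<in>space P - bad. finite (\<Xi> \<omega> \<inter> E) \<longrightarrow> (\<forall>A\<in>insert (\<Union>(An n)) (An n). \<bar>Mr n A \<omega>\<bar> < 2 ^ p * r))"
    using rounded_maximal[OF v] by auto
  then obtain bad where bad: "\<And>n. bad n \<in> events" "\<And>n. prob (bad n) \<le> 2 ^ p * (v / r\<^sup>2)"
    "\<And>n \<omega> A. \<omega> \<in> space P - bad n \<Longrightarrow> finite (\<Xi> \<omega> \<inter> E) \<Longrightarrow> A \<in> insert (\<Union>(An n)) (An n) \<Longrightarrow> \<bar>Mr n A \<omega>\<bar> < 2 ^ p * r"
    by metis
  have "\<bar>Mt A \<omega>\<bar> \<le> 2 ^ p * r"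
    if \<omega>: "\<omega> \<in> space P - (\<Union>N. \<Inter>n\<in>{N..}. bad n)" "regular \<omega>" "finite (\<Xi> \<omega> \<inter> E)" and A: "A \<in> \<A>" for \<omega> A
  proof -
    define A' where "A' n = hull_approx \<T> An n A \<inter> \<Union>(An n)" for n
    have A': "A' n \<in> insert (\<Union>(An n)) (An n)" for n
      using hull_An_T[OF A, of n] A_sub[OF An_A] by (auto simp: A'_def Int_absorb2 Sup_upper Int_absorb1 Sup_le_iff)
    have "\<Union>(An n) \<in> sets m" for n using An_m by (intro sets.finite_Union) auto
    then have A'm: "A' n \<in> sets m" for n using A'[of n] An_m by auto
    have ind: "(\<lambda>n. indicator (A' n) s :: real) \<longlonglongrightarrow> indicator A s" if "s \<in> \<T>" "s \<notin> residual" for s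
    proof (rule tendsto_eventually)
      have "s \<in> (\<Union>n. \<Union>(An n))" using that by (auto simp: residual_def)
      from hull_eventually[OF A this] show "\<forall>\<^sub>F n in sequentially. indicator (A' n) s = (indicator A s :: real)"
        by eventually_elim (auto simp: A'_def indicator_def)
    qed
    have "(\<lambda>n. \<Sum>z\<in>\<Xi> \<omega> \<inter> E. rtrunc n z * indicator (A' n) (fst z)) \<longlonglongrightarrow> (\<Sum>z\<in>\<Xi> \<omega> \<inter> E. trunc r z * indicator A (fst z))"
    proof (rule tendsto_sum)
      fix z assume z: "z \<in> \<Xi> \<omega> \<inter> E"
      then have "fst z \<in> \<T>" using sets.sets_into_space[OF B(1)] m_space by auto
      moreover have "fst z \<notin> residual" using z \<omega>(2) by (cases z) (auto simp: regular_def)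
      ultimately show "(\<lambda>n. rtrunc n z * indicator (A' n) (fst z)) \<longlonglongrightarrow> trunc r z * indicator A (fst z)"
        by (intro tendsto_mult rtrunc_tendsto ind)
    qed
    moreover have "(\<lambda>n. \<integral>z. indicator E z * (rtrunc n z * indicator (A' n) (fst z)) \<partial>Q) \<longlonglongrightarrow>
       (\<integral>z. indicator E z * (trunc r z * indicator A (fst z)) \<partial>Q)"
    proof (rule integral_dominated_convergence)
      show "integrable Q (\<lambda>z. indicator E z * r)" using r by (intro integrable_bounded_E) auto
      show "(\<lambda>z. indicator E z * (trunc r z * indicator A (fst z))) \<in> borel_measurable Q"
        using E_Q(1) A_m[OF A] by measurable
      show "(\<lambda>z. indicator E z * (rtrunc n z * indicator (A' n) (fst z))) \<in> borel_measurable Q" for n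
        using E_Q(1) A'm[of n] by measurable
      show "AE z in Q. norm (indicator E z * (rtrunc n z * indicator (A' n) (fst z))) \<le> indicator E z * r" for n
        using rtrunc_le_r r by (intro AE_I2) (auto simp: indicator_def)
      have "residual \<times> UNIV \<in> null_sets Q"
        using residual_m residual_null by (auto simp: null_sets_def Q_Times Q_Times_sets)
      from AE_not_in[OF this] show "AE z in Q. (\<lambda>n. indicator E z * (rtrunc n z * indicator (A' n) (fst z))) \<longlonglongrightarrow> indicator E z * (trunc r z * indicator A (fst z))"
        using AE_space
      proof eventually_elim
        case (elim z)
        then have "fst z \<in> \<T>" "fst z \<notin> residual" by (auto simp: space_pair_measure m_space)
        then show ?case by (intro tendsto_mult tendsto_const rtrunc_tendsto ind)
      qed
    qed
    ultimately have lim: "(\<lambda>n. Mr n (A' n) \<omega>) \<longlonglongrightarrow> Mt A \<omega>"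
      unfolding Mr_def Mt_def by (intro tendsto_diff)
    show ?thesis
    proof (rule ccontr)
      assume "\<not> \<bar>Mt A \<omega>\<bar> \<le> 2 ^ p * r"
      then have "\<forall>\<^sub>F n in sequentially. 2 ^ p * r < \<bar>Mr n (A' n) \<omega>\<bar>"
        by (intro order_tendstoD(1)[OF tendsto_rabs[OF lim]]) auto
      then obtain N where N: "\<And>n. n \<ge> N \<Longrightarrow> 2 ^ p * r < \<bar>Mr n (A' n) \<omega>\<bar>" by (auto simp: eventually_sequentially)
      obtain n where "n \<ge> N" "\<omega> \<notin> bad n" using \<omega>(1) by auto
      then show False using N[of n] bad(3)[OF _ \<omega>(3) A', of n] \<omega>(1) by auto
    qed
  qed
  then show ?thesis using prob_liminf_le[of bad, OF bad(1,2)] by (intro bexI[of _ "\<Union>N. \<Inter>n\<in>{N..}. bad n"]) auto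
qed

end

end

section \<open>The lower bound\<close>

lemma (in pair_sigma_finite) product_integral:
  fixes a :: "'a \<Rightarrow> real" and b :: "'b \<Rightarrow> real"
  assumes a: "integrable M1 a" and b: "integrable M2 b"
  shows "integrable (M1 \<Otimes>\<^sub>M M2) (\<lambda>z. a (fst z) * b (snd z))"
    and "(\<integral>z. a (fst z) * b (snd z) \<partial>(M1 \<Otimes>\<^sub>M M2)) = (\<integral>x. a x \<partial>M1) * (\<integral>y. b y \<partial>M2)"
proof -
  have [measurable]: "a \<in> borel_measurable M1" "b \<in> borel_measurable M2" using a b by auto
  show int: "integrable (M1 \<Otimes>\<^sub>M M2) (\<lambda>z. a (fst z) * b (snd z))"
  proof (rule Fubini_integrable)
    show "(\<lambda>z. a (fst z) * b (snd z)) \<in> borel_measurable (M1 \<Otimes>\<^sub>M M2)" by measurable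
    have "(\<lambda>x. \<integral>y. norm (a (fst (x, y)) * b (snd (x, y))) \<partial>M2) = (\<lambda>x. \<bar>a x\<bar> * (\<integral>y. \<bar>b y\<bar> \<partial>M2))"
      by (simp add: abs_mult)
    then show "integrable M1 (\<lambda>x. \<integral>y. norm (a (fst (x, y)) * b (snd (x, y))) \<partial>M2)" using a by simp
    show "AE x in M1. integrable M2 (\<lambda>y. a (fst (x, y)) * b (snd (x, y)))" using b by simp
  qed
  have "(\<integral>z. a (fst z) * b (snd z) \<partial>(M1 \<Otimes>\<^sub>M M2)) = (\<integral>x. (\<integral>y. a (fst (x, y)) * b (snd (x, y)) \<partial>M2) \<partial>M1)"
    using integral_fst'[OF int] by simp
  then show "(\<integral>z. a (fst z) * b (snd z) \<partial>(M1 \<Otimes>\<^sub>M M2)) = (\<integral>x. a x \<partial>M1) * (\<integral>y. b y \<partial>M2)" by simp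
qed

context levy_setting
begin

abbreviation "jump z \<equiv> f (fst z) * snd z"

lemma p_Suc: "p - 1 + 1 = p"
  using p_adm by (simp add: admissible_dim_def)

lemma filterlim_inverse_Suc: "filterlim (\<lambda>k. 1 / real (Suc k)) (at_right 0) sequentially"
  unfolding filterlim_at using LIMSEQ_inverse_real_of_nat by (auto simp: inverse_eq_divide)

text \<open>The truncated integrals converge to the increment, so a bound along infinitely many
  truncation levels is enough. This is what remains true outside a lim inf of bad events.\<close>

lemma DY_bound_frequently:
  assumes r: "regular \<omega>" and C: "C \<in> Cu" and bnd: "\<And>N. \<exists>k\<ge>N. \<bar>Ye (1 / real (Suc k)) C \<omega>\<bar> \<le> c"
  shows "\<bar>DY \<omega> C\<bar> \<le> c"
proof (rule ccontr)
  assume "\<not> \<bar>DY \<omega> C\<bar> \<le> c"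
  moreover have "(\<lambda>k. Ye (1 / real (Suc k)) C \<omega>) \<longlonglongrightarrow> DY \<omega> C"
    by (rule filterlim_compose[OF tendsto_Ye[OF r C] filterlim_inverse_Suc])
  ultimately have "\<forall>\<^sub>F k in sequentially. c < \<bar>Ye (1 / real (Suc k)) C \<omega>\<bar>"
    by (intro order_tendstoD(1)[OF tendsto_rabs]) auto
  then obtain N where "\<And>k. k \<ge> N \<Longrightarrow> c < \<bar>Ye (1 / real (Suc k)) C \<omega>\<bar>" by (auto simp: eventually_sequentially)
  then show False using bnd[of N] by fastforce
qed

text \<open>
  In what follows \<open>V\<close> bounds the \<open>\<delta>\<close>-th absolute moment of the jump intensity over \<open>B\<close>, and \<open>r\<close> is
  the truncation level of the jumps.
\<close>

lemma big_jumps: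
  assumes B: "B \<in> sets m" and r: "r > 0" and \<delta>: "\<delta> > 0"
    and V: "(\<integral>\<^sup>+z. ennreal (\<bar>jump z\<bar> powr \<delta>) * indicator (B \<times> UNIV) z \<partial>(m \<Otimes>\<^sub>M \<nu>)) \<le> ennreal V" "0 \<le> V"
  shows "\<exists>bad\<in>events. prob bad \<le> V / r powr \<delta> \<and>
    (\<forall>\<omega>\<in>space P - bad. \<forall>z\<in>\<Xi> \<omega>. fst z \<in> B \<longrightarrow> \<bar>jump z\<bar> \<le> r)"
proof -
  define G where "G = {z \<in> space (m \<Otimes>\<^sub>M \<nu>). r < \<bar>jump z\<bar>} \<inter> (B \<times> UNIV)"
  have BU[measurable]: "B \<times> UNIV \<in> sets (m \<Otimes>\<^sub>M \<nu>)" using B by (intro Q_Times_sets) auto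
  have G: "G \<in> sets (m \<Otimes>\<^sub>M \<nu>)" unfolding G_def by (intro sets.Int BU) measurable
  have "emeasure (m \<Otimes>\<^sub>M \<nu>) G = (\<integral>\<^sup>+z. indicator G z \<partial>(m \<Otimes>\<^sub>M \<nu>))" using G by simp
  also have "\<dots> \<le> (\<integral>\<^sup>+z. ennreal (1 / r powr \<delta>) * (ennreal (\<bar>jump z\<bar> powr \<delta>) * indicator (B \<times> UNIV) z) \<partial>(m \<Otimes>\<^sub>M \<nu>))"
  proof (rule nn_integral_mono)
    fix z
    show "indicator G z \<le> ennreal (1 / r powr \<delta>) * (ennreal (\<bar>jump z\<bar> powr \<delta>) * indicator (B \<times> UNIV) z)"
    proof (cases "z \<in> G")
      case True
      then have "r powr \<delta> \<le> \<bar>jump z\<bar> powr \<delta>" using r \<delta> by (intro powr_mono2) (auto simp: G_def)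
      then have "1 \<le> (1 / r powr \<delta>) * \<bar>jump z\<bar> powr \<delta>" using r by (simp add: pos_le_divide_eq)
      then have "ennreal 1 \<le> ennreal ((1 / r powr \<delta>) * \<bar>jump z\<bar> powr \<delta>)" by (rule ennreal_leI)
      then show ?thesis using True by (subst (asm) ennreal_mult) (auto simp: G_def)
    qed simp
  qed
  also have "\<dots> = ennreal (1 / r powr \<delta>) * (\<integral>\<^sup>+z. ennreal (\<bar>jump z\<bar> powr \<delta>) * indicator (B \<times> UNIV) z \<partial>(m \<Otimes>\<^sub>M \<nu>))"
    by (rule nn_integral_cmult) measurable
  also have "\<dots> \<le> ennreal (1 / r powr \<delta>) * ennreal V" using V by (intro mult_left_mono) auto
  also have "\<dots> = ennreal (V / r powr \<delta>)" using V by (subst ennreal_mult[symmetric]) auto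
  finally have "emeasure (m \<Otimes>\<^sub>M \<nu>) G \<le> ennreal (V / r powr \<delta>)" .
  with prob_points_exist(1)[OF G] have "emeasure P {\<omega> \<in> space P. \<Xi> \<omega> \<inter> G \<noteq> {}} \<le> ennreal (V / r powr \<delta>)"
    by (rule order_trans)
  then have "prob {\<omega> \<in> space P. \<Xi> \<omega> \<inter> G \<noteq> {}} \<le> V / r powr \<delta>"
    using V(2) by (simp add: emeasure_eq_measure ennreal_le_iff)
  moreover have "\<bar>jump z\<bar> \<le> r" if "\<omega> \<in> space P" "\<Xi> \<omega> \<inter> G = {}" "z \<in> \<Xi> \<omega>" "fst z \<in> B" for \<omega> z
  proof (rule ccontr)
    assume "\<not> \<bar>jump z\<bar> \<le> r"
    moreover have "z \<in> space (m \<Otimes>\<^sub>M \<nu>)" using points_space[OF that(1)] that(3) by auto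
    ultimately have "z \<in> G" using that(4) by (cases z) (auto simp: G_def)
    then show False using that by auto
  qed
  ultimately show ?thesis using prob_points_exist(2)[OF G]
    by (intro bexI[of _ "{\<omega> \<in> space P. \<Xi> \<omega> \<inter> G \<noteq> {}}"]) auto
qed

text \<open>Without compensator an increment is bounded by the sum of the absolute jumps. A jump
  \<open>y\<close> of size at most \<open>r\<close> satisfies \<open>\<bar>y\<bar> \<le> r powr (1 -
  \<delta>) * \<bar>y\<bar> powr \<delta>\<close> for \<delta> up to 1. By Campbell's formula the
  mean of the truncated sum is at most \<open>r powr (1 - \<delta>) * V\<close>, and Markov's
  inequality at level \<open>r\<close> gives the same \<open>V / r powr \<delta>\<close> as the
  large jumps.\<close>

lemma scale_summable:
  assumes ss: "summable_small_jumps \<nu>" and B: "B \<in> sets m" and r: "r > 0" and \<delta>: "0 < \<delta>" "\<delta> \<le> 1"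
    and V: "(\<integral>\<^sup>+z. ennreal (\<bar>jump z\<bar> powr \<delta>) * indicator (B \<times> UNIV) z \<partial>(m \<Otimes>\<^sub>M \<nu>)) \<le> ennreal V" "0 \<le> V"
  shows "\<exists>bad\<in>events. prob bad \<le> 2 * (V / r powr \<delta>) \<and>
    (\<forall>\<omega>\<in>space P - bad. regular \<omega> \<longrightarrow> (\<forall>C\<in>class_Ck \<A> (p - 1). C \<subseteq> B \<longrightarrow> \<bar>DY \<omega> C\<bar> \<le> r))"
proof -
  obtain bad1 where bad1: "bad1 \<in> events" "prob bad1 \<le> V / r powr \<delta>"
    "\<And>\<omega> z. \<omega> \<in> space P - bad1 \<Longrightarrow> z \<in> \<Xi> \<omega> \<Longrightarrow> fst z \<in> B \<Longrightarrow> \<bar>jump z\<bar> \<le> r"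
    using big_jumps[OF B r \<delta>(1) V] by blast
  have BU[measurable]: "B \<times> UNIV \<in> sets (m \<Otimes>\<^sub>M \<nu>)" using B by (intro Q_Times_sets) auto
  define h where "h z = ennreal \<bar>trunc r z\<bar> * indicator (B \<times> UNIV) z" for z
  have h[measurable]: "h \<in> borel_measurable (m \<Otimes>\<^sub>M \<nu>)" unfolding h_def by measurable
  define S where "S \<omega> = (\<integral>\<^sup>+z. h z \<partial>count_space (\<Xi> \<omega>))" for \<omega>
  have S: "S \<in> borel_measurable P" "(\<integral>\<^sup>+\<omega>. S \<omega> \<partial>P) = (\<integral>\<^sup>+z. h z \<partial>(m \<Otimes>\<^sub>M \<nu>))"
    unfolding S_def using campbell[OF h] by auto
  define bad2 where "bad2 = {\<omega>\<in>space P. 1 \<le> ennreal (1 / r) * S \<omega>}"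
  have bad2: "bad2 \<in> events" unfolding bad2_def using S(1) by measurable
  have "emeasure P bad2 \<le> ennreal (1 / r) * (\<integral>\<^sup>+\<omega>. S \<omega> * indicator (space P) \<omega> \<partial>P)"
    unfolding bad2_def using S(1) by (intro nn_integral_Markov_inequality) auto
  also have "(\<integral>\<^sup>+\<omega>. S \<omega> * indicator (space P) \<omega> \<partial>P) = (\<integral>\<^sup>+z. h z \<partial>(m \<Otimes>\<^sub>M \<nu>))"
    using S(2) by (simp cong: nn_integral_cong)
  also have "\<dots> \<le> (\<integral>\<^sup>+z. ennreal (r powr (1 - \<delta>)) * (ennreal (\<bar>jump z\<bar> powr \<delta>) * indicator (B \<times> UNIV) z) \<partial>(m \<Otimes>\<^sub>M \<nu>))"
  proof (rule nn_integral_mono)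
    fix z
    have "\<bar>trunc r z\<bar> \<le> r powr (1 - \<delta>) * \<bar>jump z\<bar> powr \<delta>"
    proof (cases "\<bar>jump z\<bar> \<le> r \<and> jump z \<noteq> 0")
      case True
      have "\<bar>jump z\<bar> = \<bar>jump z\<bar> powr (1 - \<delta>) * \<bar>jump z\<bar> powr \<delta>" using True by (simp add: powr_add[symmetric])
      also have "\<dots> \<le> r powr (1 - \<delta>) * \<bar>jump z\<bar> powr \<delta>"
        using True \<delta> by (intro mult_right_mono powr_mono2) auto
      finally show ?thesis using True by (simp add: trunc_def)
    qed (auto simp: trunc_def)
    then have "ennreal \<bar>trunc r z\<bar> \<le> ennreal (r powr (1 - \<delta>)) * ennreal (\<bar>jump z\<bar> powr \<delta>)"
      by (subst ennreal_mult[symmetric]) (auto intro: ennreal_leI)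
    then show "h z \<le> ennreal (r powr (1 - \<delta>)) * (ennreal (\<bar>jump z\<bar> powr \<delta>) * indicator (B \<times> UNIV) z)"
      by (simp add: h_def indicator_def)
  qed
  also have "\<dots> = ennreal (r powr (1 - \<delta>)) * (\<integral>\<^sup>+z. ennreal (\<bar>jump z\<bar> powr \<delta>) * indicator (B \<times> UNIV) z \<partial>(m \<Otimes>\<^sub>M \<nu>))"
    by (rule nn_integral_cmult) measurable
  also have "\<dots> \<le> ennreal (r powr (1 - \<delta>)) * ennreal V" using V by (intro mult_left_mono) auto
  also have "ennreal (1 / r) * (ennreal (r powr (1 - \<delta>)) * ennreal V) = ennreal (V / r powr \<delta>)"
    using V r by (simp add: ennreal_mult[symmetric] powr_diff)
  finally have "emeasure P bad2 \<le> ennreal (V / r powr \<delta>)" by (simp add: mult_left_mono)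
  then have pb2: "prob bad2 \<le> V / r powr \<delta>" using V(2) by (simp add: emeasure_eq_measure ennreal_le_iff)
  have "\<bar>DY \<omega> C\<bar> \<le> r"
    if \<omega>: "\<omega> \<in> space P - (bad1 \<union> bad2)" "regular \<omega>" and C: "C \<in> class_Ck \<A> (p - 1)" "C \<subseteq> B" for \<omega> C
  proof (rule DY_bound_frequently[OF \<omega>(2)])
    show CCu: "C \<in> Cu" using C Ck_sub_C C_in_Cu by blast
    fix N
    have "\<bar>Ye e C \<omega>\<bar> \<le> r" if e: "e > 0" for e
    proof -
      let ?F = "\<Xi> \<omega> \<inter> C \<times> tail e"
      have F: "finite ?F" by (rule regular_finite[OF \<omega>(2) CCu e])
      have "\<bar>Ye e C \<omega>\<bar> = \<bar>\<Sum>z\<in>?F. jump z\<bar>" using ss by (simp add: Ye_eq[OF F] comp_def)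
      also have "\<dots> \<le> (\<Sum>z\<in>?F. \<bar>jump z\<bar>)" by (rule sum_abs)
      finally have 1: "\<bar>Ye e C \<omega>\<bar> \<le> (\<Sum>z\<in>?F. \<bar>jump z\<bar>)" .
      have "ennreal (\<Sum>z\<in>?F. \<bar>jump z\<bar>) = (\<Sum>z\<in>?F. ennreal \<bar>jump z\<bar>)" by (rule sum_ennreal[symmetric]) simp
      also have "\<dots> = (\<Sum>z\<in>?F. h z)"
      proof (rule sum.cong[OF refl])
        fix z assume z: "z \<in> ?F"
        then have "z \<in> B \<times> UNIV" "fst z \<in> B" using C by auto
        moreover have "\<bar>jump z\<bar> \<le> r" using bad1(3)[of \<omega> z] \<omega>(1) z calculation(2) by auto
        ultimately show "ennreal \<bar>jump z\<bar> = h z" by (simp add: h_def trunc_def)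
      qed
      also have "\<dots> = (\<integral>\<^sup>+z. h z * indicator ?F z \<partial>count_space (\<Xi> \<omega>))"
        using F by (subst nn_integral_count_space'[where A = ?F]) auto
      also have "\<dots> \<le> S \<omega>" unfolding S_def by (intro nn_integral_mono) (auto simp: indicator_def)
      finally have 2: "ennreal (\<Sum>z\<in>?F. \<bar>jump z\<bar>) \<le> S \<omega>" .
      have "S \<omega> \<le> ennreal r"
      proof (rule ccontr)
        assume "\<not> S \<omega> \<le> ennreal r"
        then have "ennreal (1 / r) * ennreal r \<le> ennreal (1 / r) * S \<omega>" by (intro mult_left_mono) auto
        then have "1 \<le> ennreal (1 / r) * S \<omega>" using r by (simp add: ennreal_mult[symmetric])
        then show False using \<omega>(1) by (auto simp: bad2_def)
      qed
      with 2 have "ennreal (\<Sum>z\<in>?F. \<bar>jump z\<bar>) \<le> ennreal r" by (rule order_trans)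
      then show ?thesis using 1 r by (simp add: ennreal_le_iff)
    qed
    then show "\<exists>k\<ge>N. \<bar>Ye (1 / real (Suc k)) C \<omega>\<bar> \<le> r" by (intro exI[of _ N]) simp
  qed
  moreover have "prob (bad1 \<union> bad2) \<le> 2 * (V / r powr \<delta>)"
    using measure_Un_le[OF bad1(1) bad2] bad1(2) pb2 by simp
  ultimately show ?thesis using bad1(1) bad2 by (intro bexI[of _ "bad1 \<union> bad2"]) auto
qed

lemma Mt_additive:
  assumes B: "B \<in> sets m" "emeasure m B < \<top>" and r: "r > 0" and e: "e > 0"
    and UV: "U \<in> Cu" "V \<in> Cu" "U \<inter> V = {}"
  shows "Mt B r e (U \<union> V) \<omega> = Mt B r e U \<omega> + Mt B r e V \<omega>"
proof -
  have ind: "indicator (U \<union> V) s = (indicator U s + indicator V s :: real)" for s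
    using UV(3) by (auto simp: indicator_def)
  have int: "integrable (m \<Otimes>\<^sub>M \<nu>) (\<lambda>z. indicator (B \<times> tail e) z * (trunc r z * indicator W (fst z)))" if "W \<in> Cu" for W
  proof (rule integrable_bounded_E[OF B r e])
    show "(\<lambda>z. trunc r z * indicator W (fst z)) \<in> borel_measurable (m \<Otimes>\<^sub>M \<nu>)" using Cu_m[OF that] by measurable
    show "\<bar>trunc r z * indicator W (fst z)\<bar> \<le> r" for z using trunc_le[of r z] r by (simp add: indicator_def)
  qed
  show ?thesis unfolding Mt_def[OF B r e] ind
    by (simp add: distrib_left sum.distrib Bochner_Integration.integral_add[OF int[OF UV(1)] int[OF UV(2)]])
qed

text \<open>With no jump above \<open>r\<close> the random parts agree, so only the two compensators
  differ. They disagree on jumps above \<open>r\<close> with \<open>\<bar>x\<bar> \<le> 1\<close>,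
  which are at most \<open>r powr (1 - \<delta>) * \<bar>jump z\<bar> powr \<delta>\<close> because
  \<delta> is at least 1, and on jumps up to \<open>r\<close> with \<open>\<bar>x\<bar> > 1\<close>,
  a region of finite intensity.\<close>

lemma Ye_Mt:
  assumes ns: "\<not> summable_small_jumps \<nu>" and B: "B \<in> sets m" "emeasure m B < \<top>" and r: "r > 0" and e: "e > 0" and \<delta>: "1 \<le> \<delta>"
    and V: "(\<integral>\<^sup>+z. ennreal (\<bar>jump z\<bar> powr \<delta>) * indicator (B \<times> UNIV) z \<partial>(m \<Otimes>\<^sub>M \<nu>)) \<le> ennreal V" "0 \<le> V"
    and \<omega>: "regular \<omega>" "finite (\<Xi> \<omega> \<inter> B \<times> tail e)" "\<And>z. z \<in> \<Xi> \<omega> \<Longrightarrow> fst z \<in> B \<Longrightarrow> \<bar>jump z\<bar> \<le> r"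
    and C: "C \<in> Cu" "C \<subseteq> B"
  shows "\<bar>Ye e C \<omega> - Mt B r e C \<omega>\<bar> \<le> r powr (1 - \<delta>) * V + r * (measure m B * measure \<nu> (tail 1))"
proof -
  let ?Q = "m \<Otimes>\<^sub>M \<nu>"
  let ?E = "B \<times> tail e"
  let ?I = "{x::real. e \<le> \<bar>x\<bar> \<and> \<bar>x\<bar> \<le> 1}"
  have BU[measurable]: "B \<times> UNIV \<in> sets ?Q" using B by (intro Q_Times_sets) auto
  have BE[measurable]: "?E \<in> sets ?Q" using B by (intro Q_Times_sets) auto
  have Cm[measurable]: "C \<in> sets m" by (rule Cu_m[OF C(1)])
  define g where "g z = (indicator C (fst z) * f (fst z)) * (indicator ?I (snd z) * snd z)" for z
  have int_a: "integrable m (\<lambda>s. indicator C s * f s)"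
    using f_set_integrable[OF ns C(1)] by (simp add: set_integrable_def)
  have int_b: "integrable \<nu> (\<lambda>x. indicator ?I x * x)"
  proof (rule Bochner_Integration.integrable_bound)
    show "integrable \<nu> (indicator (tail e) :: real \<Rightarrow> real)" using nu_tail[OF e] nu_sets by (intro integrable_real_indicator) auto
    show "(\<lambda>x. indicator ?I x * x) \<in> borel_measurable \<nu>" by measurable
  qed (auto simp: indicator_def)
  have g_int: "integrable ?Q g" and g_eq: "(\<integral>z. g z \<partial>?Q) = comp e C"
    using mn.product_integral[OF int_a int_b] ns
    by (auto simp: g_def[abs_def] comp_def set_lebesgue_integral_def)
  define u where "u z = indicator ?E z * (trunc r z * indicator C (fst z))" for z
  have u_int: "integrable ?Q u"
    unfolding u_def
  proof (rule integrable_bounded_E[OF B r e])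
    show "(\<lambda>z. trunc r z * indicator C (fst z)) \<in> borel_measurable ?Q" by measurable
    show "\<bar>trunc r z * indicator C (fst z)\<bar> \<le> r" for z using trunc_le[of r z] r by (simp add: indicator_def)
  qed
  have "(\<Sum>z\<in>\<Xi> \<omega> \<inter> ?E. trunc r z * indicator C (fst z)) = (\<Sum>z\<in>\<Xi> \<omega> \<inter> C \<times> tail e. trunc r z * indicator C (fst z))"
    using \<omega>(2) C(2) by (intro sum.mono_neutral_right) (auto simp: indicator_def)
  also have "\<dots> = (\<Sum>z\<in>\<Xi> \<omega> \<inter> C \<times> tail e. jump z)"
  proof (rule sum.cong[OF refl])
    fix z assume z: "z \<in> \<Xi> \<omega> \<inter> C \<times> tail e"
    then have "\<bar>jump z\<bar> \<le> r" using \<omega>(3)[of z] C(2) by auto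
    then show "trunc r z * indicator C (fst z) = jump z" using z by (auto simp: trunc_def)
  qed
  finally have "Ye e C \<omega> - Mt B r e C \<omega> = (\<integral>z. u z \<partial>?Q) - (\<integral>z. g z \<partial>?Q)"
    using Ye_eq[OF regular_finite[OF \<omega>(1) C(1) e]] by (simp add: Mt_def[OF B r e] g_eq u_def)
  also have "\<dots> = (\<integral>z. u z - g z \<partial>?Q)" using u_int g_int by simp
  finally have eq: "Ye e C \<omega> - Mt B r e C \<omega> = (\<integral>z. u z - g z \<partial>?Q)" .
  have pw: "\<bar>u z - g z\<bar> \<le> (r powr (1 - \<delta>) * \<bar>jump z\<bar> powr \<delta>) * indicator (B \<times> UNIV) z + r * indicator (B \<times> tail 1) z" for z
  proof (cases "fst z \<in> C \<and> e \<le> \<bar>snd z\<bar>")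
    case True
    then have inB: "z \<in> B \<times> UNIV" "z \<in> ?E" using C(2) by (cases z; auto)+
    have big: "\<bar>jump z\<bar> \<le> r powr (1 - \<delta>) * \<bar>jump z\<bar> powr \<delta>" if "r < \<bar>jump z\<bar>"
    proof -
      have "\<bar>jump z\<bar> = \<bar>jump z\<bar> powr (1 - \<delta>) * \<bar>jump z\<bar> powr \<delta>" using that r by (simp add: powr_add[symmetric])
      also have "\<dots> \<le> r powr (1 - \<delta>) * \<bar>jump z\<bar> powr \<delta>"
        using that r \<delta> by (intro mult_right_mono powr_mono2') auto
      finally show ?thesis .
    qed
    have nn: "0 \<le> r powr (1 - \<delta>) * \<bar>jump z\<bar> powr \<delta>" by simp
    have uz: "u z = trunc r z" using True inB by (simp add: u_def)
    have gz: "g z = (if \<bar>snd z\<bar> \<le> 1 then jump z else 0)" using True by (simp add: g_def)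
    have t1: "z \<in> B \<times> tail 1" if "\<not> \<bar>snd z\<bar> \<le> 1" using inB that by (cases z) auto
    have "\<bar>u z - g z\<bar> \<le> r powr (1 - \<delta>) * \<bar>jump z\<bar> powr \<delta> + r * indicator (B \<times> tail 1) z"
    proof (cases "\<bar>jump z\<bar> \<le> r")
      case True
      show ?thesis
      proof (cases "\<bar>snd z\<bar> \<le> 1")
        case True
        then have "u z - g z = 0" using \<open>\<bar>jump z\<bar> \<le> r\<close> by (simp add: uz gz trunc_def)
        then show ?thesis using nn r by (simp add: indicator_def)
      next
        case False
        then have "\<bar>u z - g z\<bar> \<le> r * indicator (B \<times> tail 1) z"
          using \<open>\<bar>jump z\<bar> \<le> r\<close> t1 by (simp add: uz gz trunc_def)
        then show ?thesis using nn by linarith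
      qed
    next
      case False
      then have "\<bar>u z - g z\<bar> \<le> r powr (1 - \<delta>) * \<bar>jump z\<bar> powr \<delta>"
        using big nn by (auto simp: uz gz trunc_def)
      moreover have "0 \<le> r * indicator (B \<times> tail 1) z" using r by simp
      ultimately show ?thesis by linarith
    qed
    then show ?thesis using inB by simp
  next
    case False
    then have "u z = 0" "g z = 0" by (cases z; auto simp: u_def g_def indicator_def)+
    then show ?thesis using r by (simp add: indicator_def)
  qed
  have "ennreal (norm (\<integral>z. u z - g z \<partial>?Q)) \<le> (\<integral>\<^sup>+z. ennreal (norm (u z - g z)) \<partial>?Q)"
    using u_int g_int by (intro integral_norm_bound_ennreal) auto
  also have "\<dots> \<le> (\<integral>\<^sup>+z. ennreal (r powr (1 - \<delta>)) * (ennreal (\<bar>jump z\<bar> powr \<delta>) * indicator (B \<times> UNIV) z) + ennreal r * indicator (B \<times> tail 1) z \<partial>?Q)"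
  proof (rule nn_integral_mono)
    fix z
    have "ennreal (norm (u z - g z)) \<le> ennreal ((r powr (1 - \<delta>) * \<bar>jump z\<bar> powr \<delta>) * indicator (B \<times> UNIV) z + r * indicator (B \<times> tail 1) z)"
      using pw[of z] by (intro ennreal_leI) simp
    also have "\<dots> = ennreal (r powr (1 - \<delta>)) * (ennreal (\<bar>jump z\<bar> powr \<delta>) * indicator (B \<times> UNIV) z) + ennreal r * indicator (B \<times> tail 1) z"
      using r by (simp add: indicator_def ennreal_plus[symmetric] ennreal_mult[symmetric] del: ennreal_plus)
    finally show "ennreal (norm (u z - g z)) \<le> \<dots>" .
  qed
  also have "\<dots> = ennreal (r powr (1 - \<delta>)) * (\<integral>\<^sup>+z. ennreal (\<bar>jump z\<bar> powr \<delta>) * indicator (B \<times> UNIV) z \<partial>?Q) + ennreal r * emeasure ?Q (B \<times> tail 1)"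
  proof -
    have "B \<times> tail 1 \<in> sets ?Q" using B by (intro Q_Times_sets) auto
    then show ?thesis by (subst nn_integral_add) (auto simp: nn_integral_cmult nn_integral_cmult_indicator)
  qed
  also have "\<dots> \<le> ennreal (r powr (1 - \<delta>)) * ennreal V + ennreal r * emeasure ?Q (B \<times> tail 1)"
    using V by (intro add_right_mono mult_left_mono) auto
  also have "emeasure ?Q (B \<times> tail 1) = ennreal (measure m B * measure \<nu> (tail 1))"
    using B nu_tail[of 1] by (simp add: Q_Times emeasure_eq_ennreal_measure ennreal_mult)
  also have "ennreal (r powr (1 - \<delta>)) * ennreal V + ennreal r * ennreal (measure m B * measure \<nu> (tail 1)) =
     ennreal (r powr (1 - \<delta>) * V + r * (measure m B * measure \<nu> (tail 1)))"
    using r V by (simp add: ennreal_mult)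
  finally show ?thesis unfolding eq using r V by (subst (asm) ennreal_le_iff) auto
qed

text \<open>The maximal inequality loses \<open>2 ^ p\<close> in the level and in the probability.
  Passing from \<open>\<A>\<close> to differences loses a further \<open>2 ^ p\<close> in the level,
  and the exchange of compensators adds the remaining terms.\<close>

lemma scale_compensated:
  assumes ns: "\<not> summable_small_jumps \<nu>" and B: "B \<in> sets m" "emeasure m B < \<top>" and r: "r > 0" and \<delta>: "1 \<le> \<delta>" "\<delta> \<le> 2"
    and V: "(\<integral>\<^sup>+z. ennreal (\<bar>jump z\<bar> powr \<delta>) * indicator (B \<times> UNIV) z \<partial>(m \<Otimes>\<^sub>M \<nu>)) \<le> ennreal V" "0 \<le> V"
  shows "\<exists>bad\<in>events. prob bad \<le> (1 + 2 ^ p) * (V / r powr \<delta>) \<and>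
    (AE \<omega> in P. \<omega> \<notin> bad \<longrightarrow> (\<forall>C\<in>class_Ck \<A> (p - 1). C \<subseteq> B \<longrightarrow>
      \<bar>DY \<omega> C\<bar> \<le> 2 ^ p * (2 ^ p * r) + (r powr (1 - \<delta>) * V + r * (measure m B * measure \<nu> (tail 1)))))"
proof -
  let ?Q = "m \<Otimes>\<^sub>M \<nu>"
  let ?e = "\<lambda>k. 1 / real (Suc k)"
  let ?D = "r powr (1 - \<delta>) * V + r * (measure m B * measure \<nu> (tail 1))"
  have \<delta>0: "\<delta> > 0" using \<delta> by simp
  obtain bad1 where bad1: "bad1 \<in> events" "prob bad1 \<le> V / r powr \<delta>"
    "\<And>\<omega> z. \<omega> \<in> space P - bad1 \<Longrightarrow> z \<in> \<Xi> \<omega> \<Longrightarrow> fst z \<in> B \<Longrightarrow> \<bar>jump z\<bar> \<le> r"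
    using big_jumps[OF B(1) r \<delta>0 V] by blast
  have BU[measurable]: "B \<times> UNIV \<in> sets ?Q" using B by (intro Q_Times_sets) auto
  \<comment> \<open>For \<delta> up to 2 the square of a jump of size at most \<open>r\<close> is
    bounded by \<open>r powr (2 - \<delta>)\<close> times its \<delta>-th power. Dividing by
    \<open>r\<^sup>2\<close> brings the variance back to \<open>V / r powr \<delta>\<close>.\<close>
  define v where "v = r powr (2 - \<delta>) * V"
  have v0: "v \<ge> 0" using V by (simp add: v_def)
  have v: "(\<integral>\<^sup>+z. ennreal ((trunc r z)\<^sup>2) * indicator (B \<times> tail e) z \<partial>?Q) \<le> ennreal v" for e
  proof -
    have "(\<integral>\<^sup>+z. ennreal ((trunc r z)\<^sup>2) * indicator (B \<times> tail e) z \<partial>?Q) \<le>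
      (\<integral>\<^sup>+z. ennreal (r powr (2 - \<delta>)) * (ennreal (\<bar>jump z\<bar> powr \<delta>) * indicator (B \<times> UNIV) z) \<partial>?Q)"
    proof (rule nn_integral_mono)
      fix z
      have "(trunc r z)\<^sup>2 \<le> r powr (2 - \<delta>) * \<bar>jump z\<bar> powr \<delta>"
      proof (cases "\<bar>jump z\<bar> \<le> r \<and> jump z \<noteq> 0")
        case True
        have "(jump z)\<^sup>2 = \<bar>jump z\<bar> powr 2" using True by simp
        also have "\<dots> = \<bar>jump z\<bar> powr (2 - \<delta>) * \<bar>jump z\<bar> powr \<delta>" by (simp add: powr_add[symmetric])
        also have "\<dots> \<le> r powr (2 - \<delta>) * \<bar>jump z\<bar> powr \<delta>"
          using True \<delta> by (intro mult_right_mono powr_mono2) auto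
        finally show ?thesis using True by (simp add: trunc_def)
      qed (auto simp: trunc_def)
      then have "ennreal ((trunc r z)\<^sup>2) \<le> ennreal (r powr (2 - \<delta>)) * ennreal (\<bar>jump z\<bar> powr \<delta>)"
        by (subst ennreal_mult[symmetric]) (auto intro: ennreal_leI)
      then show "ennreal ((trunc r z)\<^sup>2) * indicator (B \<times> tail e) z \<le> ennreal (r powr (2 - \<delta>)) * (ennreal (\<bar>jump z\<bar> powr \<delta>) * indicator (B \<times> UNIV) z)"
        by (cases z) (auto simp: indicator_def)
    qed
    also have "\<dots> = ennreal (r powr (2 - \<delta>)) * (\<integral>\<^sup>+z. ennreal (\<bar>jump z\<bar> powr \<delta>) * indicator (B \<times> UNIV) z \<partial>?Q)"
      by (rule nn_integral_cmult) measurable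
    also have "\<dots> \<le> ennreal (r powr (2 - \<delta>)) * ennreal V" using V by (intro mult_left_mono) auto
    finally show ?thesis using V by (simp add: v_def ennreal_mult)
  qed
  have vr: "v / r\<^sup>2 = V / r powr \<delta>" using r by (simp add: v_def powr_diff field_simps)
  have "\<forall>k. \<exists>bad\<in>events. prob bad \<le> 2 ^ p * (v / r\<^sup>2) \<and>
    (\<forall>\<omega>\<in>space P - bad. regular \<omega> \<longrightarrow> finite (\<Xi> \<omega> \<inter> B \<times> tail (?e k)) \<longrightarrow> (\<forall>A\<in>\<A>. \<bar>Mt B r (?e k) A \<omega>\<bar> \<le> 2 ^ p * r))"
    using trunc_maximal[OF B r _ v v0] by auto
  then obtain bad where bad: "\<And>k. bad k \<in> events" "\<And>k. prob (bad k) \<le> 2 ^ p * (v / r\<^sup>2)"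
    "\<And>k \<omega> A. \<omega> \<in> space P - bad k \<Longrightarrow> regular \<omega> \<Longrightarrow> finite (\<Xi> \<omega> \<inter> B \<times> tail (?e k)) \<Longrightarrow> A \<in> \<A> \<Longrightarrow> \<bar>Mt B r (?e k) A \<omega>\<bar> \<le> 2 ^ p * r"
    by metis
  \<comment> \<open>The bad event depends on the truncation level; as before, the lim inf over the
    levels is discarded.\<close>
  define bad2 where "bad2 = (\<Union>N. \<Inter>k\<in>{N..}. bad k)"
  have bad2: "bad2 \<in> events" "prob bad2 \<le> 2 ^ p * (V / r powr \<delta>)"
    unfolding bad2_def using prob_liminf_le[of bad, OF bad(1,2)] vr by auto
  have fin: "AE \<omega> in P. \<forall>k. finite (\<Xi> \<omega> \<inter> B \<times> tail (?e k))"
    unfolding AE_all_countable using finite_points_tail[OF B] by auto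
  have "AE \<omega> in P. \<omega> \<notin> bad1 \<union> bad2 \<longrightarrow> (\<forall>C\<in>class_Ck \<A> (p - 1). C \<subseteq> B \<longrightarrow> \<bar>DY \<omega> C\<bar> \<le> 2 ^ p * (2 ^ p * r) + ?D)"
    using fin AE_regular AE_space
  proof eventually_elim
    case (elim \<omega>)
    show ?case
    proof (intro impI ballI)
      fix C assume \<omega>: "\<omega> \<notin> bad1 \<union> bad2" and C: "C \<in> class_Ck \<A> (p - 1)" "C \<subseteq> B"
      have CCu: "C \<in> Cu" using C Ck_sub_C C_in_Cu by blast
      show "\<bar>DY \<omega> C\<bar> \<le> 2 ^ p * (2 ^ p * r) + ?D"
      proof (rule DY_bound_frequently[OF elim(2) CCu])
        fix N
        obtain k where k: "k \<ge> N" "\<omega> \<notin> bad k" using \<omega> by (auto simp: bad2_def)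
        have e: "?e k > 0" by simp
        obtain A0 where A0: "A0 \<in> \<A>" "C \<subseteq> A0" using C(1) unfolding class_Ck_def by auto
        have "\<bar>Mt B r (?e k) C \<omega>\<bar> \<le> 2 ^ (p - 1 + 1) * (2 ^ p * r)"
        proof (rule Ck_bound[OF _ _ A0(1) C(1) A0(2)])
          show "Mt B r (?e k) (U \<union> V) \<omega> = Mt B r (?e k) U \<omega> + Mt B r (?e k) V \<omega>" if "U \<in> Cu" "V \<in> Cu" "U \<inter> V = {}" for U V
            by (rule Mt_additive[OF B r e that])
          show "\<bar>Mt B r (?e k) A \<omega>\<bar> \<le> 2 ^ p * r" if "A \<in> \<A>" for A
            using bad(3)[of \<omega> k A] k(2) elim that by auto
        qed
        then have "\<bar>Mt B r (?e k) C \<omega>\<bar> \<le> 2 ^ p * (2 ^ p * r)" unfolding p_Suc .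
        moreover have "\<bar>Ye (?e k) C \<omega> - Mt B r (?e k) C \<omega>\<bar> \<le> ?D"
        proof (rule Ye_Mt[OF ns B r e \<delta>(1) V elim(2) _ _ CCu C(2)])
          show "finite (\<Xi> \<omega> \<inter> B \<times> tail (?e k))" using elim(1) by blast
          show "\<bar>jump z\<bar> \<le> r" if "z \<in> \<Xi> \<omega>" "fst z \<in> B" for z using bad1(3)[of \<omega> z] \<omega> elim(3) that by auto
        qed
        ultimately have "\<bar>Ye (?e k) C \<omega>\<bar> \<le> 2 ^ p * (2 ^ p * r) + ?D" by linarith
        then show "\<exists>k\<ge>N. \<bar>Ye (?e k) C \<omega>\<bar> \<le> 2 ^ p * (2 ^ p * r) + ?D" using k(1) by blast
      qed
    qed
  qed
  moreover have "prob (bad1 \<union> bad2) \<le> (1 + 2 ^ p) * (V / r powr \<delta>)"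
    using measure_Un_le[OF bad1(1) bad2(1)] bad1(2) bad2(2) unfolding distrib_right mult_1_left by linarith
  ultimately show ?thesis using bad1(1) bad2(1) by (intro bexI[of _ "bad1 \<union> bad2"]) auto
qed

end

lemma dyadic_bracket:
  assumes "0 < x" "x \<le> (1::real)"
  shows "\<exists>k. (1 / 2) ^ Suc k < x \<and> x \<le> (1 / 2) ^ k"
proof -
  obtain n where n: "(1 / 2) ^ n < x" using real_arch_pow_inv[OF assms(1), of "1 / 2"] by auto
  define l where "l = (LEAST n. (1 / 2) ^ n < x)"
  have l: "(1 / 2) ^ l < x" unfolding l_def by (rule LeastI) (rule n)
  have "l \<noteq> 0" using l assms(2) by (intro notI) simp
  then obtain k where k: "l = Suc k" using not0_implies_Suc by blast
  have "\<not> (1 / 2) ^ k < x" using not_less_Least[of k "\<lambda>n. (1 / 2) ^ n < x"] k by (simp add: l_def)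
  then show ?thesis using l k by (intro exI[of _ k]) simp
qed

text \<open>This makes room for a moment exponent slightly above \<beta>, at which the integral of
  small jumps is finite.\<close>

lemma linear_less_near:
  fixes c b q :: real
  assumes "c * b < q"
  shows "\<exists>h>0. \<forall>\<delta>. b \<le> \<delta> \<and> \<delta> < b + h \<longrightarrow> c * \<delta> < q"
proof (cases "c \<le> 0")
  case True
  have "c * \<delta> < q" if "b \<le> \<delta>" for \<delta> using mult_left_mono_neg[OF that True] assms by linarith
  then show ?thesis by (intro exI[of _ 1]) auto
next
  case False
  have "c * \<delta> < q" if "\<delta> < b + (q - c * b) / c" for \<delta>
    using mult_strict_left_mono[OF that, of c] False by (simp add: distrib_left)
  then show ?thesis using False assms by (intro exI[of _ "(q - c * b) / c"]) auto
qed

context levy_setting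
begin

section \<open>Moments of the jumps over small balls and dyadic radii\<close>

lemma jump_moment:
  assumes B: "B \<in> sets m"
  shows "(\<integral>\<^sup>+z. ennreal (\<bar>jump z\<bar> powr \<delta>) * indicator (B \<times> UNIV) z \<partial>(m \<Otimes>\<^sub>M \<nu>)) =
    (\<integral>\<^sup>+s\<in>B. ennreal (\<bar>f s\<bar> powr \<delta>) \<partial>m) * (\<integral>\<^sup>+x. ennreal (\<bar>x\<bar> powr \<delta>) \<partial>\<nu>)"
proof -
  note [measurable] = B
  have BU[measurable]: "B \<times> UNIV \<in> sets (m \<Otimes>\<^sub>M \<nu>)" using B by (intro Q_Times_sets) auto
  have "(\<integral>\<^sup>+z. ennreal (\<bar>jump z\<bar> powr \<delta>) * indicator (B \<times> UNIV) z \<partial>(m \<Otimes>\<^sub>M \<nu>)) =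
     (\<integral>\<^sup>+s. \<integral>\<^sup>+x. ennreal (\<bar>jump (s, x)\<bar> powr \<delta>) * indicator (B \<times> UNIV) (s, x) \<partial>\<nu> \<partial>m)"
    by (rule nu.nn_integral_fst[symmetric]) measurable
  also have "\<dots> = (\<integral>\<^sup>+s. (ennreal (\<bar>f s\<bar> powr \<delta>) * indicator B s) * (\<integral>\<^sup>+x. ennreal (\<bar>x\<bar> powr \<delta>) \<partial>\<nu>) \<partial>m)"
  proof (rule nn_integral_cong)
    fix s
    have "(\<integral>\<^sup>+x. ennreal (\<bar>jump (s, x)\<bar> powr \<delta>) * indicator (B \<times> UNIV) (s, x) \<partial>\<nu>) =
      (\<integral>\<^sup>+x. (ennreal (\<bar>f s\<bar> powr \<delta>) * indicator B s) * ennreal (\<bar>x\<bar> powr \<delta>) \<partial>\<nu>)"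
      by (intro nn_integral_cong) (simp add: abs_mult powr_mult ennreal_mult indicator_def)
    then show "(\<integral>\<^sup>+x. ennreal (\<bar>jump (s, x)\<bar> powr \<delta>) * indicator (B \<times> UNIV) (s, x) \<partial>\<nu>) =
      (ennreal (\<bar>f s\<bar> powr \<delta>) * indicator B s) * (\<integral>\<^sup>+x. ennreal (\<bar>x\<bar> powr \<delta>) \<partial>\<nu>)"
      by (simp add: nn_integral_cmult)
  qed
  also have "\<dots> = (\<integral>\<^sup>+s\<in>B. ennreal (\<bar>f s\<bar> powr \<delta>) \<partial>m) * (\<integral>\<^sup>+x. ennreal (\<bar>x\<bar> powr \<delta>) \<partial>\<nu>)"
    by (intro nn_integral_multc) measurable
  finally show ?thesis .
qed

text \<open>Common form of the two cases. The term \<open>r powr (1 - \<delta>) * V\<close> equals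
  \<open>(V / r powr \<delta>) * r\<close>, so every contribution is a multiple of
  \<open>r\<close>.\<close>

lemma scale:
  assumes B: "B \<in> sets m" "emeasure m B < \<top>" and r: "r > 0" and \<delta>: "0 < \<delta>" "\<delta> \<le> 2"
    and ss: "summable_small_jumps \<nu> \<Longrightarrow> \<delta> \<le> 1" "\<not> summable_small_jumps \<nu> \<Longrightarrow> 1 \<le> \<delta>"
    and V: "(\<integral>\<^sup>+z. ennreal (\<bar>jump z\<bar> powr \<delta>) * indicator (B \<times> UNIV) z \<partial>(m \<Otimes>\<^sub>M \<nu>)) \<le> ennreal V" "0 \<le> V"
  shows "\<exists>bad\<in>events. prob bad \<le> (2 + 2 ^ p) * (V / r powr \<delta>) \<and>
    (AE \<omega> in P. \<omega> \<notin> bad \<longrightarrow> (\<forall>C\<in>class_Ck \<A> (p - 1). C \<subseteq> B \<longrightarrow>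
      \<bar>DY \<omega> C\<bar> \<le> (2 ^ p * 2 ^ p + V / r powr \<delta> + measure m B * measure \<nu> (tail 1)) * r))"
proof -
  let ?K = "2 ^ p * 2 ^ p + V / r powr \<delta> + measure m B * measure \<nu> (tail 1)"
  have Vr: "0 \<le> V / r powr \<delta>" using V by simp
  have mm: "0 \<le> measure m B * measure \<nu> (tail 1)" by simp
  show ?thesis
  proof (cases "summable_small_jumps \<nu>")
    case True
    obtain bad where bad: "bad \<in> events" "prob bad \<le> 2 * (V / r powr \<delta>)"
      "\<And>\<omega> C. \<omega> \<in> space P - bad \<Longrightarrow> regular \<omega> \<Longrightarrow> C \<in> class_Ck \<A> (p - 1) \<Longrightarrow> C \<subseteq> B \<Longrightarrow> \<bar>DY \<omega> C\<bar> \<le> r"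
      using scale_summable[OF True B(1) r \<delta>(1) ss(1)[OF True] V] by blast
    have "(1::real) \<le> 2 ^ p * 2 ^ p" unfolding power_mult_distrib[symmetric] by simp
    then have "1 \<le> ?K" using Vr mm by linarith
    then have "1 * r \<le> ?K * r" using r by (intro mult_right_mono) auto
    then have rK: "r \<le> ?K * r" by simp
    have "AE \<omega> in P. \<omega> \<notin> bad \<longrightarrow> (\<forall>C\<in>class_Ck \<A> (p - 1). C \<subseteq> B \<longrightarrow> \<bar>DY \<omega> C\<bar> \<le> ?K * r)"
      using AE_regular AE_space
    proof eventually_elim
      case (elim \<omega>)
      show ?case
      proof (intro impI ballI)
        fix C assume "\<omega> \<notin> bad" "C \<in> class_Ck \<A> (p - 1)" "C \<subseteq> B"
        then have "\<bar>DY \<omega> C\<bar> \<le> r" using bad(3) elim by simp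
        then show "\<bar>DY \<omega> C\<bar> \<le> ?K * r" using rK by linarith
      qed
    qed
    moreover have "2 * (V / r powr \<delta>) \<le> (2 + 2 ^ p) * (V / r powr \<delta>)"
      using Vr by (intro mult_right_mono) auto
    ultimately show ?thesis using bad(1,2) by (intro bexI[of _ bad]) auto
  next
    case False
    obtain bad where bad: "bad \<in> events" "prob bad \<le> (1 + 2 ^ p) * (V / r powr \<delta>)"
      "AE \<omega> in P. \<omega> \<notin> bad \<longrightarrow> (\<forall>C\<in>class_Ck \<A> (p - 1). C \<subseteq> B \<longrightarrow>
        \<bar>DY \<omega> C\<bar> \<le> 2 ^ p * (2 ^ p * r) + (r powr (1 - \<delta>) * V + r * (measure m B * measure \<nu> (tail 1))))"
      using scale_compensated[OF False B r ss(2)[OF False] \<delta>(2) V] by blast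
    have "2 ^ p * (2 ^ p * r) + (r powr (1 - \<delta>) * V + r * (measure m B * measure \<nu> (tail 1))) = ?K * r"
      using r by (simp add: powr_diff algebra_simps)
    then have "AE \<omega> in P. \<omega> \<notin> bad \<longrightarrow> (\<forall>C\<in>class_Ck \<A> (p - 1). C \<subseteq> B \<longrightarrow> \<bar>DY \<omega> C\<bar> \<le> ?K * r)"
      using bad(3) by simp
    moreover have "(1 + 2 ^ p) * (V / r powr \<delta>) \<le> (2 + 2 ^ p) * (V / r powr \<delta>)"
      using Vr by (intro mult_right_mono) auto
    ultimately show ?thesis using bad(1,2) by (intro bexI[of _ bad]) auto
  qed
qed

text \<open>On the large set the local bound on \<open>f\<close> leaves only its measure, of order
  \<open>\<rho> powr q\<close>. Off it \<open>\<bar>f s\<bar>\<close> is at most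
  \<open>\<rho> powr \<alpha>\<close>, which multiplies the measure \<open>\<rho> powr q'\<close> by
  \<open>\<rho> powr (\<alpha> * \<delta>)\<close>. The smaller exponent wins as \<rho> is below
  1.\<close>

lemma ball_moment:
  assumes reg: "(\<alpha>, q, q') \<in> lower_region \<T> An d m f t" and \<rho>0: "\<rho>\<^sub>0 > 0"
    and Mf: "\<And>s. s \<in> point_ball \<T> An d t \<rho>\<^sub>0 \<Longrightarrow> \<bar>f s\<bar> \<le> Mf" and \<delta>: "\<delta> > 0"
  shows "\<exists>K\<ge>0. \<exists>\<rho>1>0. \<forall>\<rho>. 0 < \<rho> \<and> \<rho> < \<rho>1 \<longrightarrow> emeasure m (point_ball \<T> An d t \<rho>) \<le> ennreal K \<and>
    (\<integral>\<^sup>+s\<in>point_ball \<T> An d t \<rho>. ennreal (\<bar>f s\<bar> powr \<delta>) \<partial>m) \<le> ennreal (K * \<rho> powr (min q (q' + \<alpha> * \<delta>)))"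
proof -
  have nn: "\<alpha> \<ge> 0" "q \<ge> 0" "q' \<ge> 0" using reg by (auto simp: lower_region_def)
  define L where "L = large_set \<T> An d f t \<alpha>"
  define BL where "BL \<rho> = point_ball \<T> An d t \<rho>" for \<rho>
  have L_m: "L \<in> sets m" and BL_m: "BL \<rho> \<in> sets m" for \<rho> unfolding L_def BL_def by (rule large_m ball_m)+
  let ?F = "\<lambda>\<rho>. emeasure m (BL \<rho> \<inter> L) / ennreal (\<rho> powr q) + emeasure m (BL \<rho> - L) / ennreal (\<rho> powr q')"
  have "Limsup (at_right 0) ?F < \<top>"
    using reg by (simp add: lower_region_def BL_def L_def)
  then obtain K' where K': "Limsup (at_right 0) ?F < K'" "K' < \<top>" using dense by blast
  define K where "K = enn2real K'"
  have K: "K \<ge> 0" "K' = ennreal K" using K'(2) by (auto simp: K_def)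
  have "\<forall>\<^sub>F \<rho> in at_right 0. ?F \<rho> < K'" by (rule Limsup_lessD[OF K'(1)])
  then obtain \<rho>2 where \<rho>2: "\<rho>2 > 0" "\<And>\<rho>. 0 < \<rho> \<Longrightarrow> \<rho> < \<rho>2 \<Longrightarrow> ?F \<rho> < K'"
    by (auto simp: eventually_at_right_field)
  have mL: "emeasure m (BL \<rho> \<inter> L) \<le> ennreal (K * \<rho> powr q)" "emeasure m (BL \<rho> - L) \<le> ennreal (K * \<rho> powr q')"
    if "0 < \<rho>" "\<rho> < \<rho>2" for \<rho>
  proof -
    have *: "a \<le> ennreal (K * x)" if "a / ennreal x \<le> ennreal K" "0 < x" for a x
    proof -
      have "a = a / ennreal x * ennreal x" using ennreal_divide_mult_cancel[OF that(2)] by simp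
      also have "\<dots> \<le> ennreal K * ennreal x" by (intro mult_right_mono that(1)) simp
      finally show ?thesis using K(1) that(2) by (simp add: ennreal_mult)
    qed
    have le: "?F \<rho> \<le> ennreal K" using \<rho>2(2)[OF that] K(2) by simp
    have "emeasure m (BL \<rho> \<inter> L) / ennreal (\<rho> powr q) \<le> ennreal K"
      by (rule order_trans[OF _ le]) simp
    then show "emeasure m (BL \<rho> \<inter> L) \<le> ennreal (K * \<rho> powr q)" using that by (intro *) auto
    have "emeasure m (BL \<rho> - L) / ennreal (\<rho> powr q') \<le> ennreal K"
      by (rule order_trans[OF _ le]) simp
    then show "emeasure m (BL \<rho> - L) \<le> ennreal (K * \<rho> powr q')" using that by (intro *) auto
  qed
  define \<rho>1 where "\<rho>1 = min \<rho>2 (min \<rho>\<^sub>0 1)"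
  define c1 where "c1 = \<bar>Mf\<bar> powr \<delta>"
  have c1: "c1 \<ge> 0" by (simp add: c1_def)
  \<comment> \<open>A common constant: the two parts of the ball have total measure at most
    \<open>K * 2\<close>, and the moment needs \<open>K * (c1 + 1)\<close>.\<close>
  define K2 where "K2 = K * (c1 + 2)"
  have K2: "K2 \<ge> 0" using K c1 by (simp add: K2_def)
  define w where "w = min q (q' + \<alpha> * \<delta>)"
  have main: "emeasure m (BL \<rho>) \<le> ennreal K2 \<and> (\<integral>\<^sup>+s\<in>BL \<rho>. ennreal (\<bar>f s\<bar> powr \<delta>) \<partial>m) \<le> ennreal (K2 * \<rho> powr w)"
    if \<rho>: "0 < \<rho>" "\<rho> < \<rho>1" for \<rho>
  proof
    have \<rho>': "\<rho> < \<rho>2" "\<rho> < \<rho>\<^sub>0" "\<rho> \<le> 1" using \<rho> by (auto simp: \<rho>1_def)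
    note mL' = mL[OF \<rho>(1) \<rho>'(1)]
    have p1: "\<rho> powr q \<le> 1" "\<rho> powr q' \<le> 1" using nn \<rho> \<rho>' by (auto intro!: powr_le1)
    have "emeasure m (BL \<rho>) = emeasure m (BL \<rho> \<inter> L) + emeasure m (BL \<rho> - L)"
      using BL_m L_m by (subst plus_emeasure) (auto intro!: arg_cong[where f = "emeasure m"])
    also have "\<dots> \<le> ennreal (K * \<rho> powr q) + ennreal (K * \<rho> powr q')" by (intro add_mono mL')
    also have "\<dots> \<le> ennreal K + ennreal K"
      using K p1 by (intro add_mono ennreal_leI) (auto intro: mult_left_le)
    also have "\<dots> = ennreal (K * 2)" using K by (simp add: ennreal_plus[symmetric] del: ennreal_plus)
    also have "\<dots> \<le> ennreal K2" unfolding K2_def using K c1 by (intro ennreal_leI mult_left_mono) auto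
    finally show "emeasure m (BL \<rho>) \<le> ennreal K2" .
    have "(\<integral>\<^sup>+s\<in>BL \<rho>. ennreal (\<bar>f s\<bar> powr \<delta>) \<partial>m) \<le>
      (\<integral>\<^sup>+s. ennreal c1 * indicator (BL \<rho> \<inter> L) s + ennreal (\<rho> powr (\<alpha> * \<delta>)) * indicator (BL \<rho> - L) s \<partial>m)"
    proof (rule nn_integral_mono)
      fix s
      show "ennreal (\<bar>f s\<bar> powr \<delta>) * indicator (BL \<rho>) s \<le> ennreal c1 * indicator (BL \<rho> \<inter> L) s + ennreal (\<rho> powr (\<alpha> * \<delta>)) * indicator (BL \<rho> - L) s"
      proof (cases "s \<in> BL \<rho>")
        case True
        then have s: "s \<in> space m" "dT s t < \<rho>" by (auto simp: BL_def ball_eq)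
        show ?thesis
        proof (cases "s \<in> L")
          case True
          have "s \<in> point_ball \<T> An d t \<rho>\<^sub>0" using s \<rho>' by (simp add: ball_eq)
          then have "\<bar>f s\<bar> \<le> \<bar>Mf\<bar>" using Mf by fastforce
          then have "\<bar>f s\<bar> powr \<delta> \<le> c1" unfolding c1_def using \<delta> by (intro powr_mono2) auto
          then show ?thesis using True \<open>s \<in> BL \<rho>\<close> by (simp add: ennreal_leI)
        next
          case False
          have sT: "s \<in> \<T>" using s m_space by simp
          have "rpow (dT s t) \<alpha> \<le> \<rho> powr \<alpha>"
            using s dT_nonneg[OF sT] nn \<rho> by (auto simp: rpow_def intro!: powr_mono2)
          moreover have "\<bar>f s\<bar> \<le> rpow (dT s t) \<alpha>" using False s by (simp add: L_def large_eq)
          ultimately have "\<bar>f s\<bar> \<le> \<rho> powr \<alpha>" by linarith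
          then have "\<bar>f s\<bar> powr \<delta> \<le> (\<rho> powr \<alpha>) powr \<delta>" using \<delta> by (intro powr_mono2) auto
          then show ?thesis using False \<open>s \<in> BL \<rho>\<close> by (simp add: ennreal_leI powr_powr)
        qed
      qed simp
    qed
    also have "\<dots> = ennreal c1 * emeasure m (BL \<rho> \<inter> L) + ennreal (\<rho> powr (\<alpha> * \<delta>)) * emeasure m (BL \<rho> - L)"
      using BL_m L_m by (subst nn_integral_add) (auto simp: nn_integral_cmult_indicator)
    also have "\<dots> \<le> ennreal c1 * ennreal (K * \<rho> powr q) + ennreal (\<rho> powr (\<alpha> * \<delta>)) * ennreal (K * \<rho> powr q')"
      by (intro add_mono mult_left_mono mL') auto
    also have "\<dots> = ennreal (c1 * (K * \<rho> powr q) + \<rho> powr (\<alpha> * \<delta>) * (K * \<rho> powr q'))"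
      using c1 K by (simp add: ennreal_mult ennreal_plus)
    also have "\<dots> \<le> ennreal (K2 * \<rho> powr w)"
    proof (rule ennreal_leI)
      have 1: "\<rho> powr q \<le> \<rho> powr w" using \<rho> \<rho>' by (intro powr_mono') (auto simp: w_def)
      have 2: "\<rho> powr (\<alpha> * \<delta>) * \<rho> powr q' \<le> \<rho> powr w"
        unfolding powr_add[symmetric] using \<rho> \<rho>' by (intro powr_mono') (auto simp: w_def)
      have "c1 * (K * \<rho> powr q) + \<rho> powr (\<alpha> * \<delta>) * (K * \<rho> powr q') = (K * c1) * \<rho> powr q + K * (\<rho> powr (\<alpha> * \<delta>) * \<rho> powr q')"
        by (simp add: algebra_simps)
      also have "\<dots> \<le> (K * c1) * \<rho> powr w + K * \<rho> powr w"
        using 1 2 K c1 by (intro add_mono mult_left_mono) auto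
      also have "\<dots> \<le> (K * c1) * \<rho> powr w + 2 * (K * \<rho> powr w)" using K by simp
      also have "\<dots> = K2 * \<rho> powr w" by (simp add: K2_def algebra_simps)
      finally show "c1 * (K * \<rho> powr q) + \<rho> powr (\<alpha> * \<delta>) * (K * \<rho> powr q') \<le> K2 * \<rho> powr w" .
    qed
    finally show "(\<integral>\<^sup>+s\<in>BL \<rho>. ennreal (\<bar>f s\<bar> powr \<delta>) \<partial>m) \<le> ennreal (K2 * \<rho> powr w)" .
  qed
  have "\<rho>1 > 0" using \<rho>2(1) \<rho>0 by (simp add: \<rho>1_def)
  then show ?thesis using main K2 unfolding BL_def w_def by (intro exI[of _ K2] conjI exI[of _ \<rho>1]) auto
qed

text \<open>At radius \<open>R k\<close> and level \<open>R k powr \<gamma>\<close> the probability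
  of failure is of order \<open>R k powr e\<close>, where \<open>e\<close> is the positive gap
  between the moment exponent \<open>w\<close> and \<open>\<gamma> * \<delta>\<close>. Along dyadic
  radii this is a geometric series.\<close>

lemma lower_single:
  assumes reg: "(\<alpha>, q, q') \<in> lower_region \<T> An d m f t" and \<rho>0: "\<rho>\<^sub>0 > 0"
    and Mf: "\<And>s. s \<in> point_ball \<T> An d t \<rho>\<^sub>0 \<Longrightarrow> \<bar>f s\<bar> \<le> Mf" and \<gamma>: "\<gamma> > 0"
    and \<delta>: "0 < \<delta>" "\<delta> \<le> 2" and ss: "summable_small_jumps \<nu> \<Longrightarrow> \<delta> \<le> 1" "\<not> summable_small_jumps \<nu> \<Longrightarrow> 1 \<le> \<delta>"
    and J: "(\<integral>\<^sup>+x. ennreal (\<bar>x\<bar> powr \<delta>) \<partial>\<nu>) < \<top>"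
    and q: "\<gamma> * \<delta> < q" "\<gamma> * \<delta> < q' + \<alpha> * \<delta>"
  shows "AE \<omega> in P. Limsup (at_right 0) (osc \<omega> \<gamma>) < \<top>"
proof -
  define w where "w = min q (q' + \<alpha> * \<delta>)"
  define e where "e = w - \<gamma> * \<delta>"
  have e: "e > 0" using q by (simp add: e_def w_def)
  obtain K \<rho>1 where K: "K \<ge> 0" "\<rho>1 > 0"
    "\<And>\<rho>. 0 < \<rho> \<Longrightarrow> \<rho> < \<rho>1 \<Longrightarrow> emeasure m (point_ball \<T> An d t \<rho>) \<le> ennreal K"
    "\<And>\<rho>. 0 < \<rho> \<Longrightarrow> \<rho> < \<rho>1 \<Longrightarrow> (\<integral>\<^sup>+s\<in>point_ball \<T> An d t \<rho>. ennreal (\<bar>f s\<bar> powr \<delta>) \<partial>m) \<le> ennreal (K * \<rho> powr w)"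
    using ball_moment[OF reg \<rho>0 Mf \<delta>(1)] unfolding w_def by blast
  define J' where "J' = enn2real (\<integral>\<^sup>+x. ennreal (\<bar>x\<bar> powr \<delta>) \<partial>\<nu>)"
  have J': "J' \<ge> 0" "(\<integral>\<^sup>+x. ennreal (\<bar>x\<bar> powr \<delta>) \<partial>\<nu>) = ennreal J'" using J by (auto simp: J'_def)
  define K2 where "K2 = K * J'"
  have K2: "K2 \<ge> 0" using K(1) J'(1) by (simp add: K2_def)
  \<comment> \<open>Bounds the factor from \<open>scale\<close> for all \<open>k\<close> at once:
    \<open>R k\<close> is at most 1 and the balls have measure at most \<open>K\<close>.\<close>
  define K3 where "K3 = 2 ^ p * 2 ^ p + K2 + K * measure \<nu> (tail 1)"
  have K3: "K3 \<ge> 0" using K(1) K2 by (simp add: K3_def)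
  obtain k0 where k0: "(1 / 2) ^ k0 < \<rho>1" using real_arch_pow_inv[OF K(2), of "1 / 2"] by auto
  define R where "R k = (1 / 2 :: real) ^ (k + k0)" for k
  define B where "B k = point_ball \<T> An d t (R k)" for k
  have R: "0 < R k" "R k < \<rho>1" "R k \<le> 1" for k
  proof -
    have "R k \<le> (1 / 2) ^ k0" unfolding R_def by (intro power_decreasing) auto
    then show "R k < \<rho>1" using k0 by linarith
  qed (auto simp: R_def power_le_one)
  have ex: "\<exists>bad\<in>events. prob bad \<le> (2 + 2 ^ p) * (K2 * R k powr e) \<and>
    (AE \<omega> in P. \<omega> \<notin> bad \<longrightarrow> (\<forall>C\<in>class_Ck \<A> (p - 1). C \<subseteq> B k \<longrightarrow> \<bar>DY \<omega> C\<bar> \<le> K3 * R k powr \<gamma>))" for k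
  proof -
    have Bm: "B k \<in> sets m" unfolding B_def by (rule ball_m)
    have Ble: "emeasure m (B k) \<le> ennreal K" unfolding B_def by (rule K(3)[OF R(1,2)])
    then have Bfin: "emeasure m (B k) < \<top>" by (rule order.strict_trans1) simp
    have mB: "measure m (B k) \<le> K" using Ble Bfin K(1) by (simp add: emeasure_eq_ennreal_measure ennreal_le_iff)
    define V where "V = K2 * R k powr w"
    have V0: "0 \<le> V" using K2 by (simp add: V_def)
    have V: "(\<integral>\<^sup>+z. ennreal (\<bar>jump z\<bar> powr \<delta>) * indicator (B k \<times> UNIV) z \<partial>(m \<Otimes>\<^sub>M \<nu>)) \<le> ennreal V"
    proof -
      have "(\<integral>\<^sup>+z. ennreal (\<bar>jump z\<bar> powr \<delta>) * indicator (B k \<times> UNIV) z \<partial>(m \<Otimes>\<^sub>M \<nu>)) \<le> ennreal (K * R k powr w) * ennreal J'"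
        unfolding jump_moment[OF Bm] J'(2) using K(4)[OF R(1,2), of k] by (intro mult_right_mono) (auto simp: B_def)
      also have "\<dots> = ennreal V" using K(1) J'(1) by (simp add: V_def K2_def ennreal_mult[symmetric] mult_ac)
      finally show ?thesis .
    qed
    have rpos: "R k powr \<gamma> > 0" using R(1)[of k] by simp
    have Vr: "V / (R k powr \<gamma>) powr \<delta> = K2 * R k powr e"
      by (simp add: V_def e_def powr_powr powr_diff)
    have "R k powr e \<le> 1" using powr_le1[of e "R k"] R(1,3)[of k] e by simp
    then have "K2 * R k powr e \<le> K2" using K2 by (intro mult_left_le) auto
    moreover have "measure m (B k) * measure \<nu> (tail 1) \<le> K * measure \<nu> (tail 1)" using mB by (intro mult_right_mono) auto
    ultimately have "(2 ^ p * 2 ^ p + K2 * R k powr e + measure m (B k) * measure \<nu> (tail 1)) \<le> K3" by (simp add: K3_def)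
    then have le: "(2 ^ p * 2 ^ p + K2 * R k powr e + measure m (B k) * measure \<nu> (tail 1)) * R k powr \<gamma> \<le> K3 * R k powr \<gamma>"
      using rpos by (intro mult_right_mono) auto
    obtain bad where bad: "bad \<in> events" "prob bad \<le> (2 + 2 ^ p) * (K2 * R k powr e)"
      "AE \<omega> in P. \<omega> \<notin> bad \<longrightarrow> (\<forall>C\<in>class_Ck \<A> (p - 1). C \<subseteq> B k \<longrightarrow>
        \<bar>DY \<omega> C\<bar> \<le> (2 ^ p * 2 ^ p + K2 * R k powr e + measure m (B k) * measure \<nu> (tail 1)) * R k powr \<gamma>)"
      using scale[OF Bm Bfin rpos \<delta> ss V V0] unfolding Vr by blast
    from bad(3) have "AE \<omega> in P. \<omega> \<notin> bad \<longrightarrow> (\<forall>C\<in>class_Ck \<A> (p - 1). C \<subseteq> B k \<longrightarrow> \<bar>DY \<omega> C\<bar> \<le> K3 * R k powr \<gamma>)"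
      by eventually_elim (use le in \<open>meson order_trans\<close>)
    then show ?thesis using bad(1,2) by blast
  qed
  then have "\<forall>k. \<exists>bad. bad \<in> events \<and> prob bad \<le> (2 + 2 ^ p) * (K2 * R k powr e) \<and>
    (AE \<omega> in P. \<omega> \<notin> bad \<longrightarrow> (\<forall>C\<in>class_Ck \<A> (p - 1). C \<subseteq> B k \<longrightarrow> \<bar>DY \<omega> C\<bar> \<le> K3 * R k powr \<gamma>))"
    unfolding Bex_def by (rule allI)
  from choice[OF this] obtain bad where bad': "\<forall>k. bad k \<in> events \<and> prob (bad k) \<le> (2 + 2 ^ p) * (K2 * R k powr e) \<and>
    (AE \<omega> in P. \<omega> \<notin> bad k \<longrightarrow> (\<forall>C\<in>class_Ck \<A> (p - 1). C \<subseteq> B k \<longrightarrow> \<bar>DY \<omega> C\<bar> \<le> K3 * R k powr \<gamma>))" ..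
  then have bad: "\<And>k. bad k \<in> events" "\<And>k. prob (bad k) \<le> (2 + 2 ^ p) * (K2 * R k powr e)"
    "\<And>k. AE \<omega> in P. \<omega> \<notin> bad k \<longrightarrow> (\<forall>C\<in>class_Ck \<A> (p - 1). C \<subseteq> B k \<longrightarrow> \<bar>DY \<omega> C\<bar> \<le> K3 * R k powr \<gamma>)"
    by simp_all
  have "summable (\<lambda>k. prob (bad k))"
  proof (rule summable_comparison_test')
    have "R k powr e = ((1 / 2) powr e) ^ k * ((1 / 2) powr e) ^ k0" for k
      unfolding R_def power_add[symmetric] by (simp add: powr_power powr_realpow[symmetric] powr_powr mult.commute)
    moreover have "summable (\<lambda>k. ((1 / 2 :: real) powr e) ^ k)"
      using powr_less_mono2[of e "1 / 2" 1] e by (intro summable_geometric) simp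
    ultimately show "summable (\<lambda>k. (2 + 2 ^ p) * (K2 * R k powr e))"
      by (auto intro!: summable_mult summable_mult2)
    show "norm (prob (bad k)) \<le> (2 + 2 ^ p) * (K2 * R k powr e)" if "k \<ge> 0" for k using bad(2) by simp
  qed
  then have BC: "AE \<omega> in P. \<forall>\<^sub>F k in sequentially. \<omega> \<in> space P - bad k"
    by (intro borel_cantelli_AE1 bad(1)) (auto simp: emeasure_eq_measure)
  have "AE \<omega> in P. \<forall>k. \<omega> \<notin> bad k \<longrightarrow> (\<forall>C\<in>class_Ck \<A> (p - 1). C \<subseteq> B k \<longrightarrow> \<bar>DY \<omega> C\<bar> \<le> K3 * R k powr \<gamma>)"
    unfolding AE_all_countable using bad(3) by blast
  with BC show ?thesis
  proof eventually_elim
    case (elim \<omega>)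
    obtain N where N: "\<And>k. k \<ge> N \<Longrightarrow> \<omega> \<notin> bad k" using elim(1) by (auto simp: eventually_sequentially)
    define \<rho>2 where "\<rho>2 = (1 / 2 :: real) ^ (N + k0) / 2"
    have \<rho>2: "\<rho>2 > 0" by (simp add: \<rho>2_def)
    have "osc \<omega> \<gamma> \<rho> \<le> ennreal (K3 * 4 powr \<gamma>)" if \<rho>: "0 < \<rho>" "\<rho> < \<rho>2" for \<rho>
    proof (rule SUP_least)
      fix C assume C: "C \<in> small_C \<rho>"
      \<comment> \<open>Sets at scale \<rho> lie in the ball of radius \<open>2 * \<rho>\<close>.
        The dyadic radius just above \<open>2 * \<rho>\<close> is below \<open>4 * \<rho>\<close>,
        whence the constant \<open>4 powr \<gamma>\<close>.\<close>
      have x: "2 * \<rho> < (1 / 2) ^ (N + k0)" using \<rho> by (simp add: \<rho>2_def)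
      also have "\<dots> \<le> 1" by (simp add: power_le_one)
      finally obtain k where k: "(1 / 2) ^ Suc k < 2 * \<rho>" "2 * \<rho> \<le> (1 / 2) ^ k"
        using dyadic_bracket[of "2 * \<rho>"] \<rho> by auto
      have "(1 / 2 :: real) ^ Suc k < (1 / 2) ^ (N + k0)" using k(1) x by linarith
      then have "N + k0 < Suc k" by (subst (asm) power_strict_decreasing_iff) auto
      then obtain j where j: "k = j + k0" "N \<le> j" by (metis le_add_diff_inverse2 less_Suc_eq_le add_le_imp_le_right le_add2 order_trans)
      have "C \<subseteq> point_ball \<T> An d t (2 * \<rho>)" using C by (intro class_C_ballD[OF t]) auto
      also have "\<dots> \<subseteq> B j" using k(2) j(1) by (auto simp: B_def R_def point_ball_def)
      finally have "\<bar>DY \<omega> C\<bar> \<le> K3 * R j powr \<gamma>" using elim(2) N[OF j(2)] C by blast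
      also have "\<dots> \<le> K3 * (4 * \<rho>) powr \<gamma>"
        using k(1) j(1) K3 \<gamma> R(1)[of j] by (intro mult_left_mono powr_mono2) (auto simp: R_def)
      also have "\<dots> = (K3 * 4 powr \<gamma>) * \<rho> powr \<gamma>" using \<rho> by (simp add: powr_mult)
      finally have "\<bar>DY \<omega> C\<bar> / \<rho> powr \<gamma> \<le> K3 * 4 powr \<gamma>" using \<rho> by (simp add: pos_divide_le_eq)
      then show "ennreal (\<bar>DY \<omega> C\<bar> / \<rho> powr \<gamma>) \<le> ennreal (K3 * 4 powr \<gamma>)" by (rule ennreal_leI)
    qed
    then have "\<forall>\<^sub>F \<rho> in at_right 0. osc \<omega> \<gamma> \<rho> \<le> ennreal (K3 * 4 powr \<gamma>)"
      unfolding eventually_at_right_field using \<rho>2 by blast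
    then have "Limsup (at_right 0) (osc \<omega> \<gamma>) \<le> ennreal (K3 * 4 powr \<gamma>)" by (rule Limsup_bounded)
    then show ?case by (rule order.strict_trans1) simp
  qed
qed

section \<open>Choice of the moment exponent\<close>

lemma small_jumps_mono:
  assumes "0 < \<delta>" "\<delta> \<le> \<delta>'" "(\<integral>\<^sup>+ x\<in>{x. \<bar>x\<bar> \<le> 1}. ennreal (\<bar>x\<bar> powr \<delta>) \<partial>\<nu>) < \<top>"
  shows "(\<integral>\<^sup>+ x\<in>{x. \<bar>x\<bar> \<le> 1}. ennreal (\<bar>x\<bar> powr \<delta>') \<partial>\<nu>) < \<top>"
proof -
  have "(\<integral>\<^sup>+ x\<in>{x. \<bar>x\<bar> \<le> 1}. ennreal (\<bar>x\<bar> powr \<delta>') \<partial>\<nu>) \<le> (\<integral>\<^sup>+ x\<in>{x. \<bar>x\<bar> \<le> 1}. ennreal (\<bar>x\<bar> powr \<delta>) \<partial>\<nu>)"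
    using assms by (intro nn_integral_mono) (auto simp: indicator_def intro!: ennreal_leI powr_mono')
  then show ?thesis using assms(3) by (rule order.strict_trans1)
qed

lemma all_jumps_finite:
  assumes "0 < \<delta>" "\<delta> \<le> 2" "(\<integral>\<^sup>+ x\<in>{x. \<bar>x\<bar> \<le> 1}. ennreal (\<bar>x\<bar> powr \<delta>) \<partial>\<nu>) < \<top>"
  shows "(\<integral>\<^sup>+ x. ennreal (\<bar>x\<bar> powr \<delta>) \<partial>\<nu>) < \<top>"
proof -
  have "(\<integral>\<^sup>+ x. ennreal (\<bar>x\<bar> powr \<delta>) \<partial>\<nu>) \<le>
    (\<integral>\<^sup>+ x. ennreal (\<bar>x\<bar> powr \<delta>) * indicator {x. \<bar>x\<bar> \<le> 1} x + ennreal (x\<^sup>2) \<partial>\<nu>)"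
  proof (rule nn_integral_mono)
    fix x :: real
    have "\<bar>x\<bar> powr \<delta> \<le> x\<^sup>2" if "\<not> \<bar>x\<bar> \<le> 1"
      using powr_mono[OF assms(2), of "\<bar>x\<bar>"] that by simp
    then show "ennreal (\<bar>x\<bar> powr \<delta>) \<le> ennreal (\<bar>x\<bar> powr \<delta>) * indicator {x. \<bar>x\<bar> \<le> 1} x + ennreal (x\<^sup>2)"
      by (cases "\<bar>x\<bar> \<le> 1") (auto intro: ennreal_leI)
  qed
  also have "\<dots> = (\<integral>\<^sup>+ x\<in>{x. \<bar>x\<bar> \<le> 1}. ennreal (\<bar>x\<bar> powr \<delta>) \<partial>\<nu>) + (\<integral>\<^sup>+ x. ennreal (x\<^sup>2) \<partial>\<nu>)"
    by (rule nn_integral_add) measurable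
  also have "\<dots> < \<top>" using assms(3) nu_sq by simp
  finally show ?thesis .
qed

text \<open>For \<gamma> below the claimed bound the two strict inequalities of
  \<open>lower_single\<close> hold with \<beta> in place of \<delta>, up to degenerate cases, and by
  continuity they persist for some \<delta> slightly larger. Rational \<gamma> then suffice for the
  exponent.\<close>

lemma lower_AE:
  assumes reg: "(\<alpha>, q, q') \<in> lower_region \<T> An d m f t" and \<rho>0: "\<rho>\<^sub>0 > 0"
    and Mf: "\<And>s. s \<in> point_ball \<T> An d t \<rho>\<^sub>0 \<Longrightarrow> \<bar>f s\<bar> \<le> Mf"
  shows "AE \<omega> in P. min (quot_lower q \<beta>) (quot_lower q' \<beta> + ennreal \<alpha>) \<le> expo \<omega>"
proof -
  define v where "v = min (quot_lower q \<beta>) (quot_lower q' \<beta> + ennreal \<alpha>)"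
  have nn: "\<alpha> \<ge> 0" "q \<ge> 0" "q' \<ge> 0" using reg by (auto simp: lower_region_def)
  define b where "b = enn2real \<beta>"
  have "\<beta> < \<top>" using blumenthal_getoor_le_2 by (rule order.strict_trans1) simp
  then have b: "\<beta> = ennreal b" "b \<ge> 0" by (auto simp: b_def)
  have main: "AE \<omega> in P. Limsup (at_right 0) (osc \<omega> \<gamma>) < \<top>" if \<gamma>: "\<gamma> > 0" "ennreal \<gamma> < v" for \<gamma>
  proof -
    have vq: "ennreal \<gamma> < ennreal q / ennreal b" "ennreal \<gamma> < ennreal q' / ennreal b + ennreal \<alpha>"
      using \<gamma>(2) by (auto simp: v_def quot_lower_def b)
    have c1: "\<gamma> * b < q"
    proof (cases "b = 0")
      case True
      then show ?thesis using vq(1) nn by (cases "q = 0") (auto simp: less_le)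
    next
      case False
      then have "b > 0" using b by simp
      then show ?thesis using vq(1) nn by (simp add: divide_ennreal ennreal_less_iff pos_less_divide_eq \<gamma> less_imp_le)
    qed
    \<comment> \<open>The second alternative serves the case of \<open>b\<close> and
      \<open>q'\<close> both 0: there the quotient is 0 and only \<open>\<gamma> < \<alpha>\<close>
      can be concluded.\<close>
    have c2: "(\<gamma> - \<alpha>) * b < q' \<or> \<gamma> < \<alpha>"
    proof (cases "b = 0")
      case True
      show ?thesis
      proof (cases "q' = 0")
        case True
        then show ?thesis using vq(2) \<open>b = 0\<close> nn \<gamma> by (simp add: ennreal_less_iff)
      next
        case False
        then show ?thesis using nn \<open>b = 0\<close> by simp
      qed
    next
      case False
      then have bp: "b > 0" using b by simp
      have "ennreal \<gamma> < ennreal (q' / b + \<alpha>)" using vq(2) nn bp by (simp add: divide_ennreal)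
      then have "\<gamma> < q' / b + \<alpha>" using \<gamma> by (simp add: ennreal_less_iff less_imp_le del: ennreal_plus)
      then have "\<gamma> - \<alpha> < q' / b" by simp
      then show ?thesis using bp by (simp add: pos_less_divide_eq)
    qed
    obtain h1 where h1: "h1 > 0" "\<And>\<delta>. b \<le> \<delta> \<Longrightarrow> \<delta> < b + h1 \<Longrightarrow> \<gamma> * \<delta> < q"
      using linear_less_near[OF c1] by blast
    obtain h2 where h2: "h2 > 0" "\<And>\<delta>. 0 < \<delta> \<Longrightarrow> b \<le> \<delta> \<Longrightarrow> \<delta> < b + h2 \<Longrightarrow> (\<gamma> - \<alpha>) * \<delta> < q'"
    proof (cases "\<gamma> < \<alpha>")
      case True
      have "(\<gamma> - \<alpha>) * \<delta> < q'" if "0 < \<delta>" for \<delta> using mult_neg_pos[of "\<gamma> - \<alpha>" \<delta>] True that nn by simp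
      then show ?thesis using that[of 1] by simp
    next
      case False
      then show ?thesis using linear_less_near[of "\<gamma> - \<alpha>" b q'] c2 that by blast
    qed
    let ?fin = "\<lambda>\<delta>. (\<integral>\<^sup>+ x\<in>{x. \<bar>x\<bar> \<le> 1}. ennreal (\<bar>x\<bar> powr \<delta>) \<partial>\<nu>) < \<top>"
    have "\<beta> < ennreal (b + min h1 h2)" using b h1(1) h2(1) by (simp add: ennreal_less_iff)
    then obtain \<delta>0 where \<delta>0: "\<delta>0 > 0" "?fin \<delta>0" "ennreal \<delta>0 < ennreal (b + min h1 h2)"
      unfolding blumenthal_getoor_def Inf_less_iff by auto
    have \<delta>0h: "\<delta>0 < b + min h1 h2" using \<delta>0 by (simp add: ennreal_less_iff)
    have ss1: "summable_small_jumps \<nu> \<longleftrightarrow> ?fin 1"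
      unfolding summable_small_jumps_def by (simp add: powr_one' cong: nn_integral_cong)
    \<comment> \<open>The exponent must lie on the side of 1 dictated by summability. Lowering
      \<delta>0 to 1 is harmless when small jumps are summable, and otherwise \<delta>0 already
      exceeds 1. Lowering to 2 is allowed by the finite second moment.\<close>
    define \<delta> where "\<delta> = (if summable_small_jumps \<nu> then min \<delta>0 1 else min \<delta>0 2)"
    have \<delta>: "0 < \<delta>" "\<delta> \<le> 2" "\<delta> \<le> \<delta>0" using \<delta>0 by (auto simp: \<delta>_def)
    have fin: "?fin \<delta>" using \<delta>0(2) ss1 jumps_square_small by (auto simp: \<delta>_def min_def)
    have "\<beta> \<le> ennreal \<delta>" by (rule blumenthal_getoor_le[OF \<delta>(1) fin])
    then have b\<delta>: "b \<le> \<delta>" using b \<delta>(1) by (simp add: ennreal_le_iff less_imp_le)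
    show ?thesis
    proof (rule lower_single[OF reg \<rho>0 Mf \<gamma>(1) \<delta>(1,2) _ _ all_jumps_finite[OF \<delta>(1,2) fin]])
      show "\<delta> \<le> 1" if "summable_small_jumps \<nu>" using that by (simp add: \<delta>_def)
      show "1 \<le> \<delta>" if ns: "\<not> summable_small_jumps \<nu>"
      proof -
        have "\<not> \<delta>0 \<le> 1" using small_jumps_mono[OF \<delta>0(1) _ \<delta>0(2), of 1] ns ss1 by blast
        then show ?thesis using ns by (simp add: \<delta>_def)
      qed
      show "\<gamma> * \<delta> < q" using h1(2)[OF b\<delta>] \<delta>(3) \<delta>0h by simp
      have "(\<gamma> - \<alpha>) * \<delta> < q'" using h2(2)[OF \<delta>(1) b\<delta>] \<delta>(3) \<delta>0h by simp
      then show "\<gamma> * \<delta> < q' + \<alpha> * \<delta>" by (simp add: left_diff_distrib)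
    qed
  qed
  have "AE \<omega> in P. \<forall>a::rat. 0 < a \<and> ennreal (real_of_rat a) < v \<longrightarrow> Limsup (at_right 0) (osc \<omega> (real_of_rat a)) < \<top>"
    unfolding AE_all_countable
  proof
    fix a :: rat
    show "AE \<omega> in P. 0 < a \<and> ennreal (real_of_rat a) < v \<longrightarrow> Limsup (at_right 0) (osc \<omega> (real_of_rat a)) < \<top>"
      using main[of "real_of_rat a"] by (cases "0 < a \<and> ennreal (real_of_rat a) < v") auto
  qed
  then show ?thesis
  proof eventually_elim
    case (elim \<omega>)
    show ?case unfolding v_def[symmetric]
    proof (rule ccontr)
      assume "\<not> v \<le> expo \<omega>"
      then have "expo \<omega> < v" by simp
      then obtain a :: rat where a: "expo \<omega> < ennreal (real_of_rat a)" "ennreal (real_of_rat a) < v"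
        using ennreal_rat_dense by blast
      have "0 < ennreal (real_of_rat a)" using a(1) by (rule le_less_trans[rotated]) simp
      then have a0: "0 < a" by simp
      then have "Limsup (at_right 0) (osc \<omega> (real_of_rat a)) < \<top>" using elim a(2) by blast
      then have "ennreal (real_of_rat a) \<le> expo \<omega>"
        unfolding localized_exponent_def using a0 by (intro Sup_upper CollectI exI[of _ "real_of_rat a"]) auto
      then show False using a(1) by simp
    qed
  qed
qed

end

theorem theorem4p16:
  fixes \<T> :: "'a set" and \<A> :: "'a set set" and An :: "nat \<Rightarrow> 'a set set"
    and d :: "'a set \<Rightarrow> 'a set \<Rightarrow> real" and m :: "'a measure"
    and P :: "'w measure" and \<sigma> :: real and \<nu> :: "real measure"
    and B :: "'a set \<Rightarrow> 'w \<Rightarrow> real" and \<Xi> :: "'w \<Rightarrow> ('a \<times> real) set"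
    and X Y :: "'a set \<Rightarrow> 'w \<Rightarrow> real" and f :: "'a \<Rightarrow> real"
    and t :: 'a and \<rho>\<^sub>0 :: real
  assumes "indexing_collection \<T> \<A> An"
    and "finite_dim \<A> An"
    and "compatible_metric \<T> \<A> An d"
    and "space m = \<T>" and "sets m = sigma_sets \<T> \<A>"
    and "\<forall>A\<in>\<A>. emeasure m A < \<top>"
    and "compatible_metric \<T> \<A> An (measure_dist m)"
    and "prob_space P" and "complete_measure P"
    and "\<sigma> \<ge> 0" and "L2_levy_measure \<nu>"
    and "set_indexed_BM P \<A> m B"
    and "poisson_random_set P (m \<Otimes>\<^sub>M \<nu>) \<Xi>"
    and "indep_BM_Poisson P \<A> B (m \<Otimes>\<^sub>M \<nu>) \<Xi>"
    and "levy_process P \<A> m \<sigma> \<nu> B \<Xi> X"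
    and "locally_integrable \<A> m \<sigma> \<nu> f"
    and "levy_integral P \<A> m \<sigma> \<nu> B \<Xi> f Y"
    and "t \<in> \<T>"
    and "\<sigma>\<^sup>2 = 0"
    and "\<rho>\<^sub>0 > 0" and "bdd_above ((\<lambda>s. \<bar>f s\<bar>) ` point_ball \<T> An d t \<rho>\<^sub>0)"
  shows "AE \<omega> in P.
    (SUP (\<alpha>, q, q') \<in> lower_region \<T> An d m f t.
        min (quot_lower q (blumenthal_getoor \<nu>))
            (quot_lower q' (blumenthal_getoor \<nu>) + ennreal \<alpha>))
      \<le> localized_exponent \<T> \<A> An d (\<lambda>A. Y A \<omega>) (point_set \<T> An t) \<and>
    localized_exponent \<T> \<A> An d (\<lambda>A. Y A \<omega>) (point_set \<T> An t)
      \<le> (INF (\<alpha>, q) \<in> upper_region \<T> An d m f t.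
           quot_upper q (blumenthal_getoor \<nu>) + ennreal \<alpha>)"
proof -
  have f_meas: "f \<in> borel_measurable m" using assms(16) by (simp add: locally_integrable_def)
  have \<sigma>: "\<sigma> = 0" using assms(19) by simp
  have A_m: "A \<in> sets m" if "A \<in> \<A>" for A using that assms(5) by auto
  \<comment> \<open>If small jumps are not summable, \<nu> has positive second moment, so local
    integrability puts \<open>f\<close> in \<open>L\<^sup>2\<close> on \<open>A\<close>; finite
    measure of \<open>A\<close> then gives \<open>L\<^sup>1\<close>.\<close>
  have f_int: "set_integrable m A f" if ns: "\<not> summable_small_jumps \<nu>" and A: "A \<in> \<A>" for A
  proof -
    note [measurable] = f_meas A_m[OF A]
    let ?J = "\<integral>\<^sup>+ x. ennreal (x\<^sup>2) \<partial>\<nu>"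
    let ?I = "\<integral>\<^sup>+ s. ennreal ((f s * indicator A s)\<^sup>2) \<partial>m"
    have "ennreal ((triplet_drift \<nu> + (LINT x:{x. \<bar>x\<bar> > 1}|\<nu>. x))\<^sup>2) *
          (\<integral>\<^sup>+ s. ennreal \<bar>f s * indicator A s\<bar> \<partial>m)\<^sup>2 + (ennreal (\<sigma>\<^sup>2) + ?J) * ?I < \<top>"
      using assms(16) A unfolding locally_integrable_def by blast
    then have JI: "?J * ?I < \<top>" using \<sigma> by simp
    have nus: "sets \<nu> = sets borel" using assms(11) by (simp add: L2_levy_measure_def)
    note [measurable_cong] = nus
    have "?J \<noteq> 0"
    proof
      assume "?J = 0"
      then have "AE x in \<nu>. ennreal (x\<^sup>2) = 0" by (subst nn_integral_0_iff_AE[symmetric]) auto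
      then have "AE x in \<nu>. ennreal \<bar>x\<bar> * indicator {x. \<bar>x\<bar> \<le> 1} x = 0" by eventually_elim simp
      then have "(\<integral>\<^sup>+ x\<in>{x. \<bar>x\<bar> \<le> 1}. ennreal \<bar>x\<bar> \<partial>\<nu>) = 0" by (subst nn_integral_0_iff_AE) auto
      then show False using ns by (simp add: summable_small_jumps_def)
    qed
    then have I: "?I < \<top>" using JI by (auto simp: ennreal_mult_less_top)
    show ?thesis unfolding set_integrable_def
    proof (rule integrableI_bounded)
      show "(\<lambda>x. indicator A x *\<^sub>R f x) \<in> borel_measurable m" by measurable
      have "(\<integral>\<^sup>+ x. ennreal (norm (indicator A x *\<^sub>R f x)) \<partial>m) \<le> (\<integral>\<^sup>+ x. indicator A x + ennreal ((f x * indicator A x)\<^sup>2) \<partial>m)"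
      proof (rule nn_integral_mono)
        fix x
        have "\<bar>y\<bar> \<le> 1 + y\<^sup>2" for y :: real
        proof -
          have "0 \<le> (\<bar>y\<bar> - 1)\<^sup>2 + \<bar>y\<bar>" by simp
          then have "0 \<le> 1 - \<bar>y\<bar> + \<bar>y\<bar>\<^sup>2" by (simp add: power2_eq_square algebra_simps)
          then show ?thesis by simp
        qed
        then have "ennreal \<bar>f x\<bar> \<le> ennreal (1 + (f x)\<^sup>2)" by (rule ennreal_leI)
        then show "ennreal (norm (indicator A x *\<^sub>R f x)) \<le> indicator A x + ennreal ((f x * indicator A x)\<^sup>2)"
          by (simp add: indicator_def)
      qed
      also have "\<dots> = emeasure m A + ?I" by (subst nn_integral_add) auto
      also have "\<dots> < \<infinity>" using I assms(6) A by simp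
      finally show "(\<integral>\<^sup>+ x. ennreal (norm (indicator A x *\<^sub>R f x)) \<partial>m) < \<infinity>" .
    qed
  qed
  have Y_lim: "jump_integral P \<A> m \<nu> \<Xi> f Y"
  proof -
    obtain L where L: "jump_integral P \<A> m \<nu> \<Xi> f L" "\<And>A \<omega>. A \<in> \<A> \<Longrightarrow> \<omega> \<in> space P \<Longrightarrow> Y A \<omega> = L A \<omega>"
      using assms(17) \<sigma> by (auto simp: levy_integral_def)
    show ?thesis unfolding jump_integral_def
    proof
      fix A assume "A \<in> \<A>"
      then have "AE \<omega> in P. uniform_limit {A' \<in> \<A>. A' \<subseteq> A}
          (\<lambda>\<epsilon> A'. jump_integral_eps m \<nu> \<Xi> f \<epsilon> A' \<omega>) (\<lambda>A'. L A' \<omega>) (at_right 0)"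
        using L(1) by (simp add: jump_integral_def)
      then show "AE \<omega> in P. uniform_limit {A' \<in> \<A>. A' \<subseteq> A}
          (\<lambda>\<epsilon> A'. jump_integral_eps m \<nu> \<Xi> f \<epsilon> A' \<omega>) (\<lambda>A'. Y A' \<omega>) (at_right 0)"
        using AE_space by eventually_elim (use L(2) in \<open>simp add: uniform_limit_iff\<close>)
    qed
  qed
  interpret prob_space P by (rule assms(8))
  interpret levy_setting \<T> \<A> An d P m \<nu> \<Xi> f Y t
  proof unfold_locales
    show "indexing_collection \<T> \<A> An" by (rule assms(1))
    show "compatible_metric \<T> \<A> An d" by (rule assms(3))
    show "poisson_random_set P (m \<Otimes>\<^sub>M \<nu>) \<Xi>" by (rule assms(13))
    show "finite_dim \<A> An" by (rule assms(2))
    show "space m = \<T>" by (rule assms(4))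
    show "sets m = sigma_sets \<T> \<A>" by (rule assms(5))
    show "emeasure m A < \<top>" if "A \<in> \<A>" for A using assms(6) that by (rule bspec)
    show "compatible_metric \<T> \<A> An (measure_dist m)" by (rule assms(7))
    show "L2_levy_measure \<nu>" by (rule assms(11))
    show "f \<in> borel_measurable m" by (rule f_meas)
    show "set_integrable m A f" if "\<not> summable_small_jumps \<nu>" "A \<in> \<A>" for A by (rule f_int[OF that])
    show "jump_integral P \<A> m \<nu> \<Xi> f Y" by (rule Y_lim)
    show "t \<in> \<T>" by (rule assms(18))
  qed
  obtain Mf where Mf: "\<And>s. s \<in> point_ball \<T> An d t \<rho>\<^sub>0 \<Longrightarrow> \<bar>f s\<bar> \<le> Mf"
    using assms(21) unfolding bdd_above_def by blast
  let ?L = "\<lambda>(\<alpha>, q, q'). min (quot_lower q \<beta>) (quot_lower q' \<beta> + ennreal \<alpha>)"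
  let ?U = "\<lambda>(\<alpha>, q). quot_upper q \<beta> + ennreal \<alpha>"
  let ?RL = "lower_region \<T> An d m f t"
  let ?RU = "upper_region \<T> An d m f t"
  have lower: "AE \<omega> in P. (SUP x\<in>?RL. ?L x) \<le> expo \<omega>"
  proof (cases "?RL = {}")
    case False
    \<comment> \<open>The region is uncountable, but in \<open>ennreal\<close> its supremum is
      attained along a sequence of values, so countably many null sets are enough; the infimum is
      treated in the same way.\<close>
    then obtain g :: "nat \<Rightarrow> ennreal" where g: "range g \<subseteq> ?L ` ?RL" "(SUP x\<in>?RL. ?L x) = (SUP n. g n)"
      using ennreal_SUP_countable_SUP[of ?RL ?L] by blast
    have "AE \<omega> in P. g n \<le> expo \<omega>" for n
    proof -
      have "g n \<in> ?L ` ?RL" using g(1) by blast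
      then obtain x where "x \<in> ?RL" "g n = ?L x" by (rule imageE)
      then obtain \<alpha> q q' where "(\<alpha>, q, q') \<in> ?RL" "g n = ?L (\<alpha>, q, q')" by (cases x) auto
      then show ?thesis using lower_AE[OF _ assms(20) Mf, of \<alpha> q q'] by simp
    qed
    then have "AE \<omega> in P. \<forall>n. g n \<le> expo \<omega>" unfolding AE_all_countable by blast
    then show ?thesis unfolding g(2) by eventually_elim (auto intro: SUP_least)
  qed simp
  have upper: "AE \<omega> in P. expo \<omega> \<le> (INF x\<in>?RU. ?U x)"
  proof (cases "?RU = {}")
    case False
    then have "?U ` ?RU \<noteq> {}" by blast
    from ennreal_Inf_countable_INF[OF this] obtain g :: "nat \<Rightarrow> ennreal"
      where g: "range g \<subseteq> ?U ` ?RU" "(INF x\<in>?RU. ?U x) = (INF n. g n)" by (elim exE conjE)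
    have "AE \<omega> in P. expo \<omega> \<le> g n" for n
    proof -
      have "g n \<in> ?U ` ?RU" using g(1) by blast
      then obtain x where "x \<in> ?RU" "g n = ?U x" by (rule imageE)
      then obtain \<alpha> q where "(\<alpha>, q) \<in> ?RU" "g n = ?U (\<alpha>, q)" by (cases x) auto
      then show ?thesis using upper_AE[of \<alpha> q] by simp
    qed
    then have "AE \<omega> in P. \<forall>n. expo \<omega> \<le> g n" unfolding AE_all_countable by blast
    then show ?thesis unfolding g(2) by eventually_elim (auto intro: INF_greatest)
  qed simp
  show ?thesis using lower upper by eventually_elim simp
qed

end
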